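(* Consider the delay-Doppler domain modulation with ZAK receiver described in the context, with positive integers $M,N,L$, $T>0$, $\Delta f=1/T$, fixed channel parameters $h_i\in\mathbb{C}$, $0<\tau_i<T$, $\nu_i\in\mathbb{R}$ ($i=1,\dots,L$), and let $\rho$ denote the ratio of the average transmit power to the received noise power in the communication bandwidth $M\Delta f$. With i.i.d. (zero-mean circularly symmetric) complex Gaussian information symbols, the spectral efficiency achieved is $$C=\frac{1}{MN}\log_2\left|\mathbf{I}+\rho\,\tilde{\mathbf{H}}^H\tilde{\mathbf{K}}^{-1}\tilde{\mathbf{H}}\right|,$$ where $|\cdot|$ is the determinant, $\mathbf{I}$ is the $MN\times MN$ identity matrix, and $\tilde{\mathbf{H}},\tilde{\mathbf{K}}\in\mathbb{C}^{MN\times MN}$ have entries, for $k,k'=0,\dots,N-1$ and $l,l'=0,\dots,M-1$, $$\tilde H[k'M+l'+1,\,kM+l+1]=\tilde h[k',l',k,l],$$ $$\tilde K[k'M+l'+1,\,kM+l+1]=\begin{cases}1+\frac1N,&k'=k,\ l'=l,\\ \frac1N,&k'\neq k,\ l'=l,\\ 0,&l'\neq l,\end{cases}$$ with $$\begin{aligned}\tilde h[k',l',k,l]=\frac{1}{MN}\sum_{i=1}^{L}h_i\Bigg\{&e^{j2\pi\frac{\nu_i}{\Delta f}\left(\frac{l'}{M}-\frac{\tau_i}{T}\right)}\,e^{-j\pi(N-1)\left(\frac{k'}{N}-\frac{k}{N}-\frac{\nu_i}{\Delta f}\right)}\,e^{j2\pi\left(\frac{k'}{N}-\frac{\nu_i}{\Delta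 f}\right)\left(\frac{l'}{M}-\frac{\tau_i}{T}-\frac{l}{M}\right)}\\ &\times e^{-j2\pi\left\lfloor\frac{k'}{N}-\frac{\nu_i}{\Delta f}\right\rfloor\left(\frac{l'}{M}-\frac{\tau_i}{T}-\frac{l}{M}\right)}\,e^{j\pi(M-1)\left(\frac{l'}{M}-\frac{\tau_i}{T}-\frac{l}{M}\right)}\\ &\times\frac{\sin\left[\pi N\left(\frac{k'}{N}-\frac{k}{N}-\frac{\nu_i}{\Delta f}\right)\right]}{\sin\left[\pi\left(\frac{k'}{N}-\frac{k}{N}-\frac{\nu_i}{\Delta f}\right)\right]}\,\frac{\sin\left[\pi M\left(\frac{l'}{M}-\frac{l}{M}-\frac{\tau_i}{T}\right)\right]}{\sin\left[\pi\left(\frac{l'}{M}-\frac{l}{M}-\frac{\tau_i}{T}\right)\right]}\Bigg\}.\end{aligned}$$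
   Context: Here $j=\sqrt{-1}$, $^H$ is conjugate transpose, $\lfloor\cdot\rfloor$ is the floor function, $A[p,q]$ is the entry in row $p$ and column $q$ of $\mathbf{A}$, and $\mathcal{CN}(0,\sigma^2)$ is the zero-mean circularly symmetric complex Gaussian distribution with variance $\sigma^2$. Ratios $\sin(\pi Nu)/\sin(\pi u)$, $\sin(\pi Mu)/\sin(\pi u)$ are extended by continuity at zeros of the denominators. Modulation: information symbols $x[k,l]$, $k=0,\dots,N-1$, $l=0,\dots,M-1$, i.i.d. $\mathcal{CN}(0,P)$ with $P>0$, are sent as $$x(t)=\sum_{k=0}^{N-1}\sum_{l=0}^{M-1}x[k,l]\,\alpha_{(k,l)}(t),\qquad\alpha_{(k,l)}(t)=\sqrt{\tfrac{T}{MN}}\sum_{n=0}^{N-1}e^{j2\pi\frac{nk}{N}}\int_0^{M\Delta f}e^{j2\pi f\left(t-\frac{lT}{M}-nT\right)}df.$$ The average transmit power is $\frac{1}{NT}\,\mathbb{E}\int_{-\infty}^{\infty}|x(t)|^2dt$. Channel: $y(t)=\sum_{i=1}^{L}h_i\,x(t-\tau_i)e^{j2\pi\nu_i(t-\tau_i)}+n(t)$, with $n(t)$ additive white Gaussian noise, independent of the symbols, of power spectral density $N_0>0$; the received noise power in bandwidth $M\Delta f$ is $N_0M\Delta f$. The channel parameters are fixed and known at the receiver. ZAK receiver: it samples the ZAK representation $\mathcal{Z}_y(\tau,\nu)=\sqrt{T}\sum_{n}y(\tau+nT)e^{-j2\pi n\nu T}$ at $\tau=l'T/M$, $\nu=k'\Delta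 f/N$, giving $$Y[k',l']=\sqrt{MN}\sum_{k=0}^{N-1}\sum_{l=0}^{M-1}x[k,l]\,\tilde h[k',l',k,l]+Z[k',l'],\qquad k'=0,\dots,N-1,\ l'=0,\dots,M-1,$$ with $\tilde h$ as in the claim. Since the received signal is taken to be limited to the time interval $[0,(N+1)T)$, the noise terms are $$Z[k',l']=\sqrt{T}\sum_{n'=0}^{N}n\!\left(n'T+\tfrac{l'T}{M}\right)e^{-j2\pi\frac{n'k'}{N}},$$ where the noise samples $n(n'T+l'T/M)$, $n'=0,\dots,N$, $l'=0,\dots,M-1$, are i.i.d. $\mathcal{CN}(0,N_0M\Delta f)$ (noise limited to the bandwidth $M\Delta f$). The spectral efficiency achieved is the mutual information (in bits) between the vector of all $MN$ symbols $x[k,l]$ and the vector of all $MN$ samples $Y[k',l']$, divided by the time-bandwidth product $NT\cdot M\Delta f=MN$. *)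

theory Defs
  imports
    "HOL-Probability.Probability"
    "Jordan_Normal_Form.Determinant"
    "Jordan_Normal_Form.Gauss_Jordan_Elimination"
    "Jordan_Normal_Form.Schur_Decomposition"
begin

text \<open>Zero-mean circularly symmetric complex Gaussian law of variance \<open>s\<close>, so that real and
  imaginary part each have variance \<open>s / 2\<close>.\<close>

definition complex_gaussian :: "'a measure \<Rightarrow> real \<Rightarrow> ('a \<Rightarrow> complex) \<Rightarrow> bool" where
  "complex_gaussian Om s X \<longleftrightarrow>
     distributed Om lborel X (\<lambda>z. ennreal (exp (- (cmod z)\<^sup>2 / s) / (pi * s)))"

definition family_vec :: "'i set \<Rightarrow> 'j set \<Rightarrow> ('i \<Rightarrow> 'j \<Rightarrow> 'a \<Rightarrow> complex) \<Rightarrow> 'a \<Rightarrow> ('i \<times> 'j \<Rightarrow> complex)" where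
  "family_vec I J X \<omega> = (\<lambda>(i, j) \<in> I \<times> J. X i j \<omega>)"

abbreviation complex_vec_space :: "'i set \<Rightarrow> 'j set \<Rightarrow> ('i \<times> 'j \<Rightarrow> complex) measure" where
  "complex_vec_space I J \<equiv> Pi\<^sub>M (I \<times> J) (\<lambda>_. borel)"

definition iid_complex_gaussian ::
  "'a measure \<Rightarrow> real \<Rightarrow> 'i set \<Rightarrow> 'j set \<Rightarrow> ('i \<Rightarrow> 'j \<Rightarrow> 'a \<Rightarrow> complex) \<Rightarrow> bool" where
  "iid_complex_gaussian Om s I J X \<longleftrightarrow>
     (\<forall>i\<in>I. \<forall>j\<in>J. complex_gaussian Om s (X i j)) \<and>
     prob_space.indep_vars Om (\<lambda>_. borel) (\<lambda>(i, j). X i j) (I \<times> J)"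

definition dd_pulse :: "nat \<Rightarrow> nat \<Rightarrow> real \<Rightarrow> real \<Rightarrow> nat \<Rightarrow> nat \<Rightarrow> real \<Rightarrow> complex" where
  "dd_pulse M N T df k l t =
     complex_of_real (sqrt (T / (real M * real N))) *
     (\<Sum>n<N. cis (2 * pi * (real n * real k / real N)) *
        integral {0..real M * df}
          (\<lambda>f. cis (2 * pi * f * (t - real l * T / real M - real n * T))))"

definition tx_signal ::
  "nat \<Rightarrow> nat \<Rightarrow> real \<Rightarrow> real \<Rightarrow> (nat \<Rightarrow> nat \<Rightarrow> 'a \<Rightarrow> complex) \<Rightarrow> 'a \<Rightarrow> real \<Rightarrow> complex" where
  "tx_signal M N T df x \<omega> t = (\<Sum>k<N. \<Sum>l<M. x k l \<omega> * dd_pulse M N T df k l t)"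

definition avg_tx_power ::
  "'a measure \<Rightarrow> nat \<Rightarrow> nat \<Rightarrow> real \<Rightarrow> real \<Rightarrow> (nat \<Rightarrow> nat \<Rightarrow> 'a \<Rightarrow> complex) \<Rightarrow> real" where
  "avg_tx_power Om M N T df x =
     1 / (real N * T) *
     prob_space.expectation Om (\<lambda>\<omega>. LINT t|lborel. (cmod (tx_signal M N T df x \<omega> t))\<^sup>2)"

text \<open>The quotient \<open>sin (\<pi>nu) / sin (\<pi>u)\<close>, extended by continuity to the integers.\<close>

definition sin_ratio :: "nat \<Rightarrow> real \<Rightarrow> real" where
  "sin_ratio n u =
     (if sin (pi * u) = 0 then Lim (at u) (\<lambda>v. sin (pi * real n * v) / sin (pi * v))
      else sin (pi * real n * u) / sin (pi * u))"

definition dd_channel ::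
  "nat \<Rightarrow> nat \<Rightarrow> nat \<Rightarrow> real \<Rightarrow> real \<Rightarrow> (nat \<Rightarrow> complex) \<Rightarrow> (nat \<Rightarrow> real) \<Rightarrow> (nat \<Rightarrow> real) \<Rightarrow>
   nat \<Rightarrow> nat \<Rightarrow> nat \<Rightarrow> nat \<Rightarrow> complex" where
  "dd_channel M N L T df h \<tau> \<nu> k' l' k l =
     1 / (of_nat M * of_nat N) *
     (\<Sum>i = 1..L. h i *
       (cis (2 * pi * (\<nu> i / df) * (real l' / real M - \<tau> i / T)) *
        cis (- pi * (real N - 1) * (real k' / real N - real k / real N - \<nu> i / df)) *
        cis (2 * pi * (real k' / real N - \<nu> i / df) *
              (real l' / real M - \<tau> i / T - real l / real M)) *
        cis (- 2 * pi * of_int \<lfloor>real k' / real N - \<nu> i / df\<rfloor> *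
              (real l' / real M - \<tau> i / T - real l / real M)) *
        cis (pi * (real M - 1) * (real l' / real M - \<tau> i / T - real l / real M)) *
        of_real (sin_ratio N (real k' / real N - real k / real N - \<nu> i / df)) *
        of_real (sin_ratio M (real l' / real M - real l / real M - \<tau> i / T))))"

text \<open>\<open>w t\<close> is the band-limited noise at time \<open>t\<close>; only its values on the grid
  \<open>n' T + l' T / M\<close> with \<open>n' \<le> N\<close> and \<open>l' < M\<close> matter, since the received signal is taken to be
  limited to \<open>[0, (N + 1) T)\<close>.\<close>

definition noise_sample ::
  "nat \<Rightarrow> real \<Rightarrow> (real \<Rightarrow> 'a \<Rightarrow> complex) \<Rightarrow> nat \<Rightarrow> nat \<Rightarrow> 'a \<Rightarrow> complex" where
  "noise_sample M T w n' l' = w (real n' * T + real l' * T / real M)"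

definition zak_noise ::
  "nat \<Rightarrow> nat \<Rightarrow> real \<Rightarrow> (real \<Rightarrow> 'a \<Rightarrow> complex) \<Rightarrow> nat \<Rightarrow> nat \<Rightarrow> 'a \<Rightarrow> complex" where
  "zak_noise M N T w k' l' \<omega> =
     complex_of_real (sqrt T) *
     (\<Sum>n'\<le>N. noise_sample M T w n' l' \<omega> * cis (- 2 * pi * (real n' * real k' / real N)))"

text \<open>The samples of the ZAK representation of the received signal at delay \<open>l' T / M\<close> and Doppler
  \<open>k' df / N\<close>, given by the discrete input-output relation of the channel. This relation is taken as
  the model rather than derived from the waveform: when \<open>k' / N - \<nu> i / df\<close> is an integer, the floor
  convention in \<open>dd_channel\<close> weights the band edges \<open>0\<close> and \<open>M df\<close> by 1 and 0, whereas the pointwise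
  sum of the ZAK series weights both by one half.\<close>

definition zak_output ::
  "nat \<Rightarrow> nat \<Rightarrow> nat \<Rightarrow> real \<Rightarrow> real \<Rightarrow> (nat \<Rightarrow> complex) \<Rightarrow> (nat \<Rightarrow> real) \<Rightarrow> (nat \<Rightarrow> real) \<Rightarrow>
   (nat \<Rightarrow> nat \<Rightarrow> 'a \<Rightarrow> complex) \<Rightarrow> (real \<Rightarrow> 'a \<Rightarrow> complex) \<Rightarrow> nat \<Rightarrow> nat \<Rightarrow> 'a \<Rightarrow> complex" where
  "zak_output M N L T df h \<tau> \<nu> x w k' l' \<omega> =
     complex_of_real (sqrt (real M * real N)) *
       (\<Sum>k<N. \<Sum>l<M. x k l \<omega> * dd_channel M N L T df h \<tau> \<nu> k' l' k l)
     + zak_noise M N T w k' l' \<omega>"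

definition spectral_efficiency ::
  "'a measure \<Rightarrow> nat \<Rightarrow> nat \<Rightarrow> nat \<Rightarrow> real \<Rightarrow> real \<Rightarrow> (nat \<Rightarrow> complex) \<Rightarrow> (nat \<Rightarrow> real) \<Rightarrow>
   (nat \<Rightarrow> real) \<Rightarrow> (nat \<Rightarrow> nat \<Rightarrow> 'a \<Rightarrow> complex) \<Rightarrow> (real \<Rightarrow> 'a \<Rightarrow> complex) \<Rightarrow> real" where
  "spectral_efficiency Om M N L T df h \<tau> \<nu> x w =
     prob_space.mutual_information Om 2
       (complex_vec_space {..<N} {..<M}) (complex_vec_space {..<N} {..<M})
       (family_vec {..<N} {..<M} x)
       (family_vec {..<N} {..<M} (zak_output M N L T df h \<tau> \<nu> x w))
     / ((real N * T) * (real M * df))"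

text \<open>Row and column indices start at 0, so that position \<open>k M + l\<close> stands for the pair
  \<open>(k, l)\<close> with \<open>l < M\<close>.\<close>

definition H_mat ::
  "nat \<Rightarrow> nat \<Rightarrow> nat \<Rightarrow> real \<Rightarrow> real \<Rightarrow> (nat \<Rightarrow> complex) \<Rightarrow> (nat \<Rightarrow> real) \<Rightarrow> (nat \<Rightarrow> real) \<Rightarrow>
   complex mat" where
  "H_mat M N L T df h \<tau> \<nu> = mat (M * N) (M * N)
     (\<lambda>(p, q). dd_channel M N L T df h \<tau> \<nu> (p div M) (p mod M) (q div M) (q mod M))"

definition K_mat :: "nat \<Rightarrow> nat \<Rightarrow> complex mat" where
  "K_mat M N = mat (M * N) (M * N)
     (\<lambda>(p, q). if p mod M \<noteq> q mod M then 0
               else if p div M = q div M then 1 + 1 / of_nat N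
               else 1 / of_nat N)"

definition capacity_mat ::
  "nat \<Rightarrow> nat \<Rightarrow> nat \<Rightarrow> real \<Rightarrow> real \<Rightarrow> (nat \<Rightarrow> complex) \<Rightarrow> (nat \<Rightarrow> real) \<Rightarrow> (nat \<Rightarrow> real) \<Rightarrow>
   real \<Rightarrow> complex mat" where
  "capacity_mat M N L T df h \<tau> \<nu> \<rho> =
     1\<^sub>m (M * N) + complex_of_real \<rho> \<cdot>\<^sub>m
       (mat_adjoint (H_mat M N L T df h \<tau> \<nu>) * the (mat_inverse (K_mat M N))
          * H_mat M N L T df h \<tau> \<nu>)"

end

theory Submission
  imports Defs
begin

text \<open>The noise samples at \<open>n' = 0\<close> and \<open>n' = N\<close> enter the ZAK noise with the same phase. Adding them
  leaves \<open>MN\<close> independent Gaussian variables \<open>U\<close>, so the noise is \<open>B U\<close> with an \<open>MN \<times> MN\<close> matrix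
  \<open>B\<close> satisfying \<open>B B\<^sup>H = N\<^sub>0 M N K\<close>; in particular \<open>B\<close> is invertible.
  Mutual information does not change when the output is multiplied by \<open>B\<inverse>\<close>, which reduces the
  claim to a channel \<open>Y = A X + U\<close> with white noise. There the joint density of \<open>(X, Y)\<close> is
  explicit; completing the square in \<open>X\<close> and evaluating a Gaussian integral by successive Schur
  complements gives the density of \<open>Y\<close>. The quadratic terms in the expected logarithm of the density
  ratio cancel, and what is left is \<open>log\<^sub>2 det (I + P A\<^sup>H A)\<close>. Finally
  \<open>A\<^sup>H A = H\<^sup>H K\<inverse> H / N\<^sub>0\<close>, and \<open>\<rho> = P / N\<^sub>0\<close> because each pulse is a combination of
  shifted sinc functions, which are orthogonal.\<close>

section \<open>Complex Gaussian densities\<close>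

text \<open>No Jacobian determinant of a matrix is ever computed. For fixed \<open>x\<close> the map
  from \<open>v\<close> to \<open>A x + v\<close> is a translation, so the joint density of input
  and output needs only translation invariance of Lebesgue measure and exists even when
  \<open>A\<close> is singular. Determinants come only from the Gaussian integral, where the form
  \<open>I / P + A^H A\<close> is positive definite for every \<open>A\<close>. The quadratic terms
  cancel because the output precision matrix \<open>R\<close> and the output covariance
  \<open>I + P A A^H\<close> are inverse to each other: the expectation of \<open>y^H R y\<close> is
  the trace of their product, \<open>n\<close>, which is also the expected energy of
  \<open>n\<close> unit-variance noise variables. The entries \<open>1 / N\<close> of
  \<open>K\<close> come from one surplus sample: \<open>N + 1\<close> samples meet phases of period
  \<open>N\<close>, so \<open>n' = 0\<close> gets weight 2, and its phase 1 spreads the surplus over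
  all Doppler pairs with the same delay. The scales fit since \<open>B B^H\<close> carries
  \<open>N0 M N\<close>, the square of the factor \<open>sqrt (M N)\<close> in the ZAK output
  supplies \<open>M N\<close>, and the remaining \<open>1 / N0\<close> combines with
  \<open>P\<close> to \<open>\<rho>\<close>.\<close>

lemma nn_integral_lborel_complex_prod:
  fixes f g :: "real \<Rightarrow> ennreal"
  assumes [measurable]: "f \<in> borel_measurable borel" "g \<in> borel_measurable borel"
  shows "(\<integral>\<^sup>+z. f (Re z) * g (Im z) \<partial>lborel) = (\<integral>\<^sup>+x. f x \<partial>lborel) * (\<integral>\<^sup>+x. g x \<partial>lborel)"
proof -
  have "(\<integral>\<^sup>+z. (\<Prod>b\<in>(Basis :: complex set). (if b = 1 then f else g) (z \<bullet> b)) \<partial>lborel)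
      = (\<Prod>b\<in>(Basis :: complex set). \<integral>\<^sup>+x. (if b = 1 then f else g) x \<partial>lborel)"
    by (rule nn_integral_lborel_prod[where f="\<lambda>b. if b = 1 then f else g"]) auto
  then show ?thesis
    by (simp add: Basis_complex_def)
qed

abbreviation cg_density :: "real \<Rightarrow> complex \<Rightarrow> real" where
  "cg_density s z \<equiv> exp (- (cmod z)\<^sup>2 / s) / (pi * s)"

text \<open>The variance \<open>s\<close> is shared equally by real and imaginary part, hence the
  standard deviation \<open>sqrt (s / 2)\<close> of each factor.\<close>

lemma cg_density_eq_normal:
  assumes "0 < s"
  shows "cg_density s z = normal_density 0 (sqrt (s / 2)) (Re z) * normal_density 0 (sqrt (s / 2)) (Im z)"
proof -
  have "exp (- (cmod z)\<^sup>2 / s) = exp (- (Re z)\<^sup>2 / s) * exp (- (Im z)\<^sup>2 / s)"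
    by (simp add: cmod_power2 flip: exp_add add: diff_divide_distrib)
  moreover have "sqrt (pi * s) * sqrt (pi * s) = pi * s"
    using assms by simp
  ultimately show ?thesis
    using assms by (simp add: normal_density_def field_simps)
qed

lemma nn_integral_normal_moment:
  assumes "0 < \<sigma>"
  shows "(\<integral>\<^sup>+x. ennreal (normal_density 0 \<sigma> x) \<partial>lborel) = 1"
    and "(\<integral>\<^sup>+x. ennreal (x\<^sup>2 * normal_density 0 \<sigma> x) \<partial>lborel) = ennreal (\<sigma>\<^sup>2)"
proof -
  show "(\<integral>\<^sup>+x. ennreal (normal_density 0 \<sigma> x) \<partial>lborel) = 1"
    using assms by (subst nn_integral_eq_integral) auto
  have "has_bochner_integral lborel (\<lambda>x. normal_density 0 \<sigma> x * (x - 0) ^ (2 * 1))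
          (fact (2 * 1) / ((2 / \<sigma>\<^sup>2) ^ 1 * fact 1))"
    by (rule normal_moment_even[OF assms])
  then have "has_bochner_integral lborel (\<lambda>x. x\<^sup>2 * normal_density 0 \<sigma> x) (\<sigma>\<^sup>2)"
    by (simp add: mult.commute)
  then show "(\<integral>\<^sup>+x. ennreal (x\<^sup>2 * normal_density 0 \<sigma> x) \<partial>lborel) = ennreal (\<sigma>\<^sup>2)"
    by (subst nn_integral_eq_integral) (auto simp: has_bochner_integral_iff)
qed

lemma nn_integral_cg_density:
  assumes "0 < s"
  shows "(\<integral>\<^sup>+z. ennreal (cg_density s z) \<partial>lborel) = 1"
    and "(\<integral>\<^sup>+z. ennreal ((cmod z)\<^sup>2 * cg_density s z) \<partial>lborel) = ennreal s"
proof -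
  let ?n = "normal_density 0 (sqrt (s / 2))"
  have pos: "0 < sqrt (s / 2)" using assms by simp
  note n = nn_integral_normal_moment[OF pos]
  show "(\<integral>\<^sup>+z. ennreal (cg_density s z) \<partial>lborel) = 1"
    using nn_integral_lborel_complex_prod[of "\<lambda>x. ennreal (?n x)" "\<lambda>x. ennreal (?n x)"] n(1)
    unfolding cg_density_eq_normal[OF assms] by (simp add: ennreal_mult)
  have "(\<integral>\<^sup>+z. ennreal ((cmod z)\<^sup>2 * cg_density s z) \<partial>lborel) =
     (\<integral>\<^sup>+z. ennreal ((Re z)\<^sup>2 * ?n (Re z)) * ennreal (?n (Im z))
         + ennreal (?n (Re z)) * ennreal ((Im z)\<^sup>2 * ?n (Im z)) \<partial>lborel)"
    unfolding cg_density_eq_normal[OF assms]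
    by (intro nn_integral_cong)
       (simp add: cmod_power2 ennreal_mult[symmetric] ennreal_plus[symmetric] algebra_simps del: ennreal_plus)
  also have "\<dots> = ennreal (s / 2) + ennreal (s / 2)"
    using assms n
    by (subst nn_integral_add) (simp_all add: nn_integral_lborel_complex_prod[of "\<lambda>x. ennreal (x\<^sup>2 * ?n x)" "\<lambda>x. ennreal (?n x)"]
      nn_integral_lborel_complex_prod[of "\<lambda>x. ennreal (?n x)" "\<lambda>x. ennreal (x\<^sup>2 * ?n x)"])
  also have "\<dots> = ennreal s"
    using assms by (simp add: ennreal_plus[symmetric] del: ennreal_plus)
  finally show "(\<integral>\<^sup>+z. ennreal ((cmod z)\<^sup>2 * cg_density s z) \<partial>lborel) = ennreal s" .
qed

text \<open>Translation invariance removes \<open>c\<close>; what remains is \<open>pi / q\<close>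
  times the density of variance \<open>1 / q\<close>. This is the integral over one eliminated
  variable, both in the convolution of two Gaussian laws and in the recursion for quadratic
  forms.\<close>

lemma nn_integral_exp_cmod_shift:
  fixes c :: complex
  assumes "0 < q"
  shows "(\<integral>\<^sup>+z. ennreal (exp (- q * (cmod (c + z))\<^sup>2)) \<partial>lborel) = ennreal (pi / q)"
proof -
  have "(\<integral>\<^sup>+z. ennreal (exp (- q * (cmod (c + z))\<^sup>2)) \<partial>lborel)
      = (\<integral>\<^sup>+z. ennreal (exp (- q * (cmod z)\<^sup>2)) \<partial>distr lborel borel ((+) c))"
    by (subst nn_integral_distr) auto
  also have "\<dots> = (\<integral>\<^sup>+z. ennreal (pi / q) * ennreal (cg_density (1 / q) z) \<partial>lborel)"
    using assms by (simp add: lborel_distr_plus ennreal_mult[symmetric] field_simps)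
  also have "\<dots> = ennreal (pi / q)"
    using assms nn_integral_cg_density(1)[of "1 / q"] by (subst nn_integral_cmult) auto
  finally show ?thesis .
qed

text \<open>Tonelli with \<open>v\<close> as the inner variable: for fixed \<open>x\<close> the map
  \<open>a x\<close> preserves \<open>T\<close>, so the inner integral may be rewritten in
  \<open>y = a x v\<close> with no Jacobian factor. A left inverse \<open>s x\<close> is enough to
  express \<open>v\<close> through \<open>y\<close>. Sums of independent variables and the linear
  channel are both instances.\<close>

lemma (in prob_space) distributed_shear:
  fixes f :: "'b \<Rightarrow> ennreal" and g :: "'b \<Rightarrow> ennreal"
  assumes "sigma_finite_measure S" "sigma_finite_measure T"
    and X: "distributed M S X f" and V: "distributed M T V g" and indep: "indep_var S X T V"
    and a[measurable]: "(\<lambda>(x, v). a x v) \<in> S \<Otimes>\<^sub>M T \<rightarrow>\<^sub>M T"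
    and s[measurable]: "(\<lambda>(x, v). s x v) \<in> S \<Otimes>\<^sub>M T \<rightarrow>\<^sub>M T"
    and inv: "\<And>x v. x \<in> space S \<Longrightarrow> v \<in> space T \<Longrightarrow> s x (a x v) = v"
    and preserving: "\<And>x. x \<in> space S \<Longrightarrow> distr T T (a x) = T"
  shows "distributed M (S \<Otimes>\<^sub>M T) (\<lambda>\<omega>. (X \<omega>, a (X \<omega>) (V \<omega>))) (\<lambda>(x, y). f x * g (s x y))"
proof -
  interpret S: sigma_finite_measure S by fact
  interpret T: sigma_finite_measure T by fact
  interpret ST: pair_sigma_finite S T ..
  have XV: "distributed M (S \<Otimes>\<^sub>M T) (\<lambda>\<omega>. (X \<omega>, V \<omega>)) (\<lambda>(x, v). f x * g v)"
    by (rule distributed_joint_indep[OF assms(1,2) X V indep])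
  have [measurable]: "X \<in> M \<rightarrow>\<^sub>M S" "V \<in> M \<rightarrow>\<^sub>M T" "f \<in> borel_measurable S" "g \<in> borel_measurable T"
    using X V by (auto simp: distributed_def)
  have am: "a x \<in> T \<rightarrow>\<^sub>M T" if "x \<in> space S" for x
    using measurable_compose[OF measurable_Pair1'[OF that] a] by simp
  have a': "(\<lambda>p. a (fst p) (snd p)) \<in> S \<Otimes>\<^sub>M T \<rightarrow>\<^sub>M T"
    using a by (simp add: case_prod_beta')
  have s': "(\<lambda>p. s (fst p) (snd p)) \<in> S \<Otimes>\<^sub>M T \<rightarrow>\<^sub>M T"
    using s by (simp add: case_prod_beta')
  have aXV: "(\<lambda>\<omega>. a (X \<omega>) (V \<omega>)) \<in> M \<rightarrow>\<^sub>M T"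
    using measurable_compose[OF measurable_Pair[of X M S V T] a] by simp
  have sm: "s x \<in> T \<rightarrow>\<^sub>M T" if "x \<in> space S" for x
    using measurable_compose[OF measurable_Pair1'[OF that] s] by simp
  have gs: "(\<lambda>p. g (s (fst p) (snd p))) \<in> borel_measurable (S \<Otimes>\<^sub>M T)"
    by (rule measurable_compose[OF s']) simp
  have "distr M (S \<Otimes>\<^sub>M T) (\<lambda>\<omega>. (X \<omega>, a (X \<omega>) (V \<omega>)))
      = density (S \<Otimes>\<^sub>M T) (\<lambda>(x, y). f x * g (s x y))"
  proof (rule measure_eqI)
    fix A assume "A \<in> sets (distr M (S \<Otimes>\<^sub>M T) (\<lambda>\<omega>. (X \<omega>, a (X \<omega>) (V \<omega>))))"
    then have A[measurable]: "A \<in> sets (S \<Otimes>\<^sub>M T)" by simp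
    have indm: "(\<lambda>(x, v). indicator A (x, a x v) :: ennreal) \<in> borel_measurable (S \<Otimes>\<^sub>M T)"
      using measurable_compose[OF measurable_Pair[OF measurable_fst a'] borel_measurable_indicator[OF A]]
      by (simp add: case_prod_beta')
    have "emeasure (distr M (S \<Otimes>\<^sub>M T) (\<lambda>\<omega>. (X \<omega>, a (X \<omega>) (V \<omega>)))) A
        = (\<integral>\<^sup>+\<omega>. (\<lambda>(x, v). indicator A (x, a x v)) (X \<omega>, V \<omega>) \<partial>M)"
    proof -
      have "(\<lambda>\<omega>. (X \<omega>, a (X \<omega>) (V \<omega>))) \<in> M \<rightarrow>\<^sub>M S \<Otimes>\<^sub>M T"
        using aXV by measurable
      then have "(\<integral>\<^sup>+p. indicator A p \<partial>distr M (S \<Otimes>\<^sub>M T) (\<lambda>\<omega>. (X \<omega>, a (X \<omega>) (V \<omega>))))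
          = (\<integral>\<^sup>+\<omega>. indicator A (X \<omega>, a (X \<omega>) (V \<omega>)) \<partial>M)"
        by (rule nn_integral_distr)
          (use A in \<open>intro borel_measurable_indicator; simp only: sets_distr\<close>)
      moreover have "emeasure (distr M (S \<Otimes>\<^sub>M T) (\<lambda>\<omega>. (X \<omega>, a (X \<omega>) (V \<omega>)))) A
          = (\<integral>\<^sup>+p. indicator A p \<partial>distr M (S \<Otimes>\<^sub>M T) (\<lambda>\<omega>. (X \<omega>, a (X \<omega>) (V \<omega>))))"
        by (rule nn_integral_indicator[symmetric]) (use A in \<open>simp only: sets_distr\<close>)
      ultimately show ?thesis
        by (simp only: prod.case)
    qed
    also have "\<dots> = (\<integral>\<^sup>+p. (\<lambda>(x, v). f x * g v) p * (\<lambda>(x, v). indicator A (x, a x v)) p \<partial>(S \<Otimes>\<^sub>M T))"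
      by (rule distributed_nn_integral[OF XV indm, symmetric])
    also have "\<dots> = (\<integral>\<^sup>+x. \<integral>\<^sup>+v. f x * g v * indicator A (x, a x v) \<partial>T \<partial>S)"
      using indm by (subst T.nn_integral_fst[symmetric]) (auto simp: case_prod_beta')
    also have "\<dots> = (\<integral>\<^sup>+x. \<integral>\<^sup>+y. f x * g (s x y) * indicator A (x, y) \<partial>T \<partial>S)"
    proof (rule nn_integral_cong)
      fix x assume x: "x \<in> space S"
      have m: "(\<lambda>y. f x * g (s x y) * indicator A (x, y)) \<in> borel_measurable T"
        by (intro borel_measurable_times_ennreal borel_measurable_const measurable_compose[OF sm[OF x]]
            measurable_compose[OF measurable_Pair1'[OF x] borel_measurable_indicator[OF A]]) fact
      have "(\<integral>\<^sup>+v. f x * g v * indicator A (x, a x v) \<partial>T)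
          = (\<integral>\<^sup>+v. (\<lambda>y. f x * g (s x y) * indicator A (x, y)) (a x v) \<partial>T)"
        by (intro nn_integral_cong) (simp add: inv x)
      also have "\<dots> = (\<integral>\<^sup>+y. f x * g (s x y) * indicator A (x, y) \<partial>distr T T (a x))"
        by (rule nn_integral_distr[symmetric, OF am[OF x]]) (use m in simp)
      finally show "(\<integral>\<^sup>+v. f x * g v * indicator A (x, a x v) \<partial>T)
          = (\<integral>\<^sup>+y. f x * g (s x y) * indicator A (x, y) \<partial>T)"
        by (simp add: preserving x)
    qed
    also have "\<dots> = (\<integral>\<^sup>+p. (\<lambda>(x, y). f x * g (s x y)) p * indicator A p \<partial>(S \<Otimes>\<^sub>M T))"
      using gs by (subst T.nn_integral_fst[symmetric]) (auto simp: case_prod_beta')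
    also have "\<dots> = emeasure (density (S \<Otimes>\<^sub>M T) (\<lambda>(x, y). f x * g (s x y))) A"
      using gs by (subst emeasure_density) (auto simp: case_prod_beta')
    finally show "emeasure (distr M (S \<Otimes>\<^sub>M T) (\<lambda>\<omega>. (X \<omega>, a (X \<omega>) (V \<omega>)))) A = \<dots>" .
  qed simp
  then show ?thesis
    using gs aXV by (auto simp: distributed_def case_prod_beta')
qed

section \<open>Moments, scaling and sums of complex Gaussian variables\<close>

lemma complex_gaussian_measurable: "complex_gaussian Om s X \<Longrightarrow> X \<in> borel_measurable Om"
  by (auto simp: complex_gaussian_def distributed_def)

text \<open>The second moment is read off the density and dominates the first. The mean vanishes
  because density and Lebesgue measure are both invariant under \<open>uminus\<close>, so the
  expectation equals its own negative.\<close>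

lemma (in prob_space) complex_gaussian_moments:
  assumes "0 < s" and X: "complex_gaussian M s X"
  shows "integrable M (\<lambda>\<omega>. (cmod (X \<omega>))\<^sup>2)" and "expectation (\<lambda>\<omega>. (cmod (X \<omega>))\<^sup>2) = s"
    and "integrable M X" and "expectation X = 0"
proof -
  note [measurable] = complex_gaussian_measurable[OF X]
  have D: "distributed M lborel X (\<lambda>z. ennreal (cg_density s z))"
    using X by (simp add: complex_gaussian_def)
  have "(\<integral>\<^sup>+\<omega>. ennreal ((cmod (X \<omega>))\<^sup>2) \<partial>M) = (\<integral>\<^sup>+z. ennreal (cg_density s z) * ennreal ((cmod z)\<^sup>2) \<partial>lborel)"
    by (rule distributed_nn_integral[OF D, symmetric]) simp
  also have "\<dots> = ennreal s"
    using assms(1) nn_integral_cg_density(2)[of s] by (simp add: ennreal_mult[symmetric] mult.commute)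
  finally have nn: "(\<integral>\<^sup>+\<omega>. ennreal ((cmod (X \<omega>))\<^sup>2) \<partial>M) = ennreal s" .
  show sq: "integrable M (\<lambda>\<omega>. (cmod (X \<omega>))\<^sup>2)"
    using nn by (intro integrableI_nonneg) auto
  show "expectation (\<lambda>\<omega>. (cmod (X \<omega>))\<^sup>2) = s"
    using nn assms(1) by (subst integral_eq_nn_integral) auto
  show int: "integrable M X"
  proof (rule Bochner_Integration.integrable_bound[of M "\<lambda>\<omega>. 1 + (cmod (X \<omega>))\<^sup>2"])
    show "AE \<omega> in M. norm (X \<omega>) \<le> norm (1 + (cmod (X \<omega>))\<^sup>2)"
    proof (rule AE_I2)
      fix \<omega>
      \<comment> \<open>This square bounds the modulus by \<open>1 / 4\<close> plus its own square,
        hence by the integrable majorant.\<close>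
      have "0 \<le> (cmod (X \<omega>) - 1 / 2)\<^sup>2" by simp
      then show "norm (X \<omega>) \<le> norm (1 + (cmod (X \<omega>))\<^sup>2)"
        by (simp add: power2_eq_square algebra_simps)
    qed
  qed (use sq in auto)
  have E: "expectation X = (LINT z|lborel. cg_density s z *\<^sub>R z)"
  proof -
    have "expectation X = (LINT z|distr M lborel X. z)"
      by (subst integral_distr) auto
    also have "distr M lborel X = density lborel (\<lambda>z. ennreal (cg_density s z))"
      using D by (simp add: distributed_def)
    also have "(LINT z|\<dots>. z) = (LINT z|lborel. cg_density s z *\<^sub>R z)"
      using assms(1) by (subst integral_density) auto
    finally show ?thesis .
  qed
  have neg: "(lborel :: complex measure) = distr lborel borel uminus"
    using lborel_affine[of "-1" "0 :: complex"] by (simp add: density_1)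
  have "(LINT z|lborel. cg_density s z *\<^sub>R z) = (LINT z|distr lborel borel uminus. cg_density s z *\<^sub>R z)"
    by (subst neg) (rule refl)
  also have "\<dots> = (LINT z|lborel. cg_density s z *\<^sub>R (- z))"
    by (subst integral_distr) auto
  also have "\<dots> = - (LINT z|lborel. cg_density s z *\<^sub>R z)"
    by simp
  finally show "expectation X = 0"
    unfolding E by simp
qed

text \<open>Multiplication by \<open>c\<close> on the plane has Jacobian \<open>c\<^sup>2\<close>,
  the power \<open>DIM(complex)\<close> in the affine transformation rule. This is exactly the ratio
  of the two normalising constants, while the exponents agree.\<close>

lemma (in prob_space) complex_gaussian_scale:
  assumes "0 < s" "0 < c" and X: "complex_gaussian M s X"
  shows "complex_gaussian M (c\<^sup>2 * s) (\<lambda>\<omega>. complex_of_real c * X \<omega>)"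
proof -
  note [measurable] = complex_gaussian_measurable[OF X]
  have D: "distributed M lborel X (\<lambda>z. ennreal (cg_density s z))"
    using X by (simp add: complex_gaussian_def)
  have "distr M lborel (\<lambda>\<omega>. complex_of_real c * X \<omega>) = density lborel (\<lambda>z. ennreal (cg_density (c\<^sup>2 * s) z))"
  proof (rule measure_eqI)
    fix A :: "complex set" assume "A \<in> sets (distr M lborel (\<lambda>\<omega>. complex_of_real c * X \<omega>))"
    then have A[measurable]: "A \<in> sets borel" by simp
    have "emeasure (distr M lborel (\<lambda>\<omega>. complex_of_real c * X \<omega>)) A
        = (\<integral>\<^sup>+z. indicator A z \<partial>distr M lborel (\<lambda>\<omega>. complex_of_real c * X \<omega>))"
      by simp
    also have "\<dots> = (\<integral>\<^sup>+\<omega>. indicator A (complex_of_real c * X \<omega>) \<partial>M)"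
      by (rule nn_integral_distr) auto
    also have "\<dots> = (\<integral>\<^sup>+z. ennreal (cg_density s z) * indicator A (complex_of_real c * z) \<partial>lborel)"
      by (rule distributed_nn_integral[OF D, symmetric]) measurable
    also have "\<dots> = (\<integral>\<^sup>+z. ennreal (cg_density (c\<^sup>2 * s) (0 + c *\<^sub>R z)) * indicator A (0 + c *\<^sub>R z) * ennreal (c\<^sup>2) \<partial>lborel)"
      using assms(1,2) by (intro nn_integral_cong)
        (auto simp: scaleR_conv_of_real norm_mult power_mult_distrib ennreal_mult[symmetric] indicator_def)
    also have "\<dots> = (\<integral>\<^sup>+z. ennreal (cg_density (c\<^sup>2 * s) z) * indicator A z * ennreal (c\<^sup>2)
        \<partial>distr lborel borel (\<lambda>z. 0 + c *\<^sub>R z))"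
      by (rule nn_integral_distr[symmetric]) measurable
    also have "\<dots> = (\<integral>\<^sup>+z. ennreal (cg_density (c\<^sup>2 * s) z) * indicator A z
        \<partial>density (distr lborel borel (\<lambda>z. 0 + c *\<^sub>R z)) (\<lambda>_. \<bar>c\<bar> ^ DIM(complex)))"
      by (subst nn_integral_density) (auto simp: mult.commute mult.left_commute)
    also have "density (distr lborel borel (\<lambda>z. 0 + c *\<^sub>R z)) (\<lambda>_. \<bar>c\<bar> ^ DIM(complex)) = (lborel :: complex measure)"
      using assms(2) lborel_affine[of c "0 :: complex"] by simp
    also have "(\<integral>\<^sup>+z. ennreal (cg_density (c\<^sup>2 * s) z) * indicator A z \<partial>lborel)
       = emeasure (density lborel (\<lambda>z. ennreal (cg_density (c\<^sup>2 * s) z))) A"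
      by (subst emeasure_density) auto
    finally show "emeasure (distr M lborel (\<lambda>\<omega>. complex_of_real c * X \<omega>)) A = \<dots>" .
  qed simp
  then show ?thesis
    by (auto simp: complex_gaussian_def distributed_def)
qed

text \<open>The joint law of \<open>X\<close> and \<open>X + Y\<close> is a shear of that of
  \<open>X\<close> and \<open>Y\<close>; integrating out the first coordinate leaves the convolution
  of the densities, evaluated by completing the square.\<close>

lemma (in prob_space) complex_gaussian_add:
  assumes st: "0 < s" "0 < t" and X: "complex_gaussian M s X" and Y: "complex_gaussian M t Y"
    and indep: "indep_var borel X borel Y"
  shows "complex_gaussian M (s + t) (\<lambda>\<omega>. X \<omega> + Y \<omega>)"
proof -
  have DX: "distributed M lborel X (\<lambda>z. ennreal (cg_density s z))"
    and DY: "distributed M lborel Y (\<lambda>z. ennreal (cg_density t z))"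
    using X Y by (simp_all add: complex_gaussian_def)
  have indep': "indep_var lborel X lborel Y"
    using indep unfolding indep_var_distribution_eq
    by (auto simp: cong: distr_cong sets_pair_measure_cong)
  have "distributed M (lborel \<Otimes>\<^sub>M lborel) (\<lambda>\<omega>. (X \<omega>, X \<omega> + Y \<omega>))
      (\<lambda>(x, y). ennreal (cg_density s x) * ennreal (cg_density t (y - x)))"
    by (rule distributed_shear[OF sigma_finite_lborel sigma_finite_lborel DX DY indep',
          where a="(+)" and s="\<lambda>x y. y - x"])
       (auto simp: lborel_distr_plus cong: distr_cong)
  then have D: "distributed M lborel (\<lambda>\<omega>. X \<omega> + Y \<omega>)
      (\<lambda>y. \<integral>\<^sup>+x. (\<lambda>(x, y). ennreal (cg_density s x) * ennreal (cg_density t (y - x))) (x, y) \<partial>lborel)"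
    by (rule distr_marginal2[OF sigma_finite_lborel sigma_finite_lborel])
  have "(\<integral>\<^sup>+x. ennreal (cg_density s x) * ennreal (cg_density t (y - x)) \<partial>lborel) = ennreal (cg_density (s + t) y)" for y
  proof -
    \<comment> \<open>\<open>q\<close> is the precision of \<open>X\<close> given that the sum
      equals \<open>y\<close>, and \<open>- c\<close> is its conditional mean.\<close>
    define q where "q = 1 / s + 1 / t"
    define c where "c = - (s / (s + t)) *\<^sub>R y"
    have q: "0 < q" using st by (auto simp: q_def intro!: add_pos_pos)
    have st0: "s \<noteq> 0" "t \<noteq> 0" "s + t \<noteq> 0" using st by auto
    have sq: "(cmod x)\<^sup>2 / s + (cmod (y - x))\<^sup>2 / t = q * (cmod (c + x))\<^sup>2 + (cmod y)\<^sup>2 / (s + t)" for x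
    proof -
      have real: "a\<^sup>2 / s + (b - a)\<^sup>2 / t = q * (- (s / (s + t)) * b + a)\<^sup>2 + b\<^sup>2 / (s + t)" for a b :: real
        using st0 unfolding q_def
        by (simp add: divide_simps) (simp add: power2_eq_square algebra_simps)
      show ?thesis
        using real[of "Re x" "Re y"] real[of "Im x" "Im y"]
        by (simp add: cmod_power2 c_def add_divide_distrib algebra_simps)
    qed
    have "(\<integral>\<^sup>+x. ennreal (cg_density s x) * ennreal (cg_density t (y - x)) \<partial>lborel)
       = (\<integral>\<^sup>+x. ennreal (exp (- (cmod y)\<^sup>2 / (s + t)) / (pi * s * (pi * t))) * ennreal (exp (- q * (cmod (c + x))\<^sup>2)) \<partial>lborel)"
    proof (rule nn_integral_cong)
      fix x
      have "exp (- (cmod x)\<^sup>2 / s) * exp (- (cmod (y - x))\<^sup>2 / t)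
          = exp (- (cmod y)\<^sup>2 / (s + t)) * exp (- q * (cmod (c + x))\<^sup>2)"
        unfolding exp_add[symmetric] using sq[of x] by simp
      then show "ennreal (cg_density s x) * ennreal (cg_density t (y - x))
        = ennreal (exp (- (cmod y)\<^sup>2 / (s + t)) / (pi * s * (pi * t))) * ennreal (exp (- q * (cmod (c + x))\<^sup>2))"
        using st by (subst (1 2) ennreal_mult[symmetric]) auto
    qed
    also have "\<dots> = ennreal (exp (- (cmod y)\<^sup>2 / (s + t)) / (pi * s * (pi * t))) * ennreal (pi / q)"
      by (subst nn_integral_cmult) (simp_all only: nn_integral_exp_cmod_shift[OF q], measurable)
    also have "\<dots> = ennreal (cg_density (s + t) y)"
    proof -
      have "pi / q = pi * s * (pi * t) / (pi * (s + t))"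
      proof -
        have "q = (s + t) / (s * t)"
          using st by (simp add: q_def field_simps)
        then show ?thesis
          using st by (simp add: power2_eq_square)
      qed
      then show ?thesis
        using st q by (subst ennreal_mult[symmetric]) simp_all
    qed
    finally show ?thesis .
  qed
  then have "distributed M lborel (\<lambda>\<omega>. X \<omega> + Y \<omega>) (\<lambda>y. ennreal (cg_density (s + t) y))"
    using D by simp
  then show ?thesis
    by (simp add: complex_gaussian_def)
qed

section \<open>Lebesgue measure on families of complex numbers\<close>

interpretation lborel_family: product_sigma_finite "\<lambda>_. lborel :: complex measure" ..

lemma sigma_finite_PiM_lborel:
  "finite J \<Longrightarrow> sigma_finite_measure (PiM J (\<lambda>_. lborel :: complex measure))"
  by (rule lborel_family.sigma_finite)

text \<open>It suffices to compare both measures on boxes, where the claim splits into translation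
  invariance in each coordinate. This is the measure preservation that the shear of the channel
  requires.\<close>

lemma distr_PiM_lborel_translation:
  fixes c :: "'i \<Rightarrow> complex"
  assumes "finite J"
  shows "distr (PiM J (\<lambda>_. lborel)) (PiM J (\<lambda>_. lborel)) (\<lambda>v. \<lambda>i\<in>J. c i + v i) = PiM J (\<lambda>_. lborel)"
proof (rule lborel_family.PiM_eqI[OF assms])
  fix A :: "'i \<Rightarrow> complex set" assume A: "\<And>i. i \<in> J \<Longrightarrow> A i \<in> sets lborel"
  have m: "(\<lambda>v. \<lambda>i\<in>J. c i + v i) \<in> PiM J (\<lambda>_. lborel) \<rightarrow>\<^sub>M PiM J (\<lambda>_. lborel)"
    by measurable
  have "emeasure (distr (PiM J (\<lambda>_. lborel)) (PiM J (\<lambda>_. lborel)) (\<lambda>v. \<lambda>i\<in>J. c i + v i)) (Pi\<^sub>E J A)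
     = emeasure (PiM J (\<lambda>_. lborel)) (Pi\<^sub>E J (\<lambda>i. (+) (c i) -` A i))"
    using A assms by (subst emeasure_distr[OF m])
      (auto intro!: arg_cong2[where f=emeasure] sets_PiM_I_finite simp: space_PiM PiE_iff Pi_iff split: if_splits)
  also have "\<dots> = (\<Prod>i\<in>J. emeasure lborel ((+) (c i) -` A i))"
  proof (rule lborel_family.emeasure_PiM[OF assms])
    fix i assume "i \<in> J"
    then show "(+) (c i) -` A i \<in> sets lborel"
      using A[of i] measurable_sets[of "(+) (c i)" borel borel "A i"] by simp
  qed
  also have "\<dots> = (\<Prod>i\<in>J. emeasure lborel (A i))"
  proof (rule prod.cong[OF refl])
    fix i assume i: "i \<in> J"
    have "emeasure lborel (A i) = emeasure (distr lborel borel ((+) (c i))) (A i)"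
      by (simp add: lborel_distr_plus)
    also have "\<dots> = emeasure lborel ((+) (c i) -` A i)"
      using A[OF i] by (subst emeasure_distr) auto
    finally show "emeasure lborel ((+) (c i) -` A i) = emeasure lborel (A i)" ..
  qed
  finally show "emeasure (distr (PiM J (\<lambda>_. lborel)) (PiM J (\<lambda>_. lborel)) (\<lambda>v. \<lambda>i\<in>J. c i + v i)) (Pi\<^sub>E J A)
     = (\<Prod>i\<in>J. emeasure lborel (A i))" .
qed simp

text \<open>The density measure agrees on boxes with the product of the laws, and independence
  identifies that product with the law of the whole family.\<close>

lemma (in prob_space) distributed_PiM_lborel:
  fixes X :: "'i \<Rightarrow> 'a \<Rightarrow> complex" and f :: "'i \<Rightarrow> complex \<Rightarrow> ennreal"
  assumes J: "finite J" "J \<noteq> {}"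
    and indep: "indep_vars (\<lambda>_. borel) X J"
    and X: "\<And>i. i \<in> J \<Longrightarrow> distributed M lborel (X i) (f i)"
  shows "distributed M (PiM J (\<lambda>_. lborel)) (\<lambda>\<omega>. \<lambda>i\<in>J. X i \<omega>) (\<lambda>x. \<Prod>i\<in>J. f i (x i))"
proof -
  have fm[measurable]: "\<And>i. i \<in> J \<Longrightarrow> f i \<in> borel_measurable borel"
    and Xm[measurable]: "\<And>i. i \<in> J \<Longrightarrow> X i \<in> M \<rightarrow>\<^sub>M borel"
    and Xd: "\<And>i. i \<in> J \<Longrightarrow> distr M lborel (X i) = density lborel (f i)"
    using X by (auto simp: distributed_def)
  have dens_m: "(\<lambda>x. \<Prod>i\<in>J. f i (x i)) \<in> borel_measurable (PiM J (\<lambda>_. lborel))"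
    by measurable
  have sets_eq: "sets (PiM J (\<lambda>_. borel)) = sets (PiM J (\<lambda>_. lborel :: complex measure))"
    by (intro sets_PiM_cong) auto
  \<comment> \<open>The locale demands sigma-finiteness at every index, also outside
    \<open>J\<close>, where nothing is assumed about \<open>X\<close>; \<open>lborel\<close> serves
    as default there.\<close>
  interpret D: product_sigma_finite "\<lambda>i. if i \<in> J then distr M borel (X i) else lborel"
    by (rule product_sigma_finite.intro)
       (auto intro!: prob_space_imp_sigma_finite prob_space_distr Xm sigma_finite_lborel)
  have PiM_eq: "PiM J (\<lambda>i. distr M borel (X i)) = PiM J (\<lambda>i. if i \<in> J then distr M borel (X i) else lborel)"
    by (intro PiM_cong) auto
  have "density (PiM J (\<lambda>_. lborel)) (\<lambda>x. \<Prod>i\<in>J. f i (x i)) = PiM J (\<lambda>i. distr M borel (X i))"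
    unfolding PiM_eq
  proof (rule D.PiM_eqI[OF J(1)])
    show "sets (density (PiM J (\<lambda>_. lborel)) (\<lambda>x. \<Prod>i\<in>J. f i (x i)))
      = sets (PiM J (\<lambda>i. if i \<in> J then distr M borel (X i) else lborel))"
      unfolding sets_density by (intro sets_PiM_cong) auto
  next
    fix A assume "\<And>i. i \<in> J \<Longrightarrow> A i \<in> sets (if i \<in> J then distr M borel (X i) else lborel)"
    then have A[measurable]: "\<And>i. i \<in> J \<Longrightarrow> A i \<in> sets borel" by auto
    have "emeasure (density (PiM J (\<lambda>_. lborel)) (\<lambda>x. \<Prod>i\<in>J. f i (x i))) (Pi\<^sub>E J A)
       = (\<integral>\<^sup>+x. (\<Prod>i\<in>J. f i (x i)) * indicator (Pi\<^sub>E J A) x \<partial>PiM J (\<lambda>_. lborel))"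
      using J(1) A by (intro emeasure_density dens_m sets_PiM_I_finite) auto
    also have "\<dots> = (\<integral>\<^sup>+x. (\<Prod>i\<in>J. f i (x i) * indicator (A i) (x i)) \<partial>PiM J (\<lambda>_. lborel))"
    proof (rule nn_integral_cong)
      fix x :: "'i \<Rightarrow> complex" assume x: "x \<in> space (PiM J (\<lambda>_. lborel))"
      then have "indicator (Pi\<^sub>E J A) x = (\<Prod>i\<in>J. indicator (A i) (x i) :: ennreal)"
        using J(1) by (auto simp: indicator_def PiE_iff space_PiM)
      then show "(\<Prod>i\<in>J. f i (x i)) * indicator (Pi\<^sub>E J A) x = (\<Prod>i\<in>J. f i (x i) * indicator (A i) (x i))"
        by (simp add: prod.distrib)
    qed
    also have "\<dots> = (\<Prod>i\<in>J. \<integral>\<^sup>+x. f i x * indicator (A i) x \<partial>lborel)"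
      using J(1) by (intro lborel_family.product_nn_integral_prod) auto
    also have "\<dots> = (\<Prod>i\<in>J. emeasure (if i \<in> J then distr M borel (X i) else lborel) (A i))"
    proof (rule prod.cong[OF refl])
      fix i assume i: "i \<in> J"
      have "(\<integral>\<^sup>+x. f i x * indicator (A i) x \<partial>lborel) = emeasure (distr M lborel (X i)) (A i)"
        using i by (simp add: Xd emeasure_density)
      also have "distr M lborel (X i) = distr M borel (X i)"
        by (rule distr_cong) auto
      finally show "(\<integral>\<^sup>+x. f i x * indicator (A i) x \<partial>lborel)
        = emeasure (if i \<in> J then distr M borel (X i) else lborel) (A i)"
        using i by simp
    qed
    finally show "emeasure (density (PiM J (\<lambda>_. lborel)) (\<lambda>x. \<Prod>i\<in>J. f i (x i))) (Pi\<^sub>E J A)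
      = (\<Prod>i\<in>J. emeasure (if i \<in> J then distr M borel (X i) else lborel) (A i))" .
  qed
  also have "\<dots> = distr M (PiM J (\<lambda>_. borel)) (\<lambda>\<omega>. \<lambda>i\<in>J. X i \<omega>)"
    using indep_vars_iff_distr_eq_PiM'[of J X "\<lambda>_. borel"] J indep by simp
  also have "\<dots> = distr M (PiM J (\<lambda>_. lborel)) (\<lambda>\<omega>. \<lambda>i\<in>J. X i \<omega>)"
    by (rule distr_cong) (simp_all add: sets_eq)
  finally have "distr M (PiM J (\<lambda>_. lborel)) (\<lambda>\<omega>. \<lambda>i\<in>J. X i \<omega>)
      = density (PiM J (\<lambda>_. lborel)) (\<lambda>x. \<Prod>i\<in>J. f i (x i))" ..
  then show ?thesis
    using dens_m by (auto simp: distributed_def)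
qed

section \<open>Gaussian integrals of positive definite forms\<close>

text \<open>The form \<open>x^H Q x\<close>. Coefficients are index functions rather than matrices,
  so that a leading block and its Schur complement need no conversion in an induction on
  \<open>n\<close>; only indices below \<open>n\<close> count.\<close>

definition qform :: "nat \<Rightarrow> (nat \<Rightarrow> nat \<Rightarrow> complex) \<Rightarrow> (nat \<Rightarrow> complex) \<Rightarrow> complex" where
  "qform n Q x = (\<Sum>i<n. \<Sum>j<n. cnj (x i) * Q i j * x j)"

lemma borel_measurable_cnj[measurable (raw)]:
  "f \<in> borel_measurable M \<Longrightarrow> (\<lambda>x. cnj (f x)) \<in> borel_measurable M"
  by (rule borel_measurable_continuous_on[where f=cnj]) (auto intro: continuous_intros)

lemma borel_measurable_qform:
  assumes "\<And>i. i < n \<Longrightarrow> (\<lambda>x. f x i) \<in> borel_measurable M"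
  shows "(\<lambda>x. qform n Q (f x)) \<in> borel_measurable M"
  unfolding qform_def using assms
  by (intro borel_measurable_sum borel_measurable_times borel_measurable_cnj borel_measurable_const) auto

lemma borel_measurable_PiM_component:
  "p \<in> J \<Longrightarrow> (\<lambda>x. x p) \<in> borel_measurable (PiM J (\<lambda>_. lborel :: complex measure))"
  using measurable_component_singleton[of p J "\<lambda>_. lborel :: complex measure"] by simp

definition pos_def_form :: "nat \<Rightarrow> (nat \<Rightarrow> nat \<Rightarrow> complex) \<Rightarrow> bool" where
  "pos_def_form n Q \<longleftrightarrow> (\<forall>i<n. \<forall>j<n. Q j i = cnj (Q i j)) \<and>
     (\<forall>x. (\<exists>i<n. x i \<noteq> 0) \<longrightarrow> 0 < Re (qform n Q x))"

text \<open>The last variable \<open>n\<close> is the one eliminated, so that the remaining indices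
  are again those below \<open>n\<close>.\<close>

definition schur_compl :: "nat \<Rightarrow> (nat \<Rightarrow> nat \<Rightarrow> complex) \<Rightarrow> nat \<Rightarrow> nat \<Rightarrow> complex" where
  "schur_compl n Q i j = Q i j - Q i n * Q n j / Q n n"

text \<open>Block factorisation \<open>Q = U W\<close>: \<open>U\<close> is block upper triangular
  with the Schur complement and \<open>Q n n\<close> on the diagonal, and \<open>W\<close> is unit
  lower triangular, so \<open>W\<close> contributes the factor 1.\<close>

lemma det_schur_compl:
  assumes "Q n n \<noteq> 0"
  shows "Determinant.det (mat (Suc n) (Suc n) (\<lambda>(i, j). Q i j)) =
    Q n n * Determinant.det (mat n n (\<lambda>(i, j). schur_compl n Q i j))"
proof -
  define U where "U = four_block_mat (mat n n (\<lambda>(i, j). schur_compl n Q i j))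
     (mat n 1 (\<lambda>(i, j). Q i n)) (0\<^sub>m 1 n) (mat 1 1 (\<lambda>_. Q n n))"
  define W where "W = four_block_mat (1\<^sub>m n) (0\<^sub>m n 1) (mat 1 n (\<lambda>(i, j). Q n j / Q n n)) (1\<^sub>m 1)"
  have U: "U \<in> carrier_mat (Suc n) (Suc n)" and W: "W \<in> carrier_mat (Suc n) (Suc n)"
    unfolding U_def W_def carrier_mat_def by auto
  have UW: "U * W = mat (Suc n) (Suc n) (\<lambda>(i, j). Q i j)"
  proof (rule eq_matI)
    fix i j assume "i < dim_row (mat (Suc n) (Suc n) (\<lambda>(i, j). Q i j))"
      "j < dim_col (mat (Suc n) (Suc n) (\<lambda>(i, j). Q i j))"
    then have ij: "i < Suc n" "j < Suc n" by auto
    have "(U * W) $$ (i, j) = (\<Sum>k = 0..<Suc n. U $$ (i, k) * W $$ (k, j))"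
      using U W ij by (auto simp: scalar_prod_def intro!: sum.cong)
    also have "\<dots> = (\<Sum>k = 0..<n. (if i < n then schur_compl n Q i k else 0) * (if j < n \<and> k = j then 1 else 0))
       + (if i < n then Q i n else Q n n) * (if j < n then Q n j / Q n n else 1)"
      unfolding sum.atLeast0_lessThan_Suc using ij
      by (intro arg_cong2[where f="(+)"] sum.cong)
         (auto simp: U_def W_def four_block_mat_def Let_def)
    also have "(\<Sum>k = 0..<n. (if i < n then schur_compl n Q i k else 0) * (if j < n \<and> k = j then 1 else 0))
       = (if j < n then if i < n then schur_compl n Q i j else 0 else 0)"
      by (auto simp: if_distrib cong: if_cong)
    finally show "(U * W) $$ (i, j) = mat (Suc n) (Suc n) (\<lambda>(i, j). Q i j) $$ (i, j)"
      using assms ij by (auto simp: schur_compl_def field_simps less_Suc_eq)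
  qed (use U W in auto)
  have "Determinant.det (U * W) = Determinant.det U * Determinant.det W"
    by (rule det_mult[OF U W])
  also have "Determinant.det U = Determinant.det (mat n n (\<lambda>(i, j). schur_compl n Q i j)) * Q n n"
    unfolding U_def by (subst det_four_block_mat_lower_left_zero[where n=n and m=1]) (auto simp: det_single)
  also have "Determinant.det W = 1"
    unfolding W_def by (subst det_four_block_mat_upper_right_zero[where n=n and m=1]) auto
  finally show ?thesis
    by (simp add: UW)
qed

text \<open>Completing the square in the last coordinate: the shift by \<open>b / q\<close> absorbs
  both cross terms, and the leftover \<open>- cnj b * b / q\<close> is exactly the correction from
  \<open>Q\<close> to its Schur complement.\<close>

lemma qform_fun_upd_Suc:
  assumes herm: "\<And>i j. i < Suc n \<Longrightarrow> j < Suc n \<Longrightarrow> Q j i = cnj (Q i j)"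
    and q: "Q n n = complex_of_real q" "q \<noteq> 0"
  shows "qform (Suc n) Q x = qform n (schur_compl n Q) x +
     complex_of_real (q * (cmod ((\<Sum>j<n. Q n j * x j) / q + x n))\<^sup>2)"
proof -
  define b where "b = (\<Sum>j<n. Q n j * x j)"
  have cb: "(\<Sum>i<n. cnj (x i) * Q i n) = cnj b"
    unfolding b_def cnj_sum by (intro sum.cong) (auto simp: herm[of n])
  have 1: "qform (Suc n) Q x = qform n Q x + cnj b * x n + cnj (x n) * b + q * (cnj (x n) * x n)"
    unfolding cb[symmetric] unfolding qform_def b_def
    by (simp add: sum.distrib sum_distrib_left sum_distrib_right q algebra_simps)
  have 2: "qform n (schur_compl n Q) x = qform n Q x - cnj b * b / q"
  proof -
    have "cnj b * b / q = (\<Sum>i<n. \<Sum>j<n. (cnj (x i) * Q i n) * (Q n j * x j) / q)"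
      unfolding cb[symmetric] unfolding b_def sum_product sum_divide_distrib ..
    then show ?thesis
      by (simp add: qform_def schur_compl_def q algebra_simps sum_subtractf)
  qed
  have 3: "complex_of_real (q * (cmod (b / q + x n))\<^sup>2) = q * ((b / q + x n) * cnj (b / q + x n))"
    by (simp only: of_real_mult complex_norm_square)
  show ?thesis
    unfolding 1 2 b_def[symmetric] 3 using q(2) by (simp add: field_simps)
qed

text \<open>Each elimination step takes the factor \<open>q = Q n n\<close> out of the determinant
  and produces the factor \<open>pi / q\<close> in the integral, so one induction treats both; that
  the determinant is real and positive comes along. The map \<open>e\<close> enumerates the
  coordinates of the product space, which need not be numbers.\<close>

lemma gaussian_integral_pos_def_form:
  assumes "inj_on e {..<n}" and "pos_def_form n Q"
  shows "\<exists>d>0. Determinant.det (mat n n (\<lambda>(i, j). Q i j)) = complex_of_real d \<and>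
    (\<integral>\<^sup>+x. ennreal (exp (- Re (qform n Q (\<lambda>i. x (e i))))) \<partial>PiM (e ` {..<n}) (\<lambda>_. lborel)) = ennreal (pi ^ n / d)"
  using assms
proof (induction n arbitrary: Q)
  case 0
  show ?case
    by (intro exI[of _ 1]) (simp add: qform_def PiM_empty nn_integral_count_space_finite)
next
  case (Suc n)
  have herm: "\<And>i j. i < Suc n \<Longrightarrow> j < Suc n \<Longrightarrow> Q j i = cnj (Q i j)"
    and pos: "\<And>x. \<exists>i<Suc n. x i \<noteq> 0 \<Longrightarrow> 0 < Re (qform (Suc n) Q x)"
    using Suc.prems(2) unfolding pos_def_form_def by blast+
  define q where "q = Re (Q n n)"
  have q: "Q n n = complex_of_real q"
  proof -
    have "Q n n = cnj (Q n n)"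
      by (rule herm) auto
    then have "Im (Q n n) = Im (cnj (Q n n))"
      by (rule arg_cong)
    then show ?thesis
      by (simp add: q_def complex_eq_iff)
  qed
  \<comment> \<open>The last unit vector: the form takes the value \<open>Q n n\<close> there, which
    is therefore positive.\<close>
  define u :: "nat \<Rightarrow> complex" where "u i = (if i = n then 1 else 0)" for i
  have u: "u n = 1" "\<And>j. j < n \<Longrightarrow> u j = 0"
    by (auto simp: u_def)
  have "0 < Re (qform (Suc n) Q u)"
    using u by (intro pos) auto
  also have "qform (Suc n) Q u = Q n n"
    by (simp add: qform_def u cong: sum.cong_simp)
  finally have q0: "0 < q"
    by (simp add: q_def)
  have step: "qform (Suc n) Q x = qform n (schur_compl n Q) x +
     complex_of_real (q * (cmod ((\<Sum>j<n. Q n j * x j) / q + x n))\<^sup>2)" for x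
    by (rule qform_fun_upd_Suc, rule herm, assumption+, rule q) (use q0 in simp)
  have pd: "pos_def_form n (schur_compl n Q)"
    unfolding pos_def_form_def
  proof (intro conjI allI impI)
    fix i j assume "i < n" "j < n"
    then show "schur_compl n Q j i = cnj (schur_compl n Q i j)"
      by (simp add: schur_compl_def q herm[of i j] herm[of i n] herm[of n j])
  next
    fix x :: "nat \<Rightarrow> complex" assume x: "\<exists>i<n. x i \<noteq> 0"
    \<comment> \<open>The last coordinate is chosen to annihilate the square, so that the full form
      at this point equals the Schur form at \<open>x\<close>.\<close>
    let ?y = "x(n := - (\<Sum>j<n. Q n j * x j) / q)"
    have "0 < Re (qform (Suc n) Q ?y)"
      using x by (intro pos) (auto intro: less_SucI)
    also have "qform (Suc n) Q ?y = qform n (schur_compl n Q) x"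
      unfolding step by (simp add: qform_def)
    finally show "0 < Re (qform n (schur_compl n Q) x)" .
  qed
  have inj: "inj_on e {..<n}" and en: "e n \<notin> e ` {..<n}"
    using inj_on_subset[OF Suc.prems(1), of "{..<n}"]
      inj_on_image_mem_iff[OF Suc.prems(1), of n "{..<n}"] by auto
  from Suc.IH[OF inj pd] obtain d where d: "0 < d"
    "Determinant.det (mat n n (\<lambda>(i, j). schur_compl n Q i j)) = complex_of_real d"
    "(\<integral>\<^sup>+x. ennreal (exp (- Re (qform n (schur_compl n Q) (\<lambda>i. x (e i))))) \<partial>PiM (e ` {..<n}) (\<lambda>_. lborel))
      = ennreal (pi ^ n / d)"
    by blast
  have m: "(\<lambda>x. ennreal (exp (- Re (qform k R (\<lambda>i. x (e i)))))) \<in> borel_measurable (PiM (e ` {..<k}) (\<lambda>_. lborel))" for k R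
    using borel_measurable_qform[of k "\<lambda>x i. x (e i)" "PiM (e ` {..<k}) (\<lambda>_. lborel)" R]
    by (simp add: borel_measurable_PiM_component)
  have "(\<integral>\<^sup>+x. ennreal (exp (- Re (qform (Suc n) Q (\<lambda>i. x (e i))))) \<partial>PiM (e ` {..<Suc n}) (\<lambda>_. lborel))
     = (\<integral>\<^sup>+x. \<integral>\<^sup>+z. ennreal (exp (- Re (qform (Suc n) Q (\<lambda>i. (x(e n := z)) (e i)))))
          \<partial>lborel \<partial>PiM (e ` {..<n}) (\<lambda>_. lborel))"
    using m[of "Suc n" Q] en unfolding lessThan_Suc image_insert
    by (intro lborel_family.product_nn_integral_insert) auto
  also have "\<dots> = (\<integral>\<^sup>+x. \<integral>\<^sup>+z. ennreal (exp (- Re (qform n (schur_compl n Q) (\<lambda>i. x (e i)))))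
        * ennreal (exp (- q * (cmod ((\<Sum>j<n. Q n j * x (e j)) / q + z))\<^sup>2))
          \<partial>lborel \<partial>PiM (e ` {..<n}) (\<lambda>_. lborel))"
  proof (intro nn_integral_cong)
    fix x :: "'a \<Rightarrow> complex" and z :: complex
    have ei: "(x(e n := z)) (e i) = x (e i)" if "i < n" for i
      using en that by (metis fun_upd_other imageI lessThan_iff)
    have "qform n (schur_compl n Q) (\<lambda>i. (x(e n := z)) (e i)) = qform n (schur_compl n Q) (\<lambda>i. x (e i))"
      "(\<Sum>j<n. Q n j * (x(e n := z)) (e j)) = (\<Sum>j<n. Q n j * x (e j))"
      unfolding qform_def using ei by (auto intro!: sum.cong simp del: fun_upd_apply)
    then show "ennreal (exp (- Re (qform (Suc n) Q (\<lambda>i. (x(e n := z)) (e i))))) =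
       ennreal (exp (- Re (qform n (schur_compl n Q) (\<lambda>i. x (e i)))))
        * ennreal (exp (- q * (cmod ((\<Sum>j<n. Q n j * x (e j)) / q + z))\<^sup>2))"
      unfolding step by (simp add: ennreal_mult[symmetric] exp_add[symmetric])
  qed
  also have "\<dots> = (\<integral>\<^sup>+x. ennreal (exp (- Re (qform n (schur_compl n Q) (\<lambda>i. x (e i)))))
        * ennreal (pi / q) \<partial>PiM (e ` {..<n}) (\<lambda>_. lborel))"
    using q0 by (intro nn_integral_cong) (simp add: nn_integral_cmult nn_integral_exp_cmod_shift[simplified])
  also have "\<dots> = ennreal (pi ^ n / d) * ennreal (pi / q)"
    by (subst nn_integral_multc[OF m]) (simp add: d(3))
  also have "\<dots> = ennreal (pi ^ Suc n / (q * d))"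
    using q0 d(1) by (subst ennreal_mult[symmetric]) (auto simp: field_simps)
  finally have int: "(\<integral>\<^sup>+x. ennreal (exp (- Re (qform (Suc n) Q (\<lambda>i. x (e i))))) \<partial>PiM (e ` {..<Suc n}) (\<lambda>_. lborel))
     = ennreal (pi ^ Suc n / (q * d))" .
  show ?case
    using q0 d int by (intro exI[of _ "q * d"]) (simp add: det_schur_compl q)
qed

section \<open>Completing the square for a linear channel\<close>

definition mv :: "nat \<Rightarrow> (nat \<Rightarrow> nat \<Rightarrow> complex) \<Rightarrow> (nat \<Rightarrow> complex) \<Rightarrow> nat \<Rightarrow> complex" where
  "mv n B v i = (\<Sum>j<n. B i j * v j)"

definition ip :: "nat \<Rightarrow> (nat \<Rightarrow> complex) \<Rightarrow> (nat \<Rightarrow> complex) \<Rightarrow> complex" where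
  "ip n u v = (\<Sum>i<n. cnj (u i) * v i)"

definition adj :: "(nat \<Rightarrow> nat \<Rightarrow> complex) \<Rightarrow> nat \<Rightarrow> nat \<Rightarrow> complex" where
  "adj B i j = cnj (B j i)"

text \<open>The matrix \<open>I / P + A^H A\<close>: the precision of an input of variance
  \<open>P\<close> once the output of the channel \<open>A\<close> with unit-variance noise is
  given. It is \<open>1 / P\<close> times the matrix whose determinant enters the capacity.\<close>

definition gram :: "nat \<Rightarrow> real \<Rightarrow> (nat \<Rightarrow> nat \<Rightarrow> complex) \<Rightarrow> nat \<Rightarrow> nat \<Rightarrow> complex" where
  "gram n P A i j = (if i = j then 1 / complex_of_real P else 0) + (\<Sum>k<n. cnj (A k i) * A k j)"

lemma qform_eq_ip: "qform n Q x = ip n x (mv n Q x)"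
  by (simp add: qform_def ip_def mv_def sum_distrib_left mult.assoc)

lemma ip_cong: "(\<And>i. i < n \<Longrightarrow> u i = u' i) \<Longrightarrow> (\<And>i. i < n \<Longrightarrow> v i = v' i) \<Longrightarrow> ip n u v = ip n u' v'"
  by (simp add: ip_def)

lemma mv_cong: "(\<And>i. i < n \<Longrightarrow> v i = v' i) \<Longrightarrow> mv n B v i = mv n B v' i"
  by (simp add: mv_def)

lemma ip_diff_left: "ip n (\<lambda>i. u i - u' i) v = ip n u v - ip n u' v"
  and ip_diff_right: "ip n u (\<lambda>i. v i - v' i) = ip n u v - ip n u v'"
  by (simp_all add: ip_def sum_subtractf algebra_simps)

lemma cnj_ip: "cnj (ip n u v) = ip n v u"
  by (simp add: ip_def mult.commute)

lemma mv_diff: "mv n B (\<lambda>i. u i - v i) = (\<lambda>i. mv n B u i - mv n B v i)"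
  by (auto simp: mv_def sum_subtractf algebra_simps)

lemma ip_mv: "ip n u (mv n B v) = ip n (mv n (adj B) u) v"
  unfolding ip_def mv_def adj_def cnj_sum sum_distrib_left sum_distrib_right
  by (subst sum.swap) (simp add: mult_ac)

lemma ip_self: "ip n u u = complex_of_real (\<Sum>i<n. (cmod (u i))\<^sup>2)"
  unfolding ip_def of_real_sum complex_norm_square by (simp add: mult.commute)

lemma mv_gram:
  "i < n \<Longrightarrow> mv n (gram n P A) x i = x i / complex_of_real P + mv n (adj A) (mv n A x) i"
  unfolding gram_def mv_def adj_def distrib_right sum.distrib sum_distrib_left sum_distrib_right
  by (subst (2) sum.swap) (simp add: mult.assoc if_distrib if_distribR cong: if_cong)

lemma adj_gram: "adj (gram n P A) = gram n P A"
  by (auto simp: fun_eq_iff adj_def gram_def mult.commute)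

lemma qform_gram:
  "qform n (gram n P A) x = complex_of_real ((\<Sum>i<n. (cmod (x i))\<^sup>2) / P + (\<Sum>i<n. (cmod (mv n A x i))\<^sup>2))"
proof -
  have "ip n x (mv n (gram n P A) x) = ip n x (\<lambda>i. x i / complex_of_real P + mv n (adj A) (mv n A x) i)"
    by (rule ip_cong) (simp_all add: mv_gram)
  also have "\<dots> = ip n x x / complex_of_real P + ip n x (mv n (adj A) (mv n A x))"
    by (simp add: ip_def sum.distrib sum_divide_distrib distrib_left)
  also have "ip n x (mv n (adj A) (mv n A x)) = ip n (mv n A x) (mv n A x)"
    by (subst ip_mv) (simp add: adj_def[abs_def])
  finally show ?thesis
    by (simp add: qform_eq_ip ip_self)
qed

lemma pos_def_gram:
  assumes "0 < P"
  shows "pos_def_form n (gram n P A)"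
  unfolding pos_def_form_def
proof (intro conjI allI impI)
  fix i j show "gram n P A j i = cnj (gram n P A i j)"
    by (simp add: gram_def mult.commute)
next
  fix x :: "nat \<Rightarrow> complex" assume "\<exists>i<n. x i \<noteq> 0"
  then have "0 < (\<Sum>i<n. (cmod (x i))\<^sup>2)"
    by (auto intro!: sum_pos2)
  then show "0 < Re (qform n (gram n P A) x)"
    using assms by (simp add: qform_gram add_pos_nonneg sum_nonneg)
qed

lemma mat_inverse_mv:
  assumes "Determinant.det (mat n n (\<lambda>(i, j). Q i j)) \<noteq> 0"
  obtains R where "\<And>v i. i < n \<Longrightarrow> mv n R (mv n Q v) i = v i"
    and "\<And>v i. i < n \<Longrightarrow> mv n Q (mv n R v) i = v i"
proof -
  let ?Q = "mat n n (\<lambda>(i, j). Q i j)"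
  from det_non_zero_imp_unit[of ?Q n, OF _ assms]
  obtain B where B: "B \<in> carrier_mat n n" "B * ?Q = 1\<^sub>m n" "?Q * B = 1\<^sub>m n"
    unfolding Units_def by (auto simp: ring_mat_def)
  have "mv n (\<lambda>i j. B $$ (i, j)) (mv n Q v) i = v i" if i: "i < n" for v i
  proof -
    have "mv n (\<lambda>i j. B $$ (i, j)) (mv n Q v) i = (\<Sum>k<n. (B * ?Q) $$ (i, k) * v k)"
      unfolding mv_def sum_distrib_left using B(1) i
      by (subst sum.swap)
         (auto simp: scalar_prod_def sum_distrib_right mult.assoc atLeast0LessThan intro!: sum.cong)
    then show ?thesis
      using i by (simp add: B(2) if_distrib if_distribR cong: if_cong)
  qed
  moreover have "mv n Q (mv n (\<lambda>i j. B $$ (i, j)) v) i = v i" if i: "i < n" for v i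
  proof -
    have "mv n Q (mv n (\<lambda>i j. B $$ (i, j)) v) i = (\<Sum>k<n. (?Q * B) $$ (i, k) * v k)"
      unfolding mv_def sum_distrib_left using B(1) i
      by (subst sum.swap)
         (auto simp: scalar_prod_def sum_distrib_right mult.assoc atLeast0LessThan intro!: sum.cong)
    then show ?thesis
      using i by (simp add: B(3) if_distrib if_distribR cong: if_cong)
  qed
  ultimately show thesis
    by (rule that)
qed

text \<open>With \<open>Q = gram n P A\<close>, the matrix \<open>G = inverse Q * A^H\<close> gives
  the conditional mean of \<open>x\<close> given \<open>y\<close>, and \<open>R = I - A G\<close>
  is, by the matrix inversion lemma, the inverse of the output covariance
  \<open>I + P A A^H\<close>. The first claim is the completed square in \<open>x\<close>; the
  second is the trace of \<open>R\<close> times that covariance.\<close>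

lemma channel_exponent_decomposition:
  fixes A :: "nat \<Rightarrow> nat \<Rightarrow> complex"
  assumes P: "0 < P" and det: "Determinant.det (mat n n (\<lambda>(i, j). gram n P A i j)) \<noteq> 0"
  obtains G R where
    "\<And>x y. (\<Sum>i<n. (cmod (y i - mv n A x i))\<^sup>2) + (\<Sum>i<n. (cmod (x i))\<^sup>2) / P
       = Re (qform n (gram n P A) (\<lambda>i. x i - mv n G y i)) + Re (qform n R y)"
    and "(\<Sum>i<n. \<Sum>j<n. R i j * ((if i = j then 1 else 0) + complex_of_real P * (\<Sum>k<n. A j k * cnj (A i k)))) = of_nat n"
proof -
  let ?Q = "gram n P A"
  obtain B where B: "\<And>v i. i < n \<Longrightarrow> mv n B (mv n ?Q v) i = v i"
    "\<And>v i. i < n \<Longrightarrow> mv n ?Q (mv n B v) i = v i"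
    using mat_inverse_mv[OF det] by blast
  define G where "G i j = (\<Sum>k<n. B i k * adj A k j)" for i j
  define R where "R i j = (if i = j then 1 else 0) - (\<Sum>k<n. A i k * G k j)" for i j
  have G: "mv n G y = mv n B (mv n (adj A) y)" for y
    unfolding G_def fun_eq_iff mv_def sum_distrib_left sum_distrib_right
    by (subst sum.swap) (simp add: mult.assoc)
  have R: "mv n R y i = y i - mv n A (mv n G y) i" if "i < n" for y i
    using that unfolding R_def mv_def sum_distrib_left sum_distrib_right left_diff_distrib sum_subtractf
    by (subst (2) sum.swap) (simp add: mult.assoc if_distrib if_distribR cong: if_cong)
  show thesis
  proof (rule that)
    fix x y :: "nat \<Rightarrow> complex"
    define m where "m = mv n G y"
    have Qm: "mv n ?Q m i = mv n (adj A) y i" if "i < n" for i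
      unfolding m_def G by (rule B(2)[OF that])
    \<comment> \<open>The normal equations \<open>Q m = A^H y\<close> reduce all cross terms of the
      form to inner products with \<open>y\<close>.\<close>
    have xQm: "ip n u (mv n ?Q m) = ip n (mv n A u) y" for u
    proof -
      have "ip n u (mv n ?Q m) = ip n u (mv n (adj A) y)"
        by (rule ip_cong) (simp_all add: Qm)
      then show ?thesis
        by (simp add: ip_mv adj_def[abs_def])
    qed
    have mQx: "ip n m (mv n ?Q u) = ip n y (mv n A u)" for u
      using arg_cong[OF xQm[of u], of cnj] by (simp add: cnj_ip ip_mv adj_gram)
    have "qform n ?Q (\<lambda>i. x i - m i) = qform n ?Q x - ip n (mv n A x) y - ip n y (mv n A x) + ip n y (mv n A m)"
      unfolding qform_eq_ip mv_diff ip_diff_left ip_diff_right xQm mQx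
      using mQx[of m] xQm[of m] by simp
    moreover have "qform n R y = ip n y y - ip n y (mv n A m)"
    proof -
      have "ip n y (mv n R y) = ip n y (\<lambda>i. y i - mv n A (mv n G y) i)"
        by (rule ip_cong) (simp_all add: R)
      then show ?thesis
        by (simp add: qform_eq_ip m_def ip_diff_right)
    qed
    moreover have "complex_of_real (\<Sum>i<n. (cmod (y i - mv n A x i))\<^sup>2)
       = ip n y y - ip n y (mv n A x) - ip n (mv n A x) y + complex_of_real (\<Sum>i<n. (cmod (mv n A x i))\<^sup>2)"
      unfolding ip_self[symmetric] ip_diff_left ip_diff_right by simp
    ultimately have "complex_of_real ((\<Sum>i<n. (cmod (y i - mv n A x i))\<^sup>2) + (\<Sum>i<n. (cmod (x i))\<^sup>2) / P)
       = qform n ?Q (\<lambda>i. x i - m i) + qform n R y"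
      by (simp add: qform_gram)
    then show "(\<Sum>i<n. (cmod (y i - mv n A x i))\<^sup>2) + (\<Sum>i<n. (cmod (x i))\<^sup>2) / P
       = Re (qform n ?Q (\<lambda>i. x i - mv n G y i)) + Re (qform n R y)"
      unfolding m_def by (metis Re_complex_of_real plus_complex.sel(1))
  next
    have "(\<Sum>j<n. R i j * ((if i = j then 1 else 0) + complex_of_real P * (\<Sum>k<n. A j k * cnj (A i k)))) = 1"
      if i: "i < n" for i
    proof -
      \<comment> \<open>The vector \<open>y\<close> below is column \<open>i\<close> of
        \<open>I + P A A^H\<close>. Since \<open>b / P = A^H d\<close>, one has
        \<open>A^H y = Q b\<close>, hence \<open>G y = b\<close> and
        \<open>R y = y - A b = d\<close>; entry \<open>i\<close> is a diagonal entry of the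
        trace.\<close>
      define d :: "nat \<Rightarrow> complex" where "d j = (if i = j then 1 else 0)" for j
      define b where "b k = complex_of_real P * cnj (A i k)" for k
      define y where "y j = d j + mv n A b j" for j
      have Ad: "mv n (adj A) d k = cnj (A i k)" for k
        using i by (simp add: mv_def d_def adj_def if_distrib cong: if_cong)
      have "mv n (adj A) y k = mv n ?Q b k" if "k < n" for k
      proof -
        have "mv n (adj A) y k = mv n (adj A) d k + mv n (adj A) (mv n A b) k"
          unfolding y_def by (simp add: mv_def sum.distrib distrib_left)
        then show ?thesis
          using P that by (simp add: Ad mv_gram b_def)
      qed
      then have Gy: "mv n G y k = b k" if "k < n" for k
        unfolding G using B(1)[OF that, of b] mv_cong[of n "mv n (adj A) y" "mv n ?Q b" B k] by simp
      have "mv n R y i = y i - mv n A b i"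
        using R[OF i, of y] mv_cong[of n "mv n G y" b A i] Gy by simp
      then have "mv n R y i = 1"
        by (simp add: y_def d_def)
      then show ?thesis
        by (simp add: mv_def y_def d_def b_def sum_distrib_left mult_ac)
    qed
    then show "(\<Sum>i<n. \<Sum>j<n. R i j * ((if i = j then 1 else 0) + complex_of_real P * (\<Sum>k<n. A j k * cnj (A i k)))) = of_nat n"
      by simp
  qed
qed

section \<open>Mutual information of a linear Gaussian channel\<close>

lemma (in prob_space) mutual_information_cong_sets:
  assumes "sets S = sets S'" "sets T = sets T'"
  shows "mutual_information b S T X Y = mutual_information b S' T' X Y"
proof -
  have "distr M S X = distr M S' X" "distr M T Y = distr M T' Y"
    by (rule distr_cong; simp add: assms)+
  moreover have "distr M (S \<Otimes>\<^sub>M T) (\<lambda>x. (X x, Y x)) = distr M (S' \<Otimes>\<^sub>M T') (\<lambda>x. (X x, Y x))"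
    by (rule distr_cong) (simp_all add: assms cong: sets_pair_measure_cong)
  ultimately show ?thesis
    by (simp add: mutual_information_def)
qed

text \<open>A map of the output with measurable left inverse transports the Radon-Nikodym derivative
  of the joint law against the product law, so both divergences integrate the same function.
  Absolute continuity enters because the derivatives agree almost everywhere for the product law,
  while the integral runs over the joint law.\<close>

lemma (in prob_space) mutual_information_bimeasurable:
  assumes X: "X \<in> M \<rightarrow>\<^sub>M S" and Y: "Y \<in> M \<rightarrow>\<^sub>M T" and g: "g \<in> T \<rightarrow>\<^sub>M T'" and g': "g' \<in> T' \<rightarrow>\<^sub>M T"
    and inv: "\<And>y. y \<in> space T \<Longrightarrow> g' (g y) = y"
    and ac: "absolutely_continuous (distr M S X \<Otimes>\<^sub>M distr M T Y) (distr M (S \<Otimes>\<^sub>M T) (\<lambda>x. (X x, Y x)))"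
  shows "mutual_information b S T' X (\<lambda>\<omega>. g (Y \<omega>)) = mutual_information b S T X Y"
proof -
  note [measurable] = X Y g g'
  let ?J = "distr M (S \<Otimes>\<^sub>M T) (\<lambda>x. (X x, Y x))"
  let ?I = "distr M S X \<Otimes>\<^sub>M distr M T Y"
  let ?h = "\<lambda>(x, y). (x, g y)" and ?h' = "\<lambda>(x, y). (x, g' y)"
  interpret PX: prob_space "distr M S X" by (rule prob_space_distr) fact
  interpret PY: prob_space "distr M T Y" by (rule prob_space_distr) fact
  interpret PXY: pair_prob_space "distr M S X" "distr M T Y" ..
  have h: "?h \<in> S \<Otimes>\<^sub>M T \<rightarrow>\<^sub>M S \<Otimes>\<^sub>M T'" and h': "?h' \<in> S \<Otimes>\<^sub>M T' \<rightarrow>\<^sub>M S \<Otimes>\<^sub>M T"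
    by measurable
  have J': "distr M (S \<Otimes>\<^sub>M T') (\<lambda>x. (X x, g (Y x))) = distr ?J (S \<Otimes>\<^sub>M T') ?h"
    using h by (subst distr_distr) (auto simp: comp_def)
  have gY: "distr M T' (\<lambda>\<omega>. g (Y \<omega>)) = distr (distr M T Y) T' g"
    by (subst distr_distr) (auto simp: comp_def)
  have X': "distr M S X = distr (distr M S X) S (\<lambda>x. x)"
    by (rule distr_id2[symmetric]) simp
  have sg: "sigma_finite_measure (distr (distr M T Y) T' g)"
    by (intro prob_space_imp_sigma_finite PY.prob_space_distr) simp
  have I': "distr M S X \<Otimes>\<^sub>M distr M T' (\<lambda>\<omega>. g (Y \<omega>)) = distr ?I (S \<Otimes>\<^sub>M T') ?h"
  proof -
    have "distr (distr M S X) S (\<lambda>x. x) \<Otimes>\<^sub>M distr (distr M T Y) T' g = distr ?I (S \<Otimes>\<^sub>M T') ?h"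
      by (rule pair_measure_distr[where f="\<lambda>x. x" and g=g, OF _ _ sg]) (simp_all add: g)
    then show ?thesis
      unfolding gY X'[symmetric] .
  qed
  have sI: "sets ?I = sets (S \<Otimes>\<^sub>M T)"
    by (rule sets_pair_measure_cong) simp_all
  have hI: "?h \<in> ?I \<rightarrow>\<^sub>M S \<Otimes>\<^sub>M T'"
    unfolding measurable_cong_sets[OF sI refl] by (rule h)
  have h'I: "?h' \<in> S \<Otimes>\<^sub>M T' \<rightarrow>\<^sub>M ?I"
    unfolding measurable_cong_sets[OF refl sI] by (rule h')
  have hJ: "?h \<in> ?J \<rightarrow>\<^sub>M S \<Otimes>\<^sub>M T'"
    unfolding measurable_distr_eq1 by (rule h)
  have sJI: "sets ?J = sets ?I" by (simp add: sI)
  have ac': "absolutely_continuous (distr ?I (S \<Otimes>\<^sub>M T') ?h) (distr ?J (S \<Otimes>\<^sub>M T') ?h)"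
    unfolding absolutely_continuous_def
  proof
    fix A assume "A \<in> null_sets (distr ?I (S \<Otimes>\<^sub>M T') ?h)"
    then have A: "A \<in> sets (S \<Otimes>\<^sub>M T')" "?h -` A \<inter> space ?I \<in> null_sets ?I"
      using null_sets_distr_iff[OF hI] by auto
    then have "?h -` A \<inter> space ?J \<in> null_sets ?J"
      using ac unfolding absolutely_continuous_def by (auto simp: space_pair_measure)
    with A(1) show "A \<in> null_sets (distr ?J (S \<Otimes>\<^sub>M T') ?h)"
      using null_sets_distr_iff[OF hJ] by auto
  qed
  have rn: "AE p in ?I. RN_deriv (distr ?I (S \<Otimes>\<^sub>M T') ?h) (distr ?J (S \<Otimes>\<^sub>M T') ?h) (?h p) = RN_deriv ?I ?J p"
    by (rule PXY.RN_deriv_distr[OF hI h'I _ ac' sJI]) (auto simp: space_pair_measure inv)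
  then have rnJ: "AE p in ?J. RN_deriv (distr ?I (S \<Otimes>\<^sub>M T') ?h) (distr ?J (S \<Otimes>\<^sub>M T') ?h) (?h p) = RN_deriv ?I ?J p"
    by (rule absolutely_continuous_AE[OF sJI ac])
  let ?D' = "entropy_density b (distr ?I (S \<Otimes>\<^sub>M T') ?h) (distr ?J (S \<Otimes>\<^sub>M T') ?h)"
  have D': "?D' \<in> borel_measurable (S \<Otimes>\<^sub>M T')"
    using measurable_entropy_density[of b "distr ?I (S \<Otimes>\<^sub>M T') ?h" "distr ?J (S \<Otimes>\<^sub>M T') ?h"]
    by (simp cong: measurable_cong_sets)
  have D: "entropy_density b ?I ?J \<in> borel_measurable ?J"
    using measurable_entropy_density[of b ?I ?J] by (simp cong: measurable_cong_sets)
  have "(LINT p|distr ?J (S \<Otimes>\<^sub>M T') ?h. ?D' p) = (LINT p|?J. ?D' (?h p))"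
    by (rule integral_distr[OF hJ D'])
  also have "\<dots> = (LINT p|?J. entropy_density b ?I ?J p)"
  proof (rule integral_cong_AE)
    show "(\<lambda>p. ?D' (?h p)) \<in> borel_measurable ?J"
      by (rule measurable_compose[OF hJ D'])
    show "AE p in ?J. ?D' (?h p) = entropy_density b ?I ?J p"
      using rnJ by eventually_elim (simp add: entropy_density_def)
  qed (rule D)
  finally show ?thesis
    unfolding mutual_information_def I' J' KL_divergence_def .
qed

lemma (in prob_space) indep_var_cong_sets:
  assumes "indep_var S X T Y" and "sets S = sets S'" "sets T = sets T'"
  shows "indep_var S' X T' Y"
proof -
  have "distr M S X = distr M S' X" "distr M T Y = distr M T' Y"
    by (rule distr_cong; simp add: assms)+
  moreover have "distr M (S \<Otimes>\<^sub>M T) (\<lambda>x. (X x, Y x)) = distr M (S' \<Otimes>\<^sub>M T') (\<lambda>x. (X x, Y x))"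
    by (rule distr_cong) (simp_all add: assms cong: sets_pair_measure_cong)
  moreover have "M \<rightarrow>\<^sub>M S = M \<rightarrow>\<^sub>M S'" "M \<rightarrow>\<^sub>M T = M \<rightarrow>\<^sub>M T'"
    using assms(2,3) by (auto cong: measurable_cong_sets)
  ultimately show ?thesis
    using assms(1) unfolding indep_var_distribution_eq by simp
qed

lemma borel_measurable_mv:
  assumes "\<And>i. i < n \<Longrightarrow> (\<lambda>x. f x i) \<in> borel_measurable M"
  shows "(\<lambda>x. mv n B (f x) k) \<in> borel_measurable M"
  unfolding mv_def using assms
  by (intro borel_measurable_sum borel_measurable_times borel_measurable_const) auto

lemma cg_density_prod:
  assumes "inj_on e {..<n}" "0 < s"
  shows "(\<Prod>p\<in>e ` {..<n}. cg_density s (x p)) = exp (- (\<Sum>i<n. (cmod (x (e i)))\<^sup>2) / s) / (pi * s) ^ n"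
  using assms by (simp add: prod_dividef exp_sum[symmetric] sum_negf sum_divide_distrib sum.reindex card_image)

text \<open>The joint density is the shear of independent input and noise by \<open>A x\<close>. For
  the output density \<open>x\<close> is integrated out after completing the square: up to a
  translation this is a centred Gaussian integral, which contributes
  \<open>pi ^ n / d\<close>.\<close>

lemma (in prob_space) gaussian_channel_densities:
  fixes n :: nat and e :: "nat \<Rightarrow> 'i" and A :: "nat \<Rightarrow> nat \<Rightarrow> complex" and X V Y :: "'i \<Rightarrow> 'a \<Rightarrow> complex"
  defines "J \<equiv> e ` {..<n}"
  defines "\<Lambda> \<equiv> PiM J (\<lambda>_. lborel :: complex measure)"
  assumes n: "0 < n" and P: "0 < P" and inj: "inj_on e {..<n}"
    and X: "\<And>p. p \<in> J \<Longrightarrow> complex_gaussian M P (X p)" "indep_vars (\<lambda>_. borel) X J"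
    and V: "\<And>p. p \<in> J \<Longrightarrow> complex_gaussian M 1 (V p)" "indep_vars (\<lambda>_. borel) V J"
    and indep: "indep_var (PiM J (\<lambda>_. borel)) (\<lambda>\<omega>. \<lambda>p\<in>J. X p \<omega>) (PiM J (\<lambda>_. borel)) (\<lambda>\<omega>. \<lambda>p\<in>J. V p \<omega>)"
    and Y: "\<And>i \<omega>. i < n \<Longrightarrow> Y (e i) \<omega> = mv n A (\<lambda>j. X (e j) \<omega>) i + V (e i) \<omega>"
    and d: "0 < d" "Determinant.det (mat n n (\<lambda>(i, j). gram n P A i j)) = complex_of_real d"
    and decomp: "\<And>x y. (\<Sum>i<n. (cmod (y i - mv n A x i))\<^sup>2) + (\<Sum>i<n. (cmod (x i))\<^sup>2) / P
       = Re (qform n (gram n P A) (\<lambda>i. x i - mv n G y i)) + Re (qform n R y)"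
  shows "distributed M \<Lambda> (\<lambda>\<omega>. \<lambda>p\<in>J. X p \<omega>) (\<lambda>x. ennreal (exp (- (\<Sum>i<n. (cmod (x (e i)))\<^sup>2) / P) / (pi * P) ^ n))"
    and "distributed M (\<Lambda> \<Otimes>\<^sub>M \<Lambda>) (\<lambda>\<omega>. (\<lambda>p\<in>J. X p \<omega>, \<lambda>p\<in>J. Y p \<omega>))
      (\<lambda>(x, y). ennreal (exp (- (\<Sum>i<n. (cmod (x (e i)))\<^sup>2) / P) / (pi * P) ^ n
         * (exp (- (\<Sum>i<n. (cmod (y (e i) - mv n A (\<lambda>j. x (e j)) i))\<^sup>2)) / pi ^ n)))"
    and "distributed M \<Lambda> (\<lambda>\<omega>. \<lambda>p\<in>J. Y p \<omega>)
      (\<lambda>y. ennreal (exp (- Re (qform n R (\<lambda>i. y (e i)))) / ((pi * P) ^ n * d)))"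
proof -
  have J: "finite J" "J \<noteq> {}"
    using n by (auto simp: J_def)
  have sets_\<Lambda>: "sets (PiM J (\<lambda>_. borel)) = sets \<Lambda>"
    unfolding \<Lambda>_def by (intro sets_PiM_cong) auto
  have sf: "sigma_finite_measure \<Lambda>"
    unfolding \<Lambda>_def by (rule sigma_finite_PiM_lborel[OF J(1)])
  have comp: "(\<lambda>x. x p) \<in> borel_measurable \<Lambda>" if "p \<in> J" for p
    unfolding \<Lambda>_def by (rule borel_measurable_PiM_component[OF that])
  have eJ: "e i \<in> J" if "i < n" for i
    using that by (simp add: J_def)
  \<comment> \<open>Coordinates of the product space are labelled by \<open>J\<close>, vectors and
    matrices by numbers below \<open>n\<close>; \<open>idx\<close> translates back.\<close>
  define idx where "idx = inv_into {..<n} e"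
  have idx: "idx (e i) = i" if "i < n" for i
    using that inj by (simp add: idx_def)
  have density: "distributed M \<Lambda> (\<lambda>\<omega>. \<lambda>p\<in>J. U p \<omega>) (\<lambda>x. ennreal (exp (- (\<Sum>i<n. (cmod (x (e i)))\<^sup>2) / s) / (pi * s) ^ n))"
    if "0 < s" "\<And>p. p \<in> J \<Longrightarrow> complex_gaussian M s (U p)" "indep_vars (\<lambda>_. borel) U J" for s and U :: "'i \<Rightarrow> 'a \<Rightarrow> complex"
  proof -
    have "distributed M \<Lambda> (\<lambda>\<omega>. \<lambda>p\<in>J. U p \<omega>) (\<lambda>x. \<Prod>p\<in>J. ennreal (cg_density s (x p)))"
      unfolding \<Lambda>_def using that(2) by (intro distributed_PiM_lborel J that(3)) (simp add: complex_gaussian_def)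
    then show ?thesis
      using that(1) unfolding cg_density_prod[OF inj that(1), symmetric]
      by (simp add: prod_ennreal J_def)
  qed
  show DX: "distributed M \<Lambda> (\<lambda>\<omega>. \<lambda>p\<in>J. X p \<omega>) (\<lambda>x. ennreal (exp (- (\<Sum>i<n. (cmod (x (e i)))\<^sup>2) / P) / (pi * P) ^ n))"
    by (rule density[OF P X])
  have DV: "distributed M \<Lambda> (\<lambda>\<omega>. \<lambda>p\<in>J. V p \<omega>) (\<lambda>x. ennreal (exp (- (\<Sum>i<n. (cmod (x (e i)))\<^sup>2)) / pi ^ n))"
    using density[OF _ V] by simp
  have indep': "indep_var \<Lambda> (\<lambda>\<omega>. \<lambda>p\<in>J. X p \<omega>) \<Lambda> (\<lambda>\<omega>. \<lambda>p\<in>J. V p \<omega>)"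
    by (rule indep_var_cong_sets[OF indep sets_\<Lambda> sets_\<Lambda>])
  define a where "a x v = (\<lambda>p\<in>J. mv n A (\<lambda>j. x (e j)) (idx p) + v p)" for x v :: "'i \<Rightarrow> complex"
  define s where "s x y = (\<lambda>p\<in>J. - mv n A (\<lambda>j. x (e j)) (idx p) + y p)" for x y :: "'i \<Rightarrow> complex"
  have sh: "(\<lambda>p. \<lambda>q\<in>J. f (mv n A (\<lambda>j. fst p (e j)) (idx q)) + snd p q) \<in> \<Lambda> \<Otimes>\<^sub>M \<Lambda> \<rightarrow>\<^sub>M \<Lambda>"
    if f: "f \<in> borel_measurable borel" for f :: "complex \<Rightarrow> complex"
  proof -
    have "(\<lambda>p. f (mv n A (\<lambda>j. fst p (e j)) (idx q)) + snd p q) \<in> borel_measurable (\<Lambda> \<Otimes>\<^sub>M \<Lambda>)" if "q \<in> J" for q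
      using that eJ
      by (intro borel_measurable_add measurable_compose[OF borel_measurable_mv f]
          measurable_compose[OF measurable_fst comp] measurable_compose[OF measurable_snd comp]) auto
    then have "(\<lambda>p. \<lambda>q\<in>J. f (mv n A (\<lambda>j. fst p (e j)) (idx q)) + snd p q) \<in> \<Lambda> \<Otimes>\<^sub>M \<Lambda> \<rightarrow>\<^sub>M PiM J (\<lambda>_. borel)"
      by (intro measurable_restrict) auto
    then show ?thesis
      using sets_\<Lambda> by (simp cong: measurable_cong_sets)
  qed
  have am: "(\<lambda>(x, v). a x v) \<in> \<Lambda> \<Otimes>\<^sub>M \<Lambda> \<rightarrow>\<^sub>M \<Lambda>"
    using sh[of "\<lambda>z. z"] by (simp add: a_def split_beta')
  have sm: "(\<lambda>(x, v). s x v) \<in> \<Lambda> \<Otimes>\<^sub>M \<Lambda> \<rightarrow>\<^sub>M \<Lambda>"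
    using sh[of uminus] by (simp add: s_def split_beta')
  have inv: "s x (a x v) = v" if "v \<in> space \<Lambda>" for x v
    using that by (auto simp: s_def a_def \<Lambda>_def space_PiM PiE_def extensional_def fun_eq_iff)
  have pres: "distr \<Lambda> \<Lambda> (a x) = \<Lambda>" for x
    unfolding \<Lambda>_def a_def by (rule distr_PiM_lborel_translation[OF J(1)])
  have aY: "a (\<lambda>p\<in>J. X p \<omega>) (\<lambda>p\<in>J. V p \<omega>) = (\<lambda>p\<in>J. Y p \<omega>)" for \<omega>
  proof
    fix p show "a (\<lambda>p\<in>J. X p \<omega>) (\<lambda>p\<in>J. V p \<omega>) p = (\<lambda>p\<in>J. Y p \<omega>) p"
    proof (cases "p \<in> J")
      case True
      then obtain i where i: "i < n" "p = e i" by (auto simp: J_def)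
      have "mv n A (\<lambda>j. (\<lambda>p\<in>J. X p \<omega>) (e j)) i = mv n A (\<lambda>j. X (e j) \<omega>) i"
        by (rule mv_cong) (simp add: eJ)
      then show ?thesis
        using i True by (simp add: a_def Y idx)
    qed (simp add: a_def)
  qed
  have sV: "(\<Sum>i<n. (cmod (s x y (e i)))\<^sup>2) = (\<Sum>i<n. (cmod (y (e i) - mv n A (\<lambda>j. x (e j)) i))\<^sup>2)" for x y
    by (intro sum.cong) (auto simp: s_def eJ idx)
  show DXY: "distributed M (\<Lambda> \<Otimes>\<^sub>M \<Lambda>) (\<lambda>\<omega>. (\<lambda>p\<in>J. X p \<omega>, \<lambda>p\<in>J. Y p \<omega>))
      (\<lambda>(x, y). ennreal (exp (- (\<Sum>i<n. (cmod (x (e i)))\<^sup>2) / P) / (pi * P) ^ n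
         * (exp (- (\<Sum>i<n. (cmod (y (e i) - mv n A (\<lambda>j. x (e j)) i))\<^sup>2)) / pi ^ n)))"
    using distributed_shear[OF sf sf DX DV indep' am sm inv pres] P
    unfolding aY sV by (simp add: ennreal_mult[symmetric])
  have "distributed M \<Lambda> (\<lambda>\<omega>. \<lambda>p\<in>J. Y p \<omega>)
      (\<lambda>y. \<integral>\<^sup>+x. (\<lambda>(x, y). ennreal (exp (- (\<Sum>i<n. (cmod (x (e i)))\<^sup>2) / P) / (pi * P) ^ n
         * (exp (- (\<Sum>i<n. (cmod (y (e i) - mv n A (\<lambda>j. x (e j)) i))\<^sup>2)) / pi ^ n))) (x, y) \<partial>\<Lambda>)"
    by (rule distr_marginal2[OF sf sf DXY])
  moreover have "(\<integral>\<^sup>+x. ennreal (exp (- (\<Sum>i<n. (cmod (x (e i)))\<^sup>2) / P) / (pi * P) ^ n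
         * (exp (- (\<Sum>i<n. (cmod (y (e i) - mv n A (\<lambda>j. x (e j)) i))\<^sup>2)) / pi ^ n)) \<partial>\<Lambda>)
     = ennreal (exp (- Re (qform n R (\<lambda>i. y (e i)))) / ((pi * P) ^ n * d))" for y
  proof -
    \<comment> \<open>\<open>m\<close> is the conditional mean of the input given \<open>y\<close>;
      translation by it removes \<open>y\<close> from the inner integral, and \<open>k\<close>
      collects all that is constant in \<open>x\<close>.\<close>
    define m where "m = mv n G (\<lambda>i. y (e i))"
    define k where "k = exp (- Re (qform n R (\<lambda>i. y (e i)))) / ((pi * P) ^ n * pi ^ n)"
    let ?h = "\<lambda>x. ennreal (exp (- Re (qform n (gram n P A) (\<lambda>i. x (e i)))))"
    have hm: "?h \<in> borel_measurable \<Lambda>"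
      using borel_measurable_qform[of n "\<lambda>x i. x (e i)" \<Lambda> "gram n P A"] comp eJ by simp
    have "(\<integral>\<^sup>+x. ?h x \<partial>\<Lambda>) = (\<integral>\<^sup>+x. ?h x \<partial>distr \<Lambda> \<Lambda> (\<lambda>v. \<lambda>p\<in>J. - m (idx p) + v p))"
      unfolding \<Lambda>_def by (subst distr_PiM_lborel_translation[OF J(1)]) (rule refl)
    also have "\<dots> = (\<integral>\<^sup>+x. ?h (\<lambda>p\<in>J. - m (idx p) + x p) \<partial>\<Lambda>)"
      by (rule nn_integral_distr) (use hm in \<open>auto simp: \<Lambda>_def intro!: measurable_restrict\<close>)
    also have "\<dots> = (\<integral>\<^sup>+x. ennreal (exp (- Re (qform n (gram n P A) (\<lambda>i. x (e i) - m i)))) \<partial>\<Lambda>)"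
    proof -
      have "qform n (gram n P A) (\<lambda>i. (\<lambda>p\<in>J. - m (idx p) + x p) (e i)) = qform n (gram n P A) (\<lambda>i. x (e i) - m i)" for x
        unfolding qform_def by (intro sum.cong refl) (simp add: eJ idx)
      then show ?thesis by simp
    qed
    finally have "(\<integral>\<^sup>+x. ?h x \<partial>\<Lambda>) = \<dots>" .
    moreover have "(\<integral>\<^sup>+x. ?h x \<partial>\<Lambda>) = ennreal (pi ^ n / d)"
      using gaussian_integral_pos_def_form[OF inj pos_def_gram[OF P, of n A]] d unfolding \<Lambda>_def J_def by auto
    ultimately have shift: "(\<integral>\<^sup>+x. ennreal (exp (- Re (qform n (gram n P A) (\<lambda>i. x (e i) - m i)))) \<partial>\<Lambda>) = ennreal (pi ^ n / d)"
      by simp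
    have sm': "(\<lambda>x. ennreal (exp (- Re (qform n (gram n P A) (\<lambda>i. x (e i) - m i))))) \<in> borel_measurable \<Lambda>"
      using borel_measurable_qform[of n "\<lambda>x i. x (e i) - m i" \<Lambda> "gram n P A"] comp eJ by simp
    have "(\<integral>\<^sup>+x. ennreal (exp (- (\<Sum>i<n. (cmod (x (e i)))\<^sup>2) / P) / (pi * P) ^ n
         * (exp (- (\<Sum>i<n. (cmod (y (e i) - mv n A (\<lambda>j. x (e j)) i))\<^sup>2)) / pi ^ n)) \<partial>\<Lambda>)
       = (\<integral>\<^sup>+x. ennreal k * ennreal (exp (- Re (qform n (gram n P A) (\<lambda>i. x (e i) - m i)))) \<partial>\<Lambda>)"
    proof (rule nn_integral_cong)
      fix x
      have "exp (- (\<Sum>i<n. (cmod (x (e i)))\<^sup>2) / P) * exp (- (\<Sum>i<n. (cmod (y (e i) - mv n A (\<lambda>j. x (e j)) i))\<^sup>2))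
         = exp (- Re (qform n R (\<lambda>i. y (e i)))) * exp (- Re (qform n (gram n P A) (\<lambda>i. x (e i) - m i)))"
        using decomp[of "\<lambda>i. y (e i)" "\<lambda>i. x (e i)"] unfolding exp_add[symmetric] m_def by simp
      then show "ennreal (exp (- (\<Sum>i<n. (cmod (x (e i)))\<^sup>2) / P) / (pi * P) ^ n
         * (exp (- (\<Sum>i<n. (cmod (y (e i) - mv n A (\<lambda>j. x (e j)) i))\<^sup>2)) / pi ^ n))
         = ennreal k * ennreal (exp (- Re (qform n (gram n P A) (\<lambda>i. x (e i) - m i))))"
        using P by (simp add: ennreal_mult[symmetric] k_def)
    qed
    also have "\<dots> = ennreal k * ennreal (pi ^ n / d)"
      by (subst nn_integral_cmult[OF sm']) (simp add: shift)
    also have "\<dots> = ennreal (exp (- Re (qform n R (\<lambda>i. y (e i)))) / ((pi * P) ^ n * d))"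
      using P d(1) by (subst ennreal_mult[symmetric]) (simp_all add: k_def)
    finally show ?thesis .
  qed
  ultimately show "distributed M \<Lambda> (\<lambda>\<omega>. \<lambda>p\<in>J. Y p \<omega>)
      (\<lambda>y. ennreal (exp (- Re (qform n R (\<lambda>i. y (e i)))) / ((pi * P) ^ n * d)))"
    by simp
qed

section \<open>Second moments of inputs, noise and outputs\<close>

lemma (in prob_space) complex_gaussian_covariance:
  fixes U U' :: "'a \<Rightarrow> complex"
  assumes s: "0 < s" "0 < t" and U: "complex_gaussian M s U" "complex_gaussian M t U'"
    and indep: "indep_var borel U borel U'"
  shows "has_bochner_integral M (\<lambda>\<omega>. U \<omega> * cnj (U' \<omega>)) 0"
proof -
  note U1 = complex_gaussian_moments[OF s(1) U(1)] and U2 = complex_gaussian_moments[OF s(2) U(2)]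
  have ind: "indep_var borel U borel (\<lambda>\<omega>. cnj (U' \<omega>))"
    using indep_var_compose[OF indep, of "\<lambda>z. z" borel cnj borel] by (simp add: comp_def)
  have int: "integrable M (\<lambda>\<omega>. cnj (U' \<omega>))"
    using U2(3) by simp
  show ?thesis
    using indep_var_integrable[OF ind U1(3) int] indep_var_lebesgue_integral[OF ind U1(3) int] U1(4)
    by (simp add: has_bochner_integral_iff)
qed

lemma (in prob_space) complex_gaussian_variance:
  assumes s: "0 < s" and U: "complex_gaussian M s U"
  shows "has_bochner_integral M (\<lambda>\<omega>. U \<omega> * cnj (U \<omega>)) (complex_of_real s)"
proof -
  have "has_bochner_integral M (\<lambda>\<omega>. complex_of_real ((cmod (U \<omega>))\<^sup>2)) (complex_of_real s)"
    using complex_gaussian_moments(1,2)[OF s U] by (intro has_bochner_integral_of_real) (simp add: has_bochner_integral_iff)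
  then show ?thesis
    by (simp only: complex_norm_square)
qed

lemma (in prob_space) indep_var_components:
  assumes indep: "indep_var (PiM I M1) (\<lambda>\<omega>. \<lambda>p\<in>I. X p \<omega>) (PiM J M2) (\<lambda>\<omega>. \<lambda>p\<in>J. V p \<omega>)"
    and "p \<in> I" "q \<in> J"
  shows "indep_var (M1 p) (X p) (M2 q) (V q)"
  using indep_var_compose[OF indep measurable_component_singleton[of p I M1] measurable_component_singleton[of q J M2]] assms(2,3)
  by (simp add: comp_def)

lemma (in prob_space) indep_vars_pair:
  assumes "indep_vars N X I" "i \<in> I" "j \<in> I" "i \<noteq> j"
  shows "indep_var (N i) (X i) (N j) (X j)"
proof -
  have "indep_var (PiM {i} N) (\<lambda>\<omega>. restrict (\<lambda>k. X k \<omega>) {i}) (PiM {j} N) (\<lambda>\<omega>. restrict (\<lambda>k. X k \<omega>) {j})"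
    using assms by (intro indep_var_restrict[OF assms(1)]) auto
  then show ?thesis
    by (rule indep_var_components) auto
qed

text \<open>The value is the trace of \<open>R\<close> times the output covariance
  \<open>I + P A A^H\<close>; in this covariance all input-noise terms vanish by independence and
  zero means.\<close>

lemma (in prob_space) expectation_channel_qform:
  fixes n :: nat and e :: "nat \<Rightarrow> 'i" and A R :: "nat \<Rightarrow> nat \<Rightarrow> complex" and X V :: "'i \<Rightarrow> 'a \<Rightarrow> complex"
  assumes P: "0 < P" and inj: "inj_on e {..<n}"
    and X: "\<And>p. p \<in> e ` {..<n} \<Longrightarrow> complex_gaussian M P (X p)" "indep_vars (\<lambda>_. borel) X (e ` {..<n})"
    and V: "\<And>p. p \<in> e ` {..<n} \<Longrightarrow> complex_gaussian M 1 (V p)" "indep_vars (\<lambda>_. borel) V (e ` {..<n})"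
    and indep: "indep_var (PiM (e ` {..<n}) (\<lambda>_. borel)) (\<lambda>\<omega>. \<lambda>p\<in>e ` {..<n}. X p \<omega>)
       (PiM (e ` {..<n}) (\<lambda>_. borel)) (\<lambda>\<omega>. \<lambda>p\<in>e ` {..<n}. V p \<omega>)"
    and Y: "\<And>i. i < n \<Longrightarrow> Y (e i) = (\<lambda>\<omega>. mv n A (\<lambda>j. X (e j) \<omega>) i + V (e i) \<omega>)"
  shows "has_bochner_integral M (\<lambda>\<omega>. qform n R (\<lambda>i. Y (e i) \<omega>))
    (\<Sum>i<n. \<Sum>j<n. R i j * ((if i = j then 1 else 0) + complex_of_real P * (\<Sum>k<n. A j k * cnj (A i k))))"
proof -
  have one: "0 < (1 :: real)" by simp
  have cov: "has_bochner_integral M (\<lambda>\<omega>. U (e k) \<omega> * cnj (U (e l) \<omega>)) (if k = l then complex_of_real s else 0)"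
    if "0 < s" "\<And>p. p \<in> e ` {..<n} \<Longrightarrow> complex_gaussian M s (U p)" "indep_vars (\<lambda>_. borel) U (e ` {..<n})" "k < n" "l < n"
    for s k l and U :: "'i \<Rightarrow> 'a \<Rightarrow> complex"
  proof (cases "k = l")
    case True
    then show ?thesis
      using complex_gaussian_variance[OF that(1), of "U (e k)"] that(2,4) by simp
  next
    case False
    then have "e k \<noteq> e l"
      using inj that(4,5) by (auto simp: inj_on_def)
    then have "indep_var borel (U (e k)) borel (U (e l))"
      using indep_vars_pair[OF that(3), of "e k" "e l"] that(4,5) by simp
    then show ?thesis
      using complex_gaussian_covariance[OF that(1,1), of "U (e k)" "U (e l)"] that(2,4,5) False by simp
  qed
  have XV: "has_bochner_integral M (\<lambda>\<omega>. X (e k) \<omega> * cnj (V (e l) \<omega>)) 0" if "k < n" "l < n" for k l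
    using complex_gaussian_covariance[OF P one, of "X (e k)" "V (e l)"] X(1) V(1)
      indep_var_components[OF indep, of "e k" "e l"] that by simp
  have VX: "has_bochner_integral M (\<lambda>\<omega>. V (e l) \<omega> * cnj (X (e k) \<omega>)) 0" if "k < n" "l < n" for k l
    using has_bochner_integral_cnj[OF XV[OF that]] by (simp add: mult.commute)
  have YY: "has_bochner_integral M (\<lambda>\<omega>. Y (e j) \<omega> * cnj (Y (e i) \<omega>))
     ((if i = j then 1 else 0) + complex_of_real P * (\<Sum>k<n. A j k * cnj (A i k)))"
    if i: "i < n" and j: "j < n" for i j
  proof -
    have "has_bochner_integral M (\<lambda>\<omega>.
        (\<Sum>k<n. \<Sum>l<n. A j k * cnj (A i l) * (X (e k) \<omega> * cnj (X (e l) \<omega>))) + (\<Sum>k<n. A j k * (X (e k) \<omega> * cnj (V (e i) \<omega>)))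
        + (\<Sum>l<n. cnj (A i l) * (V (e j) \<omega> * cnj (X (e l) \<omega>))) + V (e j) \<omega> * cnj (V (e i) \<omega>))
       ((\<Sum>k<n. \<Sum>l<n. A j k * cnj (A i l) * (if k = l then complex_of_real P else 0)) + (\<Sum>k<n. A j k * 0)
        + (\<Sum>l<n. cnj (A i l) * 0) + (if j = i then complex_of_real 1 else 0))"
      by (intro has_bochner_integral_add has_bochner_integral_sum has_bochner_integral_mult_right
          cov[OF P X] cov[OF one V] XV VX i j) auto
    also have "(\<lambda>\<omega>.
        (\<Sum>k<n. \<Sum>l<n. A j k * cnj (A i l) * (X (e k) \<omega> * cnj (X (e l) \<omega>))) + (\<Sum>k<n. A j k * (X (e k) \<omega> * cnj (V (e i) \<omega>)))
        + (\<Sum>l<n. cnj (A i l) * (V (e j) \<omega> * cnj (X (e l) \<omega>))) + V (e j) \<omega> * cnj (V (e i) \<omega>))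
        = (\<lambda>\<omega>. Y (e j) \<omega> * cnj (Y (e i) \<omega>))"
    proof
      fix \<omega>
      define S S' where "S = mv n A (\<lambda>k. X (e k) \<omega>) j" and "S' = mv n A (\<lambda>k. X (e k) \<omega>) i"
      have "(\<Sum>k<n. \<Sum>l<n. A j k * cnj (A i l) * (X (e k) \<omega> * cnj (X (e l) \<omega>))) = S * cnj S'"
        unfolding S_def S'_def mv_def cnj_sum sum_product by (intro sum.cong refl) (simp add: mult_ac)
      moreover have "(\<Sum>k<n. A j k * (X (e k) \<omega> * cnj (V (e i) \<omega>))) = S * cnj (V (e i) \<omega>)"
        unfolding S_def mv_def sum_distrib_right by (intro sum.cong refl) (simp add: mult_ac)
      moreover have "(\<Sum>l<n. cnj (A i l) * (V (e j) \<omega> * cnj (X (e l) \<omega>))) = V (e j) \<omega> * cnj S'"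
        unfolding S'_def mv_def cnj_sum sum_distrib_left by (intro sum.cong refl) (simp add: mult_ac)
      ultimately show "(\<Sum>k<n. \<Sum>l<n. A j k * cnj (A i l) * (X (e k) \<omega> * cnj (X (e l) \<omega>))) + (\<Sum>k<n. A j k * (X (e k) \<omega> * cnj (V (e i) \<omega>)))
        + (\<Sum>l<n. cnj (A i l) * (V (e j) \<omega> * cnj (X (e l) \<omega>))) + V (e j) \<omega> * cnj (V (e i) \<omega>)
        = Y (e j) \<omega> * cnj (Y (e i) \<omega>)"
        by (simp add: Y[OF i] Y[OF j] S_def S'_def algebra_simps)
    qed
    also have "(\<Sum>k<n. \<Sum>l<n. A j k * cnj (A i l) * (if k = l then complex_of_real P else 0)) = complex_of_real P * (\<Sum>k<n. A j k * cnj (A i k))"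
      unfolding sum_distrib_left by (intro sum.cong refl) (simp add: if_distrib cong: if_cong)
    finally show ?thesis
      by (cases "i = j") (auto simp: add.commute)
  qed
  have "has_bochner_integral M (\<lambda>\<omega>. \<Sum>i<n. \<Sum>j<n. R i j * (Y (e j) \<omega> * cnj (Y (e i) \<omega>)))
    (\<Sum>i<n. \<Sum>j<n. R i j * ((if i = j then 1 else 0) + complex_of_real P * (\<Sum>k<n. A j k * cnj (A i k))))"
    by (intro has_bochner_integral_sum has_bochner_integral_mult_right YY) auto
  then show ?thesis
    by (simp add: qform_def mult_ac)
qed

text \<open>The density ratio is \<open>D * exp (y^H R y - |v|^2)\<close> with \<open>v\<close> the
  noise, and both quadratic terms have expectation \<open>n\<close>, so the expected logarithm is
  \<open>log 2 D\<close> alone. Absolute continuity is provided as well, since it licenses a later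
  change of the output variable.\<close>

theorem (in prob_space) mutual_information_gaussian_channel:
  fixes n :: nat and e :: "nat \<Rightarrow> 'i" and A :: "nat \<Rightarrow> nat \<Rightarrow> complex" and X V Y :: "'i \<Rightarrow> 'a \<Rightarrow> complex"
  defines "J \<equiv> e ` {..<n}"
  assumes n: "0 < n" and P: "0 < P" and inj: "inj_on e {..<n}"
    and X: "\<And>p. p \<in> J \<Longrightarrow> complex_gaussian M P (X p)" "indep_vars (\<lambda>_. borel) X J"
    and V: "\<And>p. p \<in> J \<Longrightarrow> complex_gaussian M 1 (V p)" "indep_vars (\<lambda>_. borel) V J"
    and indep: "indep_var (PiM J (\<lambda>_. borel)) (\<lambda>\<omega>. \<lambda>p\<in>J. X p \<omega>) (PiM J (\<lambda>_. borel)) (\<lambda>\<omega>. \<lambda>p\<in>J. V p \<omega>)"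
    and Y: "\<And>i. i < n \<Longrightarrow> Y (e i) = (\<lambda>\<omega>. mv n A (\<lambda>j. X (e j) \<omega>) i + V (e i) \<omega>)"
  obtains D where "0 < D"
    and "Determinant.det (mat n n (\<lambda>(i, j). (if i = j then 1 else 0) + complex_of_real P * (\<Sum>k<n. cnj (A k i) * A k j))) = complex_of_real D"
    and "mutual_information 2 (PiM J (\<lambda>_. borel)) (PiM J (\<lambda>_. borel)) (\<lambda>\<omega>. \<lambda>p\<in>J. X p \<omega>) (\<lambda>\<omega>. \<lambda>p\<in>J. Y p \<omega>) = log 2 D"
    and "absolutely_continuous
        (distr M (PiM J (\<lambda>_. borel)) (\<lambda>\<omega>. \<lambda>p\<in>J. X p \<omega>) \<Otimes>\<^sub>M distr M (PiM J (\<lambda>_. borel)) (\<lambda>\<omega>. \<lambda>p\<in>J. Y p \<omega>))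
        (distr M (PiM J (\<lambda>_. borel) \<Otimes>\<^sub>M PiM J (\<lambda>_. borel)) (\<lambda>\<omega>. (\<lambda>p\<in>J. X p \<omega>, \<lambda>p\<in>J. Y p \<omega>)))"
proof -
  interpret information_space M 2
    by unfold_locales simp
  define \<Lambda> where "\<Lambda> = PiM J (\<lambda>_. lborel :: complex measure)"
  obtain d where d: "0 < d" "Determinant.det (mat n n (\<lambda>(i, j). gram n P A i j)) = complex_of_real d"
    using gaussian_integral_pos_def_form[OF inj pos_def_gram[OF P, of n A]] by blast
  from d have "Determinant.det (mat n n (\<lambda>(i, j). gram n P A i j)) \<noteq> 0" by simp
  from channel_exponent_decomposition[OF P this] obtain G R where
    decomp: "\<And>x y. (\<Sum>i<n. (cmod (y i - mv n A x i))\<^sup>2) + (\<Sum>i<n. (cmod (x i))\<^sup>2) / P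
       = Re (qform n (gram n P A) (\<lambda>i. x i - mv n G y i)) + Re (qform n R y)"
    and tr: "(\<Sum>i<n. \<Sum>j<n. R i j * ((if i = j then 1 else 0) + complex_of_real P * (\<Sum>k<n. A j k * cnj (A i k)))) = of_nat n"
    by blast
  define Px where "Px x = exp (- (\<Sum>i<n. (cmod (x (e i)))\<^sup>2) / P) / (pi * P) ^ n" for x :: "'i \<Rightarrow> complex"
  define Pxy where "Pxy = (\<lambda>(x, y). Px x * (exp (- (\<Sum>i<n. (cmod (y (e i) - mv n A (\<lambda>j. x (e j)) i))\<^sup>2)) / pi ^ n))"
  define Py where "Py y = exp (- Re (qform n R (\<lambda>i. y (e i)))) / ((pi * P) ^ n * d)" for y :: "'i \<Rightarrow> complex"
  note dens = gaussian_channel_densities[OF n P inj X[unfolded J_def] V[unfolded J_def] indep[unfolded J_def] Y[THEN fun_cong] d decomp]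
  have DX: "distributed M \<Lambda> (\<lambda>\<omega>. \<lambda>p\<in>J. X p \<omega>) (\<lambda>x. ennreal (Px x))"
    and DXY: "distributed M (\<Lambda> \<Otimes>\<^sub>M \<Lambda>) (\<lambda>\<omega>. (\<lambda>p\<in>J. X p \<omega>, \<lambda>p\<in>J. Y p \<omega>)) (\<lambda>p. ennreal (Pxy p))"
    and DY: "distributed M \<Lambda> (\<lambda>\<omega>. \<lambda>p\<in>J. Y p \<omega>) (\<lambda>y. ennreal (Py y))"
    using dens unfolding \<Lambda>_def J_def Px_def Pxy_def Py_def by (simp_all add: split_beta')
  have sf: "sigma_finite_measure \<Lambda>"
    unfolding \<Lambda>_def J_def by (rule sigma_finite_PiM_lborel) simp
  have pos: "0 < Px x" "0 < Py y" "0 < Pxy p" for x y p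
    using P d(1) by (auto simp: Px_def Py_def Pxy_def split_beta')
  \<comment> \<open>The claim speaks of Borel spaces, the densities of Lebesgue measure; both have
    the same measurable sets, and laws depend on nothing else.\<close>
  let ?S = "PiM J (\<lambda>_. borel :: complex measure)"
  have sets_S: "sets ?S = sets \<Lambda>"
    unfolding \<Lambda>_def by (intro sets_PiM_cong) auto
  \<comment> \<open>\<open>I + P A^H A\<close> is \<open>P\<close> times the Gram form, whose
    determinant is \<open>d\<close>; scaling \<open>n\<close> rows gives
    \<open>P ^ n\<close>.\<close>
  define D where "D = P ^ n * d"
  have D: "0 < D"
    using P d(1) by (simp add: D_def)
  have detD: "Determinant.det (mat n n (\<lambda>(i, j). (if i = j then 1 else 0) + complex_of_real P * (\<Sum>k<n. cnj (A k i) * A k j))) = complex_of_real D"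
  proof -
    have "mat n n (\<lambda>(i, j). (if i = j then 1 else 0) + complex_of_real P * (\<Sum>k<n. cnj (A k i) * A k j))
       = complex_of_real P \<cdot>\<^sub>m mat n n (\<lambda>(i, j). gram n P A i j)"
      using P by (intro eq_matI) (auto simp: gram_def distrib_left)
    then show ?thesis
      by (simp add: det_smult d(2) D_def)
  qed
  have ratio: "Pxy (x, y) / (Px x * Py y)
     = D * exp (Re (qform n R (\<lambda>i. y (e i))) - (\<Sum>i<n. (cmod (y (e i) - mv n A (\<lambda>j. x (e j)) i))\<^sup>2))" for x y
    using P d(1) pos(1)[of x]
    by (simp add: Pxy_def Py_def D_def exp_diff exp_minus power_mult_distrib field_simps)
  define L where "L = (\<lambda>(x, y). log 2 D + (Re (qform n R (\<lambda>i. y (e i))) - (\<Sum>i<n. (cmod (y (e i) - mv n A (\<lambda>j. x (e j)) i))\<^sup>2)) / ln 2)"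
  have L: "log 2 (Pxy p / (Px (fst p) * Py (snd p))) = L p" for p
    using D ratio[of "fst p" "snd p"] by (simp add: L_def split_beta' log_def ln_mult add_divide_distrib)
  have comp: "(\<lambda>x. x (e i)) \<in> borel_measurable \<Lambda>" if "i < n" for i
    unfolding \<Lambda>_def by (rule borel_measurable_PiM_component) (simp add: J_def that)
  have Lm: "L \<in> borel_measurable (\<Lambda> \<Otimes>\<^sub>M \<Lambda>)"
  proof -
    have f: "(\<lambda>p. fst p (e i)) \<in> borel_measurable (\<Lambda> \<Otimes>\<^sub>M \<Lambda>)" "(\<lambda>p. snd p (e i)) \<in> borel_measurable (\<Lambda> \<Otimes>\<^sub>M \<Lambda>)" if "i < n" for i
      using measurable_compose[OF measurable_fst comp[OF that]] measurable_compose[OF measurable_snd comp[OF that]] by auto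
    have 1: "(\<lambda>p. qform n R (\<lambda>i. snd p (e i))) \<in> borel_measurable (\<Lambda> \<Otimes>\<^sub>M \<Lambda>)"
      by (rule borel_measurable_qform) (rule f)
    have 2: "(\<lambda>p. mv n A (\<lambda>j. fst p (e j)) i) \<in> borel_measurable (\<Lambda> \<Otimes>\<^sub>M \<Lambda>)" for i
      by (rule borel_measurable_mv) (rule f)
    have "(\<lambda>p. \<Sum>i<n. (cmod (snd p (e i) - mv n A (\<lambda>j. fst p (e j)) i))\<^sup>2) \<in> borel_measurable (\<Lambda> \<Otimes>\<^sub>M \<Lambda>)"
      using f(2) 2 by (intro borel_measurable_sum borel_measurable_power borel_measurable_norm borel_measurable_diff) auto
    then show ?thesis
      using 1 unfolding L_def split_beta' by measurable
  qed
  \<comment> \<open>Along the channel, the output minus the transformed input is the noise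
    \<open>V\<close>, so the second quadratic term becomes the noise energy.\<close>
  have XVL: "L (\<lambda>p\<in>J. X p \<omega>, \<lambda>p\<in>J. Y p \<omega>)
     = log 2 D + (Re (qform n R (\<lambda>i. Y (e i) \<omega>)) - (\<Sum>i<n. (cmod (V (e i) \<omega>))\<^sup>2)) / ln 2" for \<omega>
  proof -
    have eJ: "e i \<in> J" if "i < n" for i
      using that by (simp add: J_def)
    have "qform n R (\<lambda>i. (\<lambda>p\<in>J. Y p \<omega>) (e i)) = qform n R (\<lambda>i. Y (e i) \<omega>)"
      unfolding qform_def by (intro sum.cong refl) (simp add: eJ)
    moreover have "mv n A (\<lambda>j. (\<lambda>p\<in>J. X p \<omega>) (e j)) i = mv n A (\<lambda>j. X (e j) \<omega>) i" for i
      by (rule mv_cong) (simp add: eJ)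
    ultimately show ?thesis
      by (simp add: L_def eJ Y)
  qed
  have EV: "has_bochner_integral M (\<lambda>\<omega>. \<Sum>i<n. (cmod (V (e i) \<omega>))\<^sup>2) (\<Sum>i<n. 1)"
    using complex_gaussian_moments(1,2)[of 1 "V (e i)" for i] V(1)
    by (intro has_bochner_integral_sum) (auto simp: has_bochner_integral_iff J_def)
  have EQ: "has_bochner_integral M (\<lambda>\<omega>. qform n R (\<lambda>i. Y (e i) \<omega>)) (of_nat n)"
    using expectation_channel_qform[OF P inj X[unfolded J_def] V[unfolded J_def] indep[unfolded J_def] Y, of R] tr by simp
  have EQ': "has_bochner_integral M (\<lambda>\<omega>. Re (qform n R (\<lambda>i. Y (e i) \<omega>))) (real n)"
    using has_bochner_integral_Re[OF EQ] by simp
  have EL: "expectation (\<lambda>\<omega>. L (\<lambda>p\<in>J. X p \<omega>, \<lambda>p\<in>J. Y p \<omega>)) = log 2 D"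
    using EV EQ' unfolding XVL by (simp add: has_bochner_integral_iff prob_space)
  have "mutual_information 2 ?S ?S (\<lambda>\<omega>. \<lambda>p\<in>J. X p \<omega>) (\<lambda>\<omega>. \<lambda>p\<in>J. Y p \<omega>)
      = mutual_information 2 \<Lambda> \<Lambda> (\<lambda>\<omega>. \<lambda>p\<in>J. X p \<omega>) (\<lambda>\<omega>. \<lambda>p\<in>J. Y p \<omega>)"
    by (rule mutual_information_cong_sets[OF sets_S sets_S])
  also have "\<dots> = (LINT p|(\<Lambda> \<Otimes>\<^sub>M \<Lambda>). Pxy p * log 2 (Pxy p / (Px (fst p) * Py (snd p))))"
    by (rule mutual_information_distr[OF sf sf DX _ DY _ DXY]) (auto intro: less_imp_le pos)
  also have "\<dots> = (LINT p|(\<Lambda> \<Otimes>\<^sub>M \<Lambda>). Pxy p * L p)"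
    by (simp add: L)
  also have "\<dots> = expectation (\<lambda>\<omega>. L (\<lambda>p\<in>J. X p \<omega>, \<lambda>p\<in>J. Y p \<omega>))"
    by (rule distributed_integral[OF DXY Lm]) (auto intro: less_imp_le pos)
  finally have MI: "mutual_information 2 ?S ?S (\<lambda>\<omega>. \<lambda>p\<in>J. X p \<omega>) (\<lambda>\<omega>. \<lambda>p\<in>J. Y p \<omega>) = log 2 D"
    by (simp add: EL)
  have ac: "absolutely_continuous (distr M ?S (\<lambda>\<omega>. \<lambda>p\<in>J. X p \<omega>) \<Otimes>\<^sub>M distr M ?S (\<lambda>\<omega>. \<lambda>p\<in>J. Y p \<omega>))
        (distr M (?S \<Otimes>\<^sub>M ?S) (\<lambda>\<omega>. (\<lambda>p\<in>J. X p \<omega>, \<lambda>p\<in>J. Y p \<omega>)))"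
  proof -
    have XS: "distr M ?S (\<lambda>\<omega>. \<lambda>p\<in>J. X p \<omega>) = density \<Lambda> (\<lambda>x. ennreal (Px x))"
      using distr_cong[OF refl sets_S, of M "\<lambda>\<omega>. \<lambda>p\<in>J. X p \<omega>" "\<lambda>\<omega>. \<lambda>p\<in>J. X p \<omega>"] DX by (simp add: distributed_def)
    have YS: "distr M ?S (\<lambda>\<omega>. \<lambda>p\<in>J. Y p \<omega>) = density \<Lambda> (\<lambda>y. ennreal (Py y))"
      using distr_cong[OF refl sets_S, of M "\<lambda>\<omega>. \<lambda>p\<in>J. Y p \<omega>" "\<lambda>\<omega>. \<lambda>p\<in>J. Y p \<omega>"] DY by (simp add: distributed_def)
    have JS: "distr M (?S \<Otimes>\<^sub>M ?S) (\<lambda>\<omega>. (\<lambda>p\<in>J. X p \<omega>, \<lambda>p\<in>J. Y p \<omega>)) = density (\<Lambda> \<Otimes>\<^sub>M \<Lambda>) (\<lambda>p. ennreal (Pxy p))"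
      using distr_cong[OF refl sets_pair_measure_cong[OF sets_S sets_S], of M "\<lambda>\<omega>. (\<lambda>p\<in>J. X p \<omega>, \<lambda>p\<in>J. Y p \<omega>)" "\<lambda>\<omega>. (\<lambda>p\<in>J. X p \<omega>, \<lambda>p\<in>J. Y p \<omega>)"] DXY
      by (simp add: distributed_def)
    have m: "(\<lambda>x. ennreal (Px x)) \<in> borel_measurable \<Lambda>" "(\<lambda>x. ennreal (Py x)) \<in> borel_measurable \<Lambda>"
      "(\<lambda>p. ennreal (Pxy p)) \<in> borel_measurable (\<Lambda> \<Otimes>\<^sub>M \<Lambda>)"
      using DX DY DXY by (auto simp: distributed_def)
    have sfY: "sigma_finite_measure (density \<Lambda> (\<lambda>y. ennreal (Py y)))"
      using DY by (metis distributed_def prob_space_distr prob_space_imp_sigma_finite)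
    have mXY: "(\<lambda>(x, y). ennreal (Px x) * ennreal (Py y)) \<in> borel_measurable (\<Lambda> \<Otimes>\<^sub>M \<Lambda>)"
      using m(1,2) by measurable
    show ?thesis
      unfolding XS YS JS pair_measure_density[OF m(1,2) sf sfY] absolutely_continuous_def
        null_sets_density_iff[OF mXY] null_sets_density_iff[OF m(3)]
    proof (intro subsetI, unfold null_sets_density_iff[OF mXY] null_sets_density_iff[OF m(3)])
      fix A assume "A \<in> sets (\<Lambda> \<Otimes>\<^sub>M \<Lambda>) \<and> (AE p in \<Lambda> \<Otimes>\<^sub>M \<Lambda>. p \<in> A \<longrightarrow> (case p of (x, y) \<Rightarrow> ennreal (Px x) * ennreal (Py y)) = 0)"
      \<comment> \<open>The product density is positive everywhere, so a null set of the product law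
        is null for the reference measure and carries no mass of the joint density.\<close>
      moreover have "(case p of (x, y) \<Rightarrow> ennreal (Px x) * ennreal (Py y)) \<noteq> 0" for p
        using pos by (auto split: prod.split simp: less_imp_neq[symmetric])
      ultimately show "A \<in> sets (\<Lambda> \<Otimes>\<^sub>M \<Lambda>) \<and> (AE p in \<Lambda> \<Otimes>\<^sub>M \<Lambda>. p \<in> A \<longrightarrow> ennreal (Pxy p) = 0)"
        by auto
    qed
  qed
  show thesis
    by (rule that[OF D detD MI ac])
qed

section \<open>Orthonormality of shifted sinc functions\<close>

text \<open>The normalised sinc, with zeros at the nonzero integers, so that its integer shifts are
  orthonormal. Going through \<open>sinc\<close> supplies the value 1 and continuity at 0.\<close>

definition nsinc :: "real \<Rightarrow> real" where
  "nsinc u = sinc (pi * u)"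

lemma nsinc_0 [simp]: "nsinc 0 = 1"
  and nsinc_nonzero: "u \<noteq> 0 \<Longrightarrow> nsinc u = sin (pi * u) / (pi * u)"
  and nsinc_minus [simp]: "nsinc (- u) = nsinc u"
  by (simp_all add: nsinc_def)

lemma isCont_nsinc: "isCont nsinc u"
proof -
  have "continuous_on UNIV nsinc"
    unfolding nsinc_def by (intro continuous_intros)
  then show ?thesis
    by (simp add: continuous_on_eq_continuous_at)
qed

lemma isCont_nsinc' [continuous_intros]: "isCont f u \<Longrightarrow> isCont (\<lambda>x. nsinc (f x)) u"
  by (rule isCont_o2[OF _ isCont_nsinc])

lemma borel_measurable_nsinc [measurable]: "nsinc \<in> borel_measurable borel"
  by (intro borel_measurable_continuous_onI continuous_at_imp_continuous_on ballI isCont_nsinc)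

text \<open>Integration by parts gives the antiderivative
  \<open>(Si (2 * pi * u) - (sin (pi * u))\<^sup>2 / (pi * u)) / pi\<close> on the positive axis. It
  tends to 0 at 0 and, since \<open>Si\<close> tends to \<open>pi / 2\<close>, to
  \<open>1 / 2\<close> at infinity; evenness doubles this.\<close>

lemma has_bochner_integral_nsinc_squared:
  "has_bochner_integral lborel (\<lambda>u. (nsinc u)\<^sup>2) 1"
proof -
  let ?F = "\<lambda>u. 1 / pi * (Si (2 * pi * u) - (sin (pi * u))\<^sup>2 / (pi * u))"
  have F: "DERIV ?F u :> (nsinc u)\<^sup>2" if u: "0 < u" for u
  proof -
    have "DERIV ?F u :> 1 / pi * (sinc (2 * pi * u) * (2 * pi)
        - (2 * (sin (pi * u) * (cos (pi * u) * pi)) * (pi * u) - (sin (pi * u))\<^sup>2 * pi) / (pi * u * (pi * u)))"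
      using u by (auto intro!: derivative_eq_intros DERIV_chain2[OF DERIV_Si] simp: power2_eq_square)
    also have "1 / pi * (sinc (2 * pi * u) * (2 * pi)
        - (2 * (sin (pi * u) * (cos (pi * u) * pi)) * (pi * u) - (sin (pi * u))\<^sup>2 * pi) / (pi * u * (pi * u))) = (nsinc u)\<^sup>2"
      using u sin_double[of "pi * u"]
      by (simp add: nsinc_nonzero power2_eq_square divide_simps) (simp add: algebra_simps)
    finally show ?thesis .
  qed
  have lim0: "(?F \<longlongrightarrow> 0) (at_right 0)"
  proof -
    have "((\<lambda>u. Si (2 * pi * u)) \<longlongrightarrow> Si (2 * pi * 0)) (at_right 0)"
      by (intro isCont_tendsto_compose[OF isCont_Si] tendsto_intros)
    moreover have "((\<lambda>u. sin (pi * u) * nsinc u) \<longlongrightarrow> sin (pi * 0) * nsinc 0) (at_right 0)"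
      by (intro tendsto_intros isCont_tendsto_compose[OF isCont_nsinc])
    then have "((\<lambda>u. sin (pi * u) * nsinc u) \<longlongrightarrow> 0) (at_right 0)"
      by simp
    then have "((\<lambda>u. (sin (pi * u))\<^sup>2 / (pi * u)) \<longlongrightarrow> 0) (at_right 0)"
      by (rule Lim_transform_eventually)
         (use eventually_at_right_less[of "0 :: real"] in
           \<open>eventually_elim, simp add: nsinc_nonzero power2_eq_square\<close>)
    ultimately have "(?F \<longlongrightarrow> 1 / pi * (Si (2 * pi * 0) - 0)) (at_right 0)"
      by (intro tendsto_intros)
    moreover have "Si 0 = 0"
      by (simp add: Si_def flip: zero_ereal_def)
    ultimately show ?thesis
      by simp
  qed
  have limtop: "(?F \<longlongrightarrow> 1 / 2) at_top"
  proof -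
    have "((\<lambda>u. Si (2 * pi * u)) \<longlongrightarrow> pi / 2) at_top"
      by (rule filterlim_compose[OF Si_at_top]) (auto intro!: filterlim_tendsto_pos_mult_at_top[OF tendsto_const] filterlim_ident)
    moreover have "((\<lambda>u. (sin (pi * u))\<^sup>2 / (pi * u)) \<longlongrightarrow> 0) at_top"
    proof (rule Lim_null_comparison)
      show "\<forall>\<^sub>F u in at_top. norm ((sin (pi * u))\<^sup>2 / (pi * u)) \<le> 1 / (pi * u)"
        using eventually_gt_at_top[of 0]
        by eventually_elim (auto simp: divide_simps abs_square_le_1)
      show "((\<lambda>u. 1 / (pi * u)) \<longlongrightarrow> 0) at_top"
        by real_asymp
    qed
    ultimately have "(?F \<longlongrightarrow> 1 / pi * (pi / 2 - 0)) at_top"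
      by (intro tendsto_intros)
    then show ?thesis by simp
  qed
  note FTC = interval_integral_FTC_nonneg[of 0 \<infinity> ?F "\<lambda>u. (nsinc u)\<^sup>2" 0 "1 / 2"]
  have prem: "((?F \<circ> real_of_ereal) \<longlongrightarrow> 0) (at_right 0)" "((?F \<circ> real_of_ereal) \<longlongrightarrow> 1 / 2) (at_left \<infinity>)"
    using lim0 limtop by (simp_all add: zero_ereal_def ereal_tendsto_simps)
  have int: "set_integrable lborel (einterval 0 \<infinity>) (\<lambda>u. (nsinc u)\<^sup>2)"
    and val: "(LBINT u=0..\<infinity>. (nsinc u)\<^sup>2) = 1 / 2"
    using FTC prem F by (auto intro!: continuous_power isCont_nsinc)
  have "has_bochner_integral lborel (\<lambda>u. indicator {0<..} u *\<^sub>R (nsinc u)\<^sup>2) (1 / 2)"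
    using int val
    by (simp add: has_bochner_integral_iff set_integrable_def interval_lebesgue_integral_def set_lebesgue_integral_def einterval_def greaterThan_def)
  \<comment> \<open>The rule for even functions expects the closed half-line, so the single point 0
    is added.\<close>
  then have "has_bochner_integral lborel (\<lambda>u. indicator {0..} u *\<^sub>R (nsinc u)\<^sup>2) (1 / 2)"
    by (rule has_bochner_integral_discrete_difference[where X="{0}", THEN iffD1, rotated 4])
       (auto split: split_indicator)
  from has_bochner_integral_even_function[OF this]
  show ?thesis by simp
qed

text \<open>For integer \<open>d\<close> one has
  \<open>sin (pi * (u + d)) = sin (pi * u) * cos (pi * d)\<close> with a sign as second factor, so
  the identity is \<open>1 / u - 1 / (u + d) = d / (u * (u + d))\<close> times
  \<open>(sin (pi * u))\<^sup>2 / pi\<close>. Written with \<open>nsinc\<close> it also holds at the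
  removable singularities 0 and \<open>- d\<close>.\<close>

lemma nsinc_partial_fractions:
  assumes d: "d \<in> \<int>" "d \<noteq> 0"
  shows "pi * d * cos (pi * d) * (nsinc u * nsinc (u + d))
    = sin (pi * u) * nsinc u - sin (pi * (u + d)) * nsinc (u + d)"
proof -
  have sd: "sin (pi * d) = 0"
    using d(1) sin_times_pi_eq_0[of d] by (simp add: mult.commute)
  have c: "cos (pi * d) * cos (pi * d) = 1"
    using sin_cos_squared_add[of "pi * d"] sd by (simp add: power2_eq_square)
  have sud: "sin (pi * (u + d)) = sin (pi * u) * cos (pi * d)"
    using sd by (simp add: distrib_left sin_add)
  consider "u = 0" | "u = - d" | "u \<noteq> 0" "u + d \<noteq> 0" by force
  then show ?thesis
  proof cases
    case 1 then show ?thesis using sd d by (simp add: nsinc_nonzero)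
  next
    case 2 then show ?thesis using sd d by (simp add: nsinc_nonzero)
  next
    case 3
    have "pi * d * cos (pi * d) * (nsinc u * nsinc (u + d)) = d * (sin (pi * u))\<^sup>2 * (cos (pi * d) * cos (pi * d)) / (pi * (u * (u + d)))"
      using 3 by (simp add: nsinc_nonzero sud power2_eq_square mult_ac)
    also have "\<dots> = (sin (pi * u))\<^sup>2 / (pi * u) - (sin (pi * u))\<^sup>2 * (cos (pi * d) * cos (pi * d)) / (pi * (u + d))"
      unfolding c using 3 by (simp add: divide_simps) (simp add: algebra_simps)
    also have "\<dots> = sin (pi * u) * nsinc u - sin (pi * (u + d)) * nsinc (u + d)"
      using 3 by (simp add: nsinc_nonzero sud power2_eq_square)
    finally show ?thesis .
  qed
qed

text \<open>\<open>K\<close> itself grows like a logarithm, so neither term has a limit. The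
  derivative is bounded by \<open>1 / (pi * z)\<close>, and the mean value bound over an interval of
  radius \<open>\<bar>d\<bar>\<close> makes the difference small.\<close>

lemma sin_nsinc_antiderivative_shift_vanishes:
  fixes K :: "real \<Rightarrow> real"
  assumes K: "\<And>u. DERIV K u :> sin (pi * u) * nsinc u"
  shows "((\<lambda>u. K u - K (u + d)) \<longlongrightarrow> 0) at_top"
proof (rule Lim_null_comparison)
  show "((\<lambda>u. \<bar>d\<bar> / (pi * (u - \<bar>d\<bar>))) \<longlongrightarrow> 0) at_top"
    by real_asymp
  show "\<forall>\<^sub>F u in at_top. norm (K u - K (u + d)) \<le> \<bar>d\<bar> / (pi * (u - \<bar>d\<bar>))"
    using eventually_gt_at_top[of "\<bar>d\<bar>"]
  proof eventually_elim
    case (elim u)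
    have "norm (K (u + d) - K u) \<le> 1 / (pi * (u - \<bar>d\<bar>)) * norm (u + d - u)"
    proof (rule field_differentiable_bound[where S="{u - \<bar>d\<bar>..u + \<bar>d\<bar>}" and f'="\<lambda>u. sin (pi * u) * nsinc u"])
      fix z assume z: "z \<in> {u - \<bar>d\<bar>..u + \<bar>d\<bar>}"
      then have z0: "0 < z" "u - \<bar>d\<bar> \<le> z" using elim by auto
      have "norm (sin (pi * z) * nsinc z) = (sin (pi * z))\<^sup>2 / (pi * z)"
        using z0 by (simp add: nsinc_nonzero abs_mult power2_eq_square)
      also have "\<dots> \<le> 1 / (pi * z)"
        using z0 by (intro divide_right_mono) (auto simp: abs_square_le_1)
      also have "\<dots> \<le> 1 / (pi * (u - \<bar>d\<bar>))"
        using z0 elim by (intro divide_left_mono mult_left_mono mult_pos_pos) auto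
      finally show "norm (sin (pi * z) * nsinc z) \<le> 1 / (pi * (u - \<bar>d\<bar>))" .
      show "(K has_field_derivative sin (pi * z) * nsinc z) (at z within {u - \<bar>d\<bar>..u + \<bar>d\<bar>})"
        by (rule has_field_derivative_at_within[OF K])
    qed auto
    then show ?case
      by (simp add: abs_minus_commute)
  qed
qed

text \<open>By partial fractions, a difference of two shifts of one function \<open>K\<close> is up
  to a constant an antiderivative of the product. It vanishes at both ends, the left one by
  reflection, since \<open>K\<close> has an odd derivative and so is even. Absolute integrability
  comes separately from that of the squares.\<close>

lemma has_bochner_integral_nsinc_orthogonal:
  assumes d: "d \<in> \<int>" "d \<noteq> 0"
  shows "has_bochner_integral lborel (\<lambda>u. nsinc u * nsinc (u + d)) 0"
proof -
  have "\<exists>K. \<forall>u::real. - \<infinity> < ereal u \<longrightarrow> ereal u < \<infinity> \<longrightarrow> (K has_vector_derivative sin (pi * u) * nsinc u) (at u)"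
    by (rule einterval_antiderivative) (auto intro!: continuous_intros)
  then obtain K where K: "\<And>u. DERIV K u :> sin (pi * u) * nsinc u"
    by (auto simp: has_real_derivative_iff_has_vector_derivative)
  have "DERIV (\<lambda>u. K u - K (- u)) u :> 0" for u
    by (auto intro!: derivative_eq_intros K DERIV_chain2[OF K])
  then have even: "K (- u) = K u" for u
    using DERIV_isconst_all[of "\<lambda>u. K u - K (- u)" u 0] by simp
  have cd: "cos (pi * d) \<noteq> 0"
  proof -
    have "sin (pi * d) = 0"
      using d(1) sin_times_pi_eq_0[of d] by (simp add: mult.commute)
    then show ?thesis
      using sin_cos_squared_add[of "pi * d"] by auto
  qed
  define c where "c = pi * d * cos (pi * d)"
  have c: "c \<noteq> 0" using d cd by (simp add: c_def)
  let ?F = "\<lambda>u. (K u - K (u + d)) / c"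
  have F: "(?F has_vector_derivative nsinc u * nsinc (u + d)) (at u)" for u
  proof -
    have "DERIV ?F u :> (sin (pi * u) * nsinc u - sin (pi * (u + d)) * nsinc (u + d)) / c"
      using c by (auto intro!: derivative_eq_intros K DERIV_chain2[OF K])
    then show ?thesis
      using c unfolding nsinc_partial_fractions[OF d, symmetric] c_def[symmetric]
      by (simp add: has_real_derivative_iff_has_vector_derivative)
  qed
  have top: "(?F \<longlongrightarrow> 0) at_top"
    using tendsto_divide[OF sin_nsinc_antiderivative_shift_vanishes[OF K, of d] tendsto_const[of c]] c by simp
  have bot: "(?F \<longlongrightarrow> 0) at_bot"
  proof -
    have "((\<lambda>u. (K (- u) - K (- u + d)) / c) \<longlongrightarrow> 0) at_top"
      using tendsto_divide[OF sin_nsinc_antiderivative_shift_vanishes[OF K, of "- d"] tendsto_const[of c]] c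
        even[of "u - d" for u] by (simp add: even)
    then show ?thesis
      by (simp add: filterlim_at_bot_mirror)
  qed
  have int: "integrable lborel (\<lambda>u. nsinc u * nsinc (u + d))"
  proof (rule Bochner_Integration.integrable_bound[of _ "\<lambda>u. (nsinc u)\<^sup>2 + (nsinc (u + d))\<^sup>2"])
    have "has_bochner_integral lborel (\<lambda>u. (nsinc (d + 1 * u))\<^sup>2) (1 /\<^sub>R \<bar>1\<bar>)"
      using has_bochner_integral_nsinc_squared by (subst (asm) lborel_has_bochner_integral_real_affine_iff[of 1 _ _ d]) auto
    then show "integrable lborel (\<lambda>u. (nsinc u)\<^sup>2 + (nsinc (u + d))\<^sup>2)"
      using has_bochner_integral_nsinc_squared by (auto simp: has_bochner_integral_iff add.commute)
    show "AE u in lborel. norm (nsinc u * nsinc (u + d)) \<le> norm ((nsinc u)\<^sup>2 + (nsinc (u + d))\<^sup>2)"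
    proof (rule AE_I2)
      fix u
      have "0 \<le> (\<bar>nsinc u\<bar> - \<bar>nsinc (u + d)\<bar>)\<^sup>2" by simp
      then have "2 * (\<bar>nsinc u\<bar> * \<bar>nsinc (u + d)\<bar>) \<le> (nsinc u)\<^sup>2 + (nsinc (u + d))\<^sup>2"
        by (simp add: power2_diff)
      moreover have "0 \<le> \<bar>nsinc u\<bar> * \<bar>nsinc (u + d)\<bar>" by simp
      ultimately have "\<bar>nsinc u\<bar> * \<bar>nsinc (u + d)\<bar> \<le> (nsinc u)\<^sup>2 + (nsinc (u + d))\<^sup>2"
        by linarith
      then show "norm (nsinc u * nsinc (u + d)) \<le> norm ((nsinc u)\<^sup>2 + (nsinc (u + d))\<^sup>2)"
        by (simp add: abs_mult)
    qed
  qed simp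
  have "(LBINT u=-\<infinity>..\<infinity>. nsinc u * nsinc (u + d)) = 0 - 0"
  proof (rule interval_integral_FTC_integrable[where F="?F"])
    show "set_integrable lborel (einterval (-\<infinity>) \<infinity>) (\<lambda>u. nsinc u * nsinc (u + d))"
      using int by (simp add: set_integrable_def)
    show "((?F \<circ> real_of_ereal) \<longlongrightarrow> 0) (at_right (-\<infinity>))" "((?F \<circ> real_of_ereal) \<longlongrightarrow> 0) (at_left \<infinity>)"
      using top bot by (simp_all add: ereal_tendsto_simps)
  qed (auto intro!: F continuous_intros)
  then show ?thesis
    using int by (simp add: has_bochner_integral_iff interval_lebesgue_integral_def set_lebesgue_integral_def)
qed

section \<open>Average transmit power\<close>

text \<open>The band starts at 0 instead of being centred, which produces the phase
  \<open>cis (pi * (B * u))\<close> of the mid frequency \<open>B / 2\<close>. Degenerate values are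
  split off because the antiderivative divides by \<open>u\<close>.\<close>

lemma integral_cis_eq_nsinc:
  assumes "0 \<le> B"
  shows "integral {0..B} (\<lambda>f. cis (2 * pi * f * u)) = complex_of_real B * (cis (pi * (B * u)) * complex_of_real (nsinc (B * u)))"
proof (cases "u = 0 \<or> B = 0")
  case True
  then show ?thesis using assms by (auto simp: scaleR_conv_of_real)
next
  case False
  then have u: "u \<noteq> 0" "B \<noteq> 0" by auto
  let ?w = "2 * pi * u"
  have "((\<lambda>f. cis (2 * pi * f * u)) has_integral (exp (\<i> * ?w * B) / (\<i> * ?w) - exp (\<i> * ?w * complex_of_real 0) / (\<i> * ?w))) {0..B}"
  proof (rule fundamental_theorem_of_calculus[OF assms])
    fix f
    have "((\<lambda>z. exp (\<i> * ?w * z) / (\<i> * ?w)) has_field_derivative exp (\<i> * ?w * complex_of_real f)) (at (complex_of_real f))"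
      using u by (auto intro!: derivative_eq_intros)
    then have "((\<lambda>f. exp (\<i> * ?w * complex_of_real f) / (\<i> * ?w)) has_vector_derivative exp (\<i> * ?w * complex_of_real f)) (at f within {0..B})"
      by (rule has_vector_derivative_real_field)
    then show "((\<lambda>f. exp (\<i> * ?w * complex_of_real f) / (\<i> * ?w)) has_vector_derivative cis (2 * pi * f * u)) (at f within {0..B})"
      by (simp add: cis_conv_exp mult_ac)
  qed
  then have "integral {0..B} (\<lambda>f. cis (2 * pi * f * u)) = (cis (2 * (pi * (B * u))) - 1) / (\<i> * ?w)"
    by (simp add: integral_unique cis_conv_exp diff_divide_distrib mult_ac)
  also have "cis (2 * (pi * (B * u))) - 1 = cis (pi * (B * u)) * (2 * \<i> * complex_of_real (sin (pi * (B * u))))"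
    by (simp add: complex_eq_iff cos_double sin_double power2_eq_square) (simp add: sin_squared_eq flip: power2_eq_square)
  also have "cis (pi * (B * u)) * (2 * \<i> * complex_of_real (sin (pi * (B * u)))) / (\<i> * ?w)
     = complex_of_real B * (cis (pi * (B * u)) * complex_of_real (nsinc (B * u)))"
    using u by (simp add: nsinc_nonzero)
  finally show ?thesis .
qed

lemma has_bochner_integral_nsinc_shifts:
  assumes "p - q \<in> \<int>"
  shows "has_bochner_integral lborel (\<lambda>v. nsinc (v - p) * nsinc (v - q)) (if p = q then 1 else 0)"
proof -
  have "has_bochner_integral lborel (\<lambda>u. nsinc u * nsinc (u + (p - q))) (if p = q then 1 else 0)"
    using has_bochner_integral_nsinc_squared has_bochner_integral_nsinc_orthogonal[of "p - q"] assms
    by (auto simp: power2_eq_square)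
  from this[unfolded lborel_has_bochner_integral_real_affine_iff[of 1 "\<lambda>u. nsinc u * nsinc (u + (p - q))" _ "- p", simplified]]
  show ?thesis
    by (simp add: algebra_simps)
qed

text \<open>In the product of term \<open>p\<close> with the conjugate of term \<open>q\<close> the
  phase is \<open>cis (pi * (r q - r p))\<close>, free of \<open>v\<close>, so the modulation does
  not disturb the orthonormality of the shifts and only diagonal terms survive.\<close>

lemma has_bochner_integral_nsinc_expansion:
  fixes r :: "'s \<Rightarrow> real" and c :: "'s \<Rightarrow> complex"
  assumes S: "finite S" "inj_on r S" and r: "\<And>p q. p \<in> S \<Longrightarrow> q \<in> S \<Longrightarrow> r p - r q \<in> \<int>"
  shows "has_bochner_integral lborel
    (\<lambda>v. (cmod (\<Sum>p\<in>S. c p * (cis (pi * (v - r p)) * complex_of_real (nsinc (v - r p)))))\<^sup>2) (\<Sum>p\<in>S. (cmod (c p))\<^sup>2)"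
proof -
  have pair: "has_bochner_integral lborel (\<lambda>v. complex_of_real (nsinc (v - r p) * nsinc (v - r q)))
      (complex_of_real (if p = q then 1 else 0))" if "p \<in> S" "q \<in> S" for p q
    using has_bochner_integral_of_real[OF has_bochner_integral_nsinc_shifts[OF r[OF that]], where 'a=complex] S(2) that
    by (simp add: inj_on_eq_iff)
  have "has_bochner_integral lborel (\<lambda>v. \<Sum>p\<in>S. \<Sum>q\<in>S. c p * cnj (c q) * cis (pi * (r q - r p)) * complex_of_real (nsinc (v - r p) * nsinc (v - r q)))
     (\<Sum>p\<in>S. \<Sum>q\<in>S. c p * cnj (c q) * cis (pi * (r q - r p)) * complex_of_real (if p = q then 1 else 0))"
    by (intro has_bochner_integral_sum has_bochner_integral_mult_right pair) auto
  also have "(\<Sum>p\<in>S. \<Sum>q\<in>S. c p * cnj (c q) * cis (pi * (r q - r p)) * complex_of_real (if p = q then 1 else 0)) = complex_of_real (\<Sum>p\<in>S. (cmod (c p))\<^sup>2)"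
    unfolding of_real_sum using S(1)
    by (intro sum.cong refl) (simp add: if_distrib complex_norm_square[symmetric] cong: if_cong)
  also have "(\<lambda>v. \<Sum>p\<in>S. \<Sum>q\<in>S. c p * cnj (c q) * cis (pi * (r q - r p)) * complex_of_real (nsinc (v - r p) * nsinc (v - r q)))
     = (\<lambda>v. complex_of_real ((cmod (\<Sum>p\<in>S. c p * (cis (pi * (v - r p)) * complex_of_real (nsinc (v - r p)))))\<^sup>2))"
  proof
    fix v
    have cis: "cis (pi * (r q - r p)) = cis (pi * (v - r p)) * cnj (cis (pi * (v - r q)))" for p q
      by (simp add: cis_cnj cis_mult algebra_simps)
    show "(\<Sum>p\<in>S. \<Sum>q\<in>S. c p * cnj (c q) * cis (pi * (r q - r p)) * complex_of_real (nsinc (v - r p) * nsinc (v - r q)))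
       = complex_of_real ((cmod (\<Sum>p\<in>S. c p * (cis (pi * (v - r p)) * complex_of_real (nsinc (v - r p)))))\<^sup>2)"
      unfolding complex_norm_square cnj_sum sum_product cis by (intro sum.cong refl) (simp add: mult_ac)
  qed
  finally show ?thesis
    using has_bochner_integral_Re by fastforce
qed

text \<open>In time units of \<open>T / M\<close> the pulse of slot \<open>n\<close> and delay
  \<open>l\<close> is a modulated sinc centred at \<open>l + n * M\<close>. Exchanging the sums
  collects all symbols with the same centre into one coefficient, a discrete Fourier transform over
  \<open>k\<close>.\<close>

lemma tx_signal_eq_nsinc_expansion:
  assumes "0 < M" "0 < N" "0 < T" "df = 1 / T"
  shows "tx_signal M N T df x \<omega> t = complex_of_real (real M / T) *
    (\<Sum>(n, l)\<in>{..<N} \<times> {..<M}. (complex_of_real (sqrt (T / (real M * real N))) * (\<Sum>k<N. cis (2 * pi * (real n * real k / real N)) * x k l \<omega>))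
      * (cis (pi * (real M / T * t - real (l + n * M))) * complex_of_real (nsinc (real M / T * t - real (l + n * M)))))"
proof -
  define g where "g n l = complex_of_real (real M / T) * (cis (pi * (real M / T * t - real (l + n * M))) * complex_of_real (nsinc (real M / T * t - real (l + n * M))))" for n l
  have "integral {0..real M * df} (\<lambda>f. cis (2 * pi * f * (t - real l * T / real M - real n * T))) = g n l" for l n
  proof -
    have "real M * df * (t - real l * T / real M - real n * T) = real M / T * t - real (l + n * M)"
      using assms(1-3) unfolding assms(4) by (simp add: field_simps)
    then show ?thesis
      using assms integral_cis_eq_nsinc[of "real M * df" "t - real l * T / real M - real n * T"] by (simp add: g_def)
  qed
  then have "tx_signal M N T df x \<omega> t = (\<Sum>k<N. \<Sum>l<M. \<Sum>n<N. complex_of_real (sqrt (T / (real M * real N))) * cis (2 * pi * (real n * real k / real N)) * x k l \<omega> * g n l)"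
    by (simp add: tx_signal_def dd_pulse_def sum_distrib_left mult_ac)
  also have "\<dots> = (\<Sum>k<N. \<Sum>n<N. \<Sum>l<M. complex_of_real (sqrt (T / (real M * real N))) * cis (2 * pi * (real n * real k / real N)) * x k l \<omega> * g n l)"
    by (rule sum.cong[OF refl]) (rule sum.swap)
  also have "\<dots> = (\<Sum>n<N. \<Sum>k<N. \<Sum>l<M. complex_of_real (sqrt (T / (real M * real N))) * cis (2 * pi * (real n * real k / real N)) * x k l \<omega> * g n l)"
    by (rule sum.swap)
  also have "\<dots> = (\<Sum>n<N. \<Sum>l<M. \<Sum>k<N. complex_of_real (sqrt (T / (real M * real N))) * cis (2 * pi * (real n * real k / real N)) * x k l \<omega> * g n l)"
    by (rule sum.cong[OF refl]) (rule sum.swap)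
  also have "\<dots> = (\<Sum>(n, l)\<in>{..<N} \<times> {..<M}. (complex_of_real (sqrt (T / (real M * real N))) * (\<Sum>k<N. cis (2 * pi * (real n * real k / real N)) * x k l \<omega>)) * g n l)"
    by (simp add: sum.cartesian_product[symmetric] sum_distrib_left sum_distrib_right mult_ac)
  finally show ?thesis
    unfolding g_def sum_distrib_left split_beta' by (simp add: mult_ac)
qed

text \<open>With \<open>B = M / T\<close>, the amplitude contributes \<open>B\<^sup>2\<close> and
  the substitution \<open>v = B t\<close> divides by \<open>B\<close>; the remaining
  \<open>B\<close> times the squared pulse normalisation \<open>T / (M N)\<close> is
  \<open>1 / N\<close>. The centres \<open>l + n * M\<close> are distinct because
  \<open>l < M\<close>.\<close>

lemma tx_signal_energy:
  assumes "0 < M" "0 < N" "0 < T" "df = 1 / T"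
  shows "(LINT t|lborel. (cmod (tx_signal M N T df x \<omega> t))\<^sup>2)
    = 1 / real N * (\<Sum>(n, l)\<in>{..<N} \<times> {..<M}. (cmod (\<Sum>k<N. cis (2 * pi * (real n * real k / real N)) * x k l \<omega>))\<^sup>2)"
proof -
  define B where "B = real M / T"
  have B: "0 < B" using assms by (simp add: B_def)
  define c where "c = (\<lambda>(n, l). complex_of_real (sqrt (T / (real M * real N))) * (\<Sum>k<N. cis (2 * pi * (real n * real k / real N)) * x k l \<omega>))"
  define r where "r = (\<lambda>(n, l). real (l + n * M))"
  have inj: "inj_on r ({..<N} \<times> {..<M})"
  proof (rule inj_onI, clarsimp simp: r_def)
    fix n l n' l' assume "l < M" "l' < M" "real l + real n * real M = real l' + real n' * real M"
    then have "l + n * M = l' + n' * M"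
      by (metis of_nat_add of_nat_eq_iff of_nat_mult)
    then show "n = n' \<and> l = l'"
      using \<open>l < M\<close> \<open>l' < M\<close> by (metis div_mult_self3 div_less mod_mult_self1 mod_less add_cancel_right_right gr_implies_not0 add.commute)
  qed
  have "has_bochner_integral lborel
    (\<lambda>v. (cmod (\<Sum>p\<in>{..<N} \<times> {..<M}. c p * (cis (pi * (v - r p)) * complex_of_real (nsinc (v - r p)))))\<^sup>2) (\<Sum>p\<in>{..<N} \<times> {..<M}. (cmod (c p))\<^sup>2)"
    by (rule has_bochner_integral_nsinc_expansion[OF _ inj]) (auto simp: r_def)
  then have "has_bochner_integral lborel
    (\<lambda>t. (cmod (\<Sum>p\<in>{..<N} \<times> {..<M}. c p * (cis (pi * (0 + B * t - r p)) * complex_of_real (nsinc (0 + B * t - r p)))))\<^sup>2) ((\<Sum>p\<in>{..<N} \<times> {..<M}. (cmod (c p))\<^sup>2) /\<^sub>R \<bar>B\<bar>)"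
    using B by (subst (asm) lborel_has_bochner_integral_real_affine_iff[of B _ _ 0]) auto
  then have "has_bochner_integral lborel
    (\<lambda>t. B\<^sup>2 * (cmod (\<Sum>p\<in>{..<N} \<times> {..<M}. c p * (cis (pi * (0 + B * t - r p)) * complex_of_real (nsinc (0 + B * t - r p)))))\<^sup>2) (B\<^sup>2 * ((\<Sum>p\<in>{..<N} \<times> {..<M}. (cmod (c p))\<^sup>2) /\<^sub>R \<bar>B\<bar>))"
    by (intro has_bochner_integral_mult_right) auto
  moreover have "(cmod (tx_signal M N T df x \<omega> t))\<^sup>2 = B\<^sup>2 * (cmod (\<Sum>p\<in>{..<N} \<times> {..<M}. c p * (cis (pi * (0 + B * t - r p)) * complex_of_real (nsinc (0 + B * t - r p)))))\<^sup>2" for t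
    unfolding tx_signal_eq_nsinc_expansion[OF assms] B_def[symmetric] c_def r_def using B
    by (simp add: norm_mult power_mult_distrib split_beta')
  ultimately have "(LINT t|lborel. (cmod (tx_signal M N T df x \<omega> t))\<^sup>2) = B\<^sup>2 * ((\<Sum>p\<in>{..<N} \<times> {..<M}. (cmod (c p))\<^sup>2) /\<^sub>R \<bar>B\<bar>)"
    by (simp add: has_bochner_integral_iff)
  also have "\<dots> = B * (\<Sum>p\<in>{..<N} \<times> {..<M}. (cmod (c p))\<^sup>2)"
    using B by (simp add: power2_eq_square)
  also have "\<dots> = (\<Sum>(n, l)\<in>{..<N} \<times> {..<M}. B * (T / (real M * real N)) * (cmod (\<Sum>k<N. cis (2 * pi * (real n * real k / real N)) * x k l \<omega>))\<^sup>2)"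
    using assms unfolding sum_distrib_left by (intro sum.cong refl) (auto simp: c_def norm_mult power_mult_distrib)
  also have "B * (T / (real M * real N)) = 1 / real N"
    using assms by (simp add: B_def)
  finally show ?thesis
    by (simp add: sum_distrib_left split_beta')
qed

text \<open>Each of the \<open>M N\<close> Fourier coefficients has mean square \<open>N P\<close>,
  whatever the unimodular weights, because distinct symbols are uncorrelated. The mean energy is
  thus \<open>M N P\<close>, and it is divided by \<open>N T\<close>.\<close>

lemma avg_tx_power_iid_gaussian:
  assumes "prob_space Om" and pos: "0 < M" "0 < N" "0 < T" and df: "df = 1 / T" and P: "0 < P"
    and x: "iid_complex_gaussian Om P {..<N} {..<M} x"
  shows "avg_tx_power Om M N T df x = P * real M / T"
proof -
  interpret prob_space Om by fact
  have g: "complex_gaussian Om P (x k l)" if "k < N" "l < M" for k l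
    using x that by (auto simp: iid_complex_gaussian_def)
  have ind: "indep_vars (\<lambda>_. borel) (\<lambda>(i, j). x i j) ({..<N} \<times> {..<M})"
    using x by (auto simp: iid_complex_gaussian_def)
  have cov: "has_bochner_integral Om (\<lambda>\<omega>. x k l \<omega> * cnj (x k' l \<omega>)) (if k = k' then complex_of_real P else 0)"
    if "k < N" "k' < N" "l < M" for k k' l
    using complex_gaussian_variance[OF P g, of k l] complex_gaussian_covariance[OF P P g g, of k l k' l]
      indep_vars_pair[OF ind, of "(k, l)" "(k', l)"] that by auto
  have E: "has_bochner_integral Om (\<lambda>\<omega>. (cmod (\<Sum>k<N. cis (\<theta> k) * x k l \<omega>))\<^sup>2) (real N * P)" if "l < M" for \<theta> l
  proof -
    have "has_bochner_integral Om (\<lambda>\<omega>. \<Sum>k<N. \<Sum>k'<N. cis (\<theta> k) * cnj (cis (\<theta> k')) * (x k l \<omega> * cnj (x k' l \<omega>)))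
       (\<Sum>k<N. \<Sum>k'<N. cis (\<theta> k) * cnj (cis (\<theta> k')) * (if k = k' then complex_of_real P else 0))"
      using that by (intro has_bochner_integral_sum has_bochner_integral_mult_right cov) auto
    also have "(\<lambda>\<omega>. \<Sum>k<N. \<Sum>k'<N. cis (\<theta> k) * cnj (cis (\<theta> k')) * (x k l \<omega> * cnj (x k' l \<omega>)))
      = (\<lambda>\<omega>. complex_of_real ((cmod (\<Sum>k<N. cis (\<theta> k) * x k l \<omega>))\<^sup>2))"
      unfolding complex_norm_square cnj_sum sum_product by (intro ext sum.cong refl) (simp add: mult_ac)
    also have "(\<Sum>k<N. \<Sum>k'<N. cis (\<theta> k) * cnj (cis (\<theta> k')) * (if k = k' then complex_of_real P else 0)) = complex_of_real (real N * P)"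
      by (simp add: if_distrib cis_cnj cis_mult cong: if_cong)
    finally show ?thesis
      using has_bochner_integral_Re by fastforce
  qed
  have "has_bochner_integral Om (\<lambda>\<omega>. 1 / real N * (\<Sum>p\<in>{..<N} \<times> {..<M}. (cmod (\<Sum>k<N. cis (2 * pi * (real (fst p) * real k / real N)) * x k (snd p) \<omega>))\<^sup>2))
     (1 / real N * (\<Sum>p\<in>{..<N} \<times> {..<M}. real N * P))"
    by (intro has_bochner_integral_sum has_bochner_integral_mult_right E) auto
  then have "expectation (\<lambda>\<omega>. LINT t|lborel. (cmod (tx_signal M N T df x \<omega> t))\<^sup>2) = real M * real N * P"
    using pos unfolding tx_signal_energy[OF pos df] by (simp add: has_bochner_integral_iff split_beta')
  then show ?thesis
    using pos by (simp add: avg_tx_power_def)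
qed

section \<open>Covariance of the ZAK noise\<close>

lemma mat_adjoint_eq_mat:
  fixes A :: "complex mat"
  assumes "A \<in> carrier_mat n n"
  shows "mat_adjoint A = mat n n (\<lambda>(i, j). cnj (A $$ (j, i)))"
  using assms unfolding mat_adjoint_def by (intro eq_matI) (auto simp: mat_of_rows_index)

lemma mat_adjoint_carrier [simp]:
  fixes A :: "complex mat"
  shows "A \<in> carrier_mat n n \<Longrightarrow> mat_adjoint A \<in> carrier_mat n n"
  by (simp add: mat_adjoint_eq_mat)

lemma mat_adjoint_dim:
  fixes A :: "complex mat"
  assumes "A \<in> carrier_mat n n"
  shows "dim_row (mat_adjoint A) = n" "dim_col (mat_adjoint A) = n"
  by (simp_all add: mat_adjoint_eq_mat[OF assms])

lemma mat_mult_index_sum: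
  assumes "A \<in> carrier_mat n n" "B \<in> carrier_mat n n" "i < n" "j < n"
  shows "(A * B) $$ (i, j) = (\<Sum>k<n. A $$ (i, k) * B $$ (k, j))"
  using assms by (auto simp: scalar_prod_def atLeast0LessThan intro!: sum.cong)

lemma mat_adjoint_mult:
  fixes A B :: "complex mat"
  assumes A: "A \<in> carrier_mat n n" and B: "B \<in> carrier_mat n n"
  shows "mat_adjoint (A * B) = mat_adjoint B * mat_adjoint A"
proof (rule eq_matI)
  have AB: "A * B \<in> carrier_mat n n" using A B by simp
  fix i j assume "i < dim_row (mat_adjoint B * mat_adjoint A)" "j < dim_col (mat_adjoint B * mat_adjoint A)"
  then have ij: "i < n" "j < n" using mat_adjoint_carrier[OF A] mat_adjoint_carrier[OF B] by auto
  have "(mat_adjoint B * mat_adjoint A) $$ (i, j) = (\<Sum>k<n. mat_adjoint B $$ (i, k) * mat_adjoint A $$ (k, j))"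
    by (rule mat_mult_index_sum[OF mat_adjoint_carrier[OF B] mat_adjoint_carrier[OF A] ij])
  also have "\<dots> = cnj ((A * B) $$ (j, i))"
    using ij unfolding mat_mult_index_sum[OF A B ij(2,1)]
    by (simp add: mat_adjoint_eq_mat[OF A] mat_adjoint_eq_mat[OF B] mult.commute)
  also have "\<dots> = mat_adjoint (A * B) $$ (i, j)"
    using ij by (simp add: mat_adjoint_eq_mat[OF AB] del: index_mult_mat)
  finally show "mat_adjoint (A * B) $$ (i, j) = (mat_adjoint B * mat_adjoint A) $$ (i, j)" ..
qed (use mat_adjoint_dim[OF A] mat_adjoint_dim[OF B] mat_adjoint_dim[of "A * B" n] A B in auto)

lemma mv_mat_mult:
  assumes "A \<in> carrier_mat n n" "B \<in> carrier_mat n n" "i < n"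
  shows "mv n (\<lambda>i j. (A * B) $$ (i, j)) v i = mv n (\<lambda>i j. A $$ (i, j)) (mv n (\<lambda>i j. B $$ (i, j)) v) i"
proof -
  have "mv n (\<lambda>i j. (A * B) $$ (i, j)) v i = (\<Sum>j<n. \<Sum>k<n. A $$ (i, k) * B $$ (k, j) * v j)"
    unfolding mv_def using assms by (intro sum.cong refl) (simp only: mat_mult_index_sum lessThan_iff sum_distrib_right)
  also have "\<dots> = (\<Sum>k<n. \<Sum>j<n. A $$ (i, k) * B $$ (k, j) * v j)"
    by (rule sum.swap)
  finally show ?thesis
    by (simp add: mv_def sum_distrib_left mult.assoc)
qed

lemma mv_one_mat: "i < n \<Longrightarrow> mv n (\<lambda>i j. 1\<^sub>m n $$ (i, j)) v i = v i"
  by (simp add: mv_def if_distrib if_distribR cong: if_cong)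

lemma div_mod_bij_betw:
  fixes M N :: nat
  assumes "0 < M"
  shows "bij_betw (\<lambda>p. (p div M, p mod M)) {..<M * N} ({..<N} \<times> {..<M})"
proof (rule bij_betwI[where g="\<lambda>(n, l). n * M + l"])
  show "(\<lambda>(n, l). n * M + l) \<in> {..<N} \<times> {..<M} \<rightarrow> {..<M * N}"
  proof clarsimp
    fix n l assume nl: "n < N" "l < M"
    have "n * M + l < Suc n * M" using nl by simp
    also have "\<dots> \<le> N * M" using nl by (intro mult_le_mono1) simp
    finally show "n * M + l < M * N" by (simp add: mult.commute)
  qed
qed (use assms in \<open>auto simp: less_mult_imp_div_less mult.commute\<close>)

lemma sum_div_mod:
  fixes M N :: nat
  assumes "0 < M"
  shows "(\<Sum>p<M * N. f (p div M) (p mod M)) = (\<Sum>n<N. \<Sum>l<M. f n l)"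
  using sum.reindex_bij_betw[OF div_mod_bij_betw[OF assms, of N], of "\<lambda>(n, l). f n l"]
  by (simp add: sum.cartesian_product)

text \<open>A geometric sum of powers of \<open>z\<close>, an \<open>N\<close>-th root of unity that
  equals 1 only for \<open>k = k'\<close>.\<close>

lemma sum_cis_roots_of_unity:
  assumes "0 < N" "k < N" "k' < N"
  shows "(\<Sum>n<N. cis (- 2 * pi * (real n * real k / real N)) * cnj (cis (- 2 * pi * (real n * real k' / real N))))
    = (if k = k' then of_nat N else 0)"
proof -
  define z where "z = cis (2 * pi * (real k' - real k) / real N)"
  have powers: "cis (- 2 * pi * (real n * real k / real N)) * cnj (cis (- 2 * pi * (real n * real k' / real N))) = z ^ n" for n
    unfolding z_def cis_cnj cis_mult Complex.DeMoivre
    by (intro arg_cong[where f=cis]) (simp add: diff_divide_distrib right_diff_distrib mult_ac)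
  have zN: "z ^ N = 1"
    using assms cis_multiple_2pi[of "real k' - real k"] unfolding z_def Complex.DeMoivre by simp
  have z1: "z = 1 \<longleftrightarrow> k = k'"
  proof -
    have c: "cis (2 * pi * real j / real N) = exp (2 * of_real pi * \<i> * of_nat j / of_nat N)" for j
      by (simp add: cis_conv_exp mult_ac)
    have "z = 1 \<longleftrightarrow> cis (2 * pi * real k' / real N) = cis (2 * pi * real k / real N)"
      by (simp add: z_def diff_divide_distrib right_diff_distrib flip: cis_divide)
    also have "\<dots> \<longleftrightarrow> k' mod N = k mod N"
      unfolding c using assms by (intro complex_root_unity_eq) simp
    finally show ?thesis using assms by auto
  qed
  show ?thesis
  proof (cases "k = k'")
    case True
    then show ?thesis unfolding powers using z1 by simp
  next
    case False
    then have "z \<noteq> 1" using z1 by simp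
    then show ?thesis
      unfolding powers using geometric_sum[of z N] zN False by simp
  qed
qed

text \<open>For each fixed delay, \<open>K\<close> is the block \<open>I + E / N\<close> with
  \<open>E\<close> the all-ones matrix of size \<open>N\<close>. Since \<open>E * E = N * E\<close>,
  its inverse is \<open>I - E / (2 * N)\<close>.\<close>

definition K_inv_mat :: "nat \<Rightarrow> nat \<Rightarrow> complex mat" where
  "K_inv_mat M N = mat (M * N) (M * N)
     (\<lambda>(p, q). if p mod M \<noteq> q mod M then 0 else (if p div M = q div M then 1 else 0) - 1 / (2 * of_nat N))"

lemma K_mat_carrier: "K_mat M N \<in> carrier_mat (M * N) (M * N)"
  and K_inv_mat_carrier: "K_inv_mat M N \<in> carrier_mat (M * N) (M * N)"
  by (simp_all add: K_mat_def K_inv_mat_def)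

lemma K_mat_index:
  "p < M * N \<Longrightarrow> q < M * N \<Longrightarrow> K_mat M N $$ (p, q) =
    (if p mod M = q mod M then (if p div M = q div M then 1 else 0) + 1 / of_nat N else 0)"
  by (simp add: K_mat_def)

lemma K_mat_mult_inv:
  assumes "0 < M" "0 < N"
  shows "K_mat M N * K_inv_mat M N = 1\<^sub>m (M * N)"
proof (rule eq_matI)
  fix p q assume "p < dim_row (1\<^sub>m (M * N) :: complex mat)" "q < dim_col (1\<^sub>m (M * N) :: complex mat)"
  then have pq: "p < M * N" "q < M * N" by auto
  let ?a = "\<lambda>n. (if p div M = n then 1 else 0) + 1 / of_nat N :: complex"
  let ?b = "\<lambda>n. (if n = q div M then 1 else 0) - 1 / (2 * of_nat N) :: complex"
  have k: "p div M < N" "q div M < N"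
    using pq by (simp_all add: less_mult_imp_div_less mult.commute)
  have l: "p mod M < M" "q mod M < M"
    using assms by simp_all
  have "(K_mat M N * K_inv_mat M N) $$ (p, q) = (\<Sum>r<M * N. K_mat M N $$ (p, r) * K_inv_mat M N $$ (r, q))"
    by (rule mat_mult_index_sum[OF K_mat_carrier K_inv_mat_carrier pq])
  also have "\<dots> = (\<Sum>r<M * N. (\<lambda>n l. if p mod M = l \<and> l = q mod M then ?a n * ?b n else 0) (r div M) (r mod M))"
    using pq by (intro sum.cong refl) (auto simp: K_mat_index K_inv_mat_def)
  also have "\<dots> = (\<Sum>n<N. \<Sum>l<M. if p mod M = l \<and> l = q mod M then ?a n * ?b n else 0)"
    by (rule sum_div_mod[OF assms(1)])
  also have "\<dots> = (\<Sum>n<N. if p mod M = q mod M then ?a n * ?b n else 0)"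
  proof (rule sum.cong[OF refl])
    fix n
    have "(\<Sum>l<M. if p mod M = l \<and> l = q mod M then ?a n * ?b n else 0)
       = (\<Sum>l<M. if l = p mod M then (if p mod M = q mod M then ?a n * ?b n else 0) else 0)"
      by (intro sum.cong) auto
    then show "(\<Sum>l<M. if p mod M = l \<and> l = q mod M then ?a n * ?b n else 0)
       = (if p mod M = q mod M then ?a n * ?b n else 0)"
      using l by simp
  qed
  also have "\<dots> = (if p mod M = q mod M then if p div M = q div M then 1 else 0 else 0)"
  proof -
    \<comment> \<open>Expanding leaves three terms supported at a single \<open>n\<close> each and a
      constant; after summation the corrections are
      \<open>- 1 / (2 * N) + 1 / N - 1 / (2 * N) = 0\<close>.\<close>
    have ab: "?a n * ?b n = (if n = p div M then if p div M = q div M then 1 else 0 else 0)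
        - (if n = p div M then 1 / (2 * of_nat N) else 0)
        + (if n = q div M then 1 / of_nat N else 0) - 1 / of_nat N * (1 / (2 * of_nat N))" for n
      by (auto simp: algebra_simps)
    have "(\<Sum>n<N. ?a n * ?b n) = (if p div M = q div M then 1 else 0)
        - 1 / (2 * of_nat N) + 1 / of_nat N - of_nat N * (1 / of_nat N * (1 / (2 * of_nat N)))"
      unfolding ab sum_subtractf sum.distrib using k by (simp del: times_divide_eq_left times_divide_eq_right)
    also have "\<dots> = (if p div M = q div M then 1 else 0)"
      using assms(2) by (simp add: field_simps)
    finally show ?thesis by simp
  qed
  also have "\<dots> = 1\<^sub>m (M * N) $$ (p, q)"
    using pq by auto (metis div_mult_mod_eq)
  finally show "(K_mat M N * K_inv_mat M N) $$ (p, q) = 1\<^sub>m (M * N) $$ (p, q)" .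
qed (auto simp: K_mat_def K_inv_mat_def)

text \<open>The sample at \<open>n' = N\<close> is added to the one at \<open>n' = 0\<close>, which doubles the variance there.\<close>

definition fold_weight :: "nat \<Rightarrow> real" where
  "fold_weight n = (if n = 0 then 2 else 1)"

text \<open>The folded sample in row \<open>n\<close> has variance \<open>s * fold_weight n\<close>;
  dividing by its root gives the unit-variance noise that the Gaussian channel expects.\<close>

definition folded_noise :: "real \<Rightarrow> nat \<Rightarrow> (nat \<Rightarrow> nat \<Rightarrow> 'a \<Rightarrow> complex) \<Rightarrow> nat \<times> nat \<Rightarrow> 'a \<Rightarrow> complex" where
  "folded_noise s N W p \<omega> = complex_of_real (1 / sqrt (s * fold_weight (fst p))) *
     (W (fst p) (snd p) \<omega> + (if fst p = 0 then W N (snd p) \<omega> else 0))"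

text \<open>A square root of the ZAK noise covariance: for each delay a Fourier matrix over
  \<open>n\<close>, whose columns carry the standard deviations that \<open>folded_noise\<close>
  divides out.\<close>

definition B_mat :: "nat \<Rightarrow> nat \<Rightarrow> real \<Rightarrow> real \<Rightarrow> complex mat" where
  "B_mat M N T s = mat (M * N) (M * N) (\<lambda>(p, q). if p mod M = q mod M then
     complex_of_real (sqrt T * sqrt (s * fold_weight (q div M)))
       * cis (- 2 * pi * (real (q div M) * real (p div M) / real N)) else 0)"

lemma B_mat_carrier: "B_mat M N T s \<in> carrier_mat (M * N) (M * N)"
  by (simp add: B_mat_def)

text \<open>With equal weights the roots of unity would give \<open>T s N\<close> times the
  identity. The surplus weight sits at \<open>n = 0\<close>, where all phases are 1, and so adds the
  constant \<open>T s\<close> to every entry with equal delays; relative to \<open>T s N\<close>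
  this is the \<open>1 / N\<close> of \<open>K\<close>.\<close>

lemma B_mat_adjoint:
  assumes "0 < M" "0 < N" "0 < T" "0 < s"
  shows "B_mat M N T s * mat_adjoint (B_mat M N T s) = complex_of_real (T * s * real N) \<cdot>\<^sub>m K_mat M N"
proof (rule eq_matI)
  fix p q assume "p < dim_row (complex_of_real (T * s * real N) \<cdot>\<^sub>m K_mat M N)" "q < dim_col (complex_of_real (T * s * real N) \<cdot>\<^sub>m K_mat M N)"
  then have pq: "p < M * N" "q < M * N" by (auto simp: K_mat_def)
  have k: "p div M < N" "q div M < N"
    using pq by (simp_all add: less_mult_imp_div_less mult.commute)
  have l: "p mod M < M" "q mod M < M"
    using assms by simp_all
  let ?c = "\<lambda>n. cis (- 2 * pi * (real n * real (p div M) / real N)) * cnj (cis (- 2 * pi * (real n * real (q div M) / real N)))"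
  let ?t = "\<lambda>n. complex_of_real (T * s * fold_weight n) * ?c n"
  have "(B_mat M N T s * mat_adjoint (B_mat M N T s)) $$ (p, q) = (\<Sum>r<M * N. B_mat M N T s $$ (p, r) * mat_adjoint (B_mat M N T s) $$ (r, q))"
    by (rule mat_mult_index_sum[OF B_mat_carrier mat_adjoint_carrier[OF B_mat_carrier] pq])
  also have "\<dots> = (\<Sum>r<M * N. (\<lambda>n l. if p mod M = l \<and> l = q mod M then ?t n else 0) (r div M) (r mod M))"
  proof (intro sum.cong refl)
    fix r assume r: "r \<in> {..<M * N}"
    have w: "0 \<le> s * fold_weight n" "0 \<le> T" for n
      using assms by (auto simp: fold_weight_def)
    have "complex_of_real (sqrt T * sqrt (s * fold_weight n)) * complex_of_real (sqrt T * sqrt (s * fold_weight n)) = complex_of_real (T * s * fold_weight n)" for n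
    proof -
      have "(sqrt T * sqrt (s * fold_weight n)) * (sqrt T * sqrt (s * fold_weight n)) = (sqrt T * sqrt T) * (sqrt (s * fold_weight n) * sqrt (s * fold_weight n))"
        by (simp only: mult_ac)
      also have "\<dots> = T * (s * fold_weight n)"
        using w by (simp only: real_sqrt_mult_self abs_of_nonneg)
      finally show ?thesis
        by (simp only: of_real_mult[symmetric] mult.assoc)
    qed
    then have sq: "complex_of_real (sqrt T * sqrt (s * fold_weight n)) * a * (complex_of_real (sqrt T * sqrt (s * fold_weight n)) * b) = complex_of_real (T * s * fold_weight n) * (a * b)" for n a b
      by (metis (no_types, lifting) mult.assoc mult.left_commute)
    show "B_mat M N T s $$ (p, r) * mat_adjoint (B_mat M N T s) $$ (r, q) = (\<lambda>n l. if p mod M = l \<and> l = q mod M then ?t n else 0) (r div M) (r mod M)"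
      unfolding mat_adjoint_eq_mat[OF B_mat_carrier] using pq r
      by (auto simp: B_mat_def sq[symmetric] simp del: of_real_mult)
  qed
  also have "\<dots> = (\<Sum>n<N. \<Sum>l<M. if p mod M = l \<and> l = q mod M then ?t n else 0)"
    by (rule sum_div_mod[OF assms(1)])
  also have "\<dots> = (\<Sum>n<N. if p mod M = q mod M then ?t n else 0)"
  proof (rule sum.cong[OF refl])
    fix n
    have "(\<Sum>l<M. if p mod M = l \<and> l = q mod M then ?t n else 0)
       = (\<Sum>l<M. if l = p mod M then (if p mod M = q mod M then ?t n else 0) else 0)"
      by (intro sum.cong) auto
    then show "(\<Sum>l<M. if p mod M = l \<and> l = q mod M then ?t n else 0)
       = (if p mod M = q mod M then ?t n else 0)"
      using l by simp
  qed
  also have "\<dots> = (if p mod M = q mod M then complex_of_real (T * s) * ((if p div M = q div M then of_nat N else 0) + 1) else 0)"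
  proof -
    have "(\<Sum>n<N. ?t n) = (\<Sum>n<N. complex_of_real (T * s) * ?c n + (if n = 0 then complex_of_real (T * s) else 0))"
      by (intro sum.cong refl) (auto simp: fold_weight_def)
    also have "\<dots> = complex_of_real (T * s) * (\<Sum>n<N. ?c n) + complex_of_real (T * s)"
      using assms(2) by (simp only: sum.distrib sum_distrib_left[symmetric]) simp
    also have "(\<Sum>n<N. ?c n) = (if p div M = q div M then of_nat N else 0)"
      by (rule sum_cis_roots_of_unity[OF assms(2) k])
    finally show ?thesis
      by (simp add: distrib_left)
  qed
  also have "\<dots> = (complex_of_real (T * s * real N) \<cdot>\<^sub>m K_mat M N) $$ (p, q)"
    using pq K_mat_carrier[of M N] assms(2) by (simp add: K_mat_index field_simps)
  finally show "(B_mat M N T s * mat_adjoint (B_mat M N T s)) $$ (p, q) = (complex_of_real (T * s * real N) \<cdot>\<^sub>m K_mat M N) $$ (p, q)" .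
qed (use B_mat_carrier[of M N T s] mat_adjoint_dim[OF B_mat_carrier[of M N T s]] K_mat_carrier[of M N] in auto)

text \<open>The explicit inverse serves to show that the determinant is nonzero; the matrix returned
  by Gauss-Jordan elimination is then handled through its defining product alone.\<close>

lemma inverse_K_mat:
  assumes "0 < M" "0 < N"
  shows "invertible_mat (K_mat M N)" and "the (mat_inverse (K_mat M N)) \<in> carrier_mat (M * N) (M * N)"
    and "the (mat_inverse (K_mat M N)) * K_mat M N = 1\<^sub>m (M * N)"
    and "Determinant.det (K_mat M N) \<noteq> 0"
proof -
  note K = K_mat_carrier[of M N] K_inv_mat_carrier[of M N]
  have "Determinant.det (K_mat M N) * Determinant.det (K_inv_mat M N) = 1"
    using det_mult[OF K] K_mat_mult_inv[OF assms] by simp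
  then show det: "Determinant.det (K_mat M N) \<noteq> 0" by auto
  have "K_mat M N \<in> Units (ring_mat TYPE(complex) (M * N) ())"
    by (rule det_non_zero_imp_unit[OF K(1) det])
  then obtain B where "mat_inverse (K_mat M N) = Some B"
    using mat_inverse(1)[OF K(1), where b="()"] by (metis option.exhaust)
  then show B: "the (mat_inverse (K_mat M N)) \<in> carrier_mat (M * N) (M * N)"
    and BK: "the (mat_inverse (K_mat M N)) * K_mat M N = 1\<^sub>m (M * N)"
    using mat_inverse(2)[OF K(1)] by auto
  have "K_mat M N * the (mat_inverse (K_mat M N)) = 1\<^sub>m (M * N)"
    using mat_mult_left_right_inverse[OF B K(1) BK] .
  then show "invertible_mat (K_mat M N)"
    using K(1) B BK unfolding invertible_mat_def inverts_mat_def
    by (intro conjI exI[of _ "the (mat_inverse (K_mat M N))"]) auto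
qed

section \<open>The channel in matrix form\<close>

lemma zak_noise_folded:
  assumes "0 < M" "0 < N" "0 < s" and p: "p < M * N"
  shows "zak_noise M N T w (p div M) (p mod M) \<omega> =
    mv (M * N) (\<lambda>i j. B_mat M N T s $$ (i, j)) (\<lambda>q. folded_noise s N (noise_sample M T w) (q div M, q mod M) \<omega>) p"
proof -
  let ?W = "\<lambda>n. noise_sample M T w n (p mod M) \<omega>"
  let ?c = "\<lambda>n. cis (- 2 * pi * (real n * real (p div M) / real N))"
  have l: "p mod M < M" using assms by simp
  have cN: "?c N = 1"
    using assms(2) cis_multiple_2pi[of "- real (p div M)"] by (simp add: mult_ac)
  have "zak_noise M N T w (p div M) (p mod M) \<omega> = complex_of_real (sqrt T) * ((\<Sum>n<N. ?W n * ?c n) + ?W N * ?c N)"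
    by (simp only: zak_noise_def lessThan_Suc_atMost[symmetric] sum.lessThan_Suc)
  also have "(\<Sum>n<N. ?W n * ?c n) + ?W N * ?c N = (\<Sum>n<N. (?W n + (if n = 0 then ?W N else 0)) * ?c n)"
  proof -
    have "(\<Sum>n<N. (?W n + (if n = 0 then ?W N else 0)) * ?c n) = (\<Sum>n<N. ?W n * ?c n + (if n = 0 then ?W N else 0))"
      by (intro sum.cong refl) (auto simp: distrib_right)
    then show ?thesis
      unfolding cN sum.distrib using assms(2) by simp
  qed
  also have "complex_of_real (sqrt T) * \<dots> = (\<Sum>n<N. complex_of_real (sqrt T * sqrt (s * fold_weight n)) * ?c n * folded_noise s N (noise_sample M T w) (n, p mod M) \<omega>)"
    unfolding sum_distrib_left
  proof (intro sum.cong refl)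
    fix n
    have "sqrt (s * fold_weight n) \<noteq> 0"
      using assms(3) by (simp add: fold_weight_def)
    then show "complex_of_real (sqrt T) * ((?W n + (if n = 0 then ?W N else 0)) * ?c n)
      = complex_of_real (sqrt T * sqrt (s * fold_weight n)) * ?c n * folded_noise s N (noise_sample M T w) (n, p mod M) \<omega>"
      by (simp add: folded_noise_def del: real_sqrt_eq_0_iff)
  qed
  also have "\<dots> = (\<Sum>n<N. \<Sum>l<M. if l = p mod M then complex_of_real (sqrt T * sqrt (s * fold_weight n)) * ?c n * folded_noise s N (noise_sample M T w) (n, l) \<omega> else 0)"
    using l by (intro sum.cong refl) simp
  also have "\<dots> = (\<Sum>q<M * N. (\<lambda>n l. if l = p mod M then complex_of_real (sqrt T * sqrt (s * fold_weight n)) * ?c n * folded_noise s N (noise_sample M T w) (n, l) \<omega> else 0) (q div M) (q mod M))"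
    by (rule sum_div_mod[OF assms(1), symmetric])
  also have "\<dots> = mv (M * N) (\<lambda>i j. B_mat M N T s $$ (i, j)) (\<lambda>q. folded_noise s N (noise_sample M T w) (q div M, q mod M) \<omega>) p"
    unfolding mv_def using p by (intro sum.cong refl) (auto simp: B_mat_def)
  finally show ?thesis .
qed

lemma zak_output_eq_mv:
  assumes "0 < M" "0 < N" "0 < s" and p: "p < M * N"
  shows "zak_output M N L T df h \<tau> \<nu> x w (p div M) (p mod M) \<omega> =
    mv (M * N) (\<lambda>i j. (complex_of_real (sqrt (real M * real N)) \<cdot>\<^sub>m H_mat M N L T df h \<tau> \<nu>) $$ (i, j)) (\<lambda>q. x (q div M) (q mod M) \<omega>) p
    + mv (M * N) (\<lambda>i j. B_mat M N T s $$ (i, j)) (\<lambda>q. folded_noise s N (noise_sample M T w) (q div M, q mod M) \<omega>) p"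
proof -
  have "complex_of_real (sqrt (real M * real N)) * (\<Sum>k<N. \<Sum>l<M. x k l \<omega> * dd_channel M N L T df h \<tau> \<nu> (p div M) (p mod M) k l)
     = complex_of_real (sqrt (real M * real N)) * (\<Sum>q<M * N. (\<lambda>k l. x k l \<omega> * dd_channel M N L T df h \<tau> \<nu> (p div M) (p mod M) k l) (q div M) (q mod M))"
    using sum_div_mod[OF assms(1), of "\<lambda>k l. x k l \<omega> * dd_channel M N L T df h \<tau> \<nu> (p div M) (p mod M) k l" N] by simp
  also have "\<dots> = mv (M * N) (\<lambda>i j. (complex_of_real (sqrt (real M * real N)) \<cdot>\<^sub>m H_mat M N L T df h \<tau> \<nu>) $$ (i, j)) (\<lambda>q. x (q div M) (q mod M) \<omega>) p"
    unfolding mv_def sum_distrib_left using p by (intro sum.cong refl) (auto simp: H_mat_def)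
  finally show ?thesis
    unfolding zak_output_def zak_noise_folded[OF assms] by simp
qed

text \<open>For \<open>n = 0\<close> the folded sample is a sum of two samples, distinct as
  \<open>N\<close> is positive and hence independent, of total variance
  \<open>s + s\<close>.\<close>

lemma (in prob_space) folded_noise_gaussian:
  assumes "0 < N" "0 < s" and W: "iid_complex_gaussian M s {..N} {..<K} W"
    and p: "p \<in> {..<N} \<times> {..<K}"
  shows "complex_gaussian M 1 (folded_noise s N W p)"
proof -
  obtain n l where nl: "p = (n, l)" "n < N" "l < K"
    using p by auto
  have g: "complex_gaussian M s (W n l)" if "n \<le> N" for n
    using W nl that by (auto simp: iid_complex_gaussian_def)
  have c: "0 < 1 / sqrt (s * fold_weight n)"
    using assms(2) by (simp add: fold_weight_def)
  have c2: "(1 / sqrt (s * fold_weight n))\<^sup>2 * (s * fold_weight n) = 1"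
    using assms(2) by (simp add: fold_weight_def power_divide)
  have "complex_gaussian M (s * fold_weight n) (\<lambda>\<omega>. W n l \<omega> + (if n = 0 then W N l \<omega> else 0))"
  proof (cases "n = 0")
    case True
    have "indep_var borel (W 0 l) borel (W N l)"
      using indep_vars_pair[of "\<lambda>_. borel" "\<lambda>(i, j). W i j" "{..N} \<times> {..<K}" "(0, l)" "(N, l)"] W nl assms(1)
      by (auto simp: iid_complex_gaussian_def)
    then have "complex_gaussian M (s + s) (\<lambda>\<omega>. W 0 l \<omega> + W N l \<omega>)"
      by (intro complex_gaussian_add g assms) auto
    then show ?thesis
      using True by (simp add: fold_weight_def mult.commute)
  next
    case False
    then show ?thesis
      using g[of n] nl by (simp add: fold_weight_def)
  qed
  from complex_gaussian_scale[OF _ c this] show ?thesis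
    unfolding c2 using assms(2) by (cases "n = 0") (simp_all add: folded_noise_def[abs_def] nl fold_weight_def)
qed

text \<open>Each folded variable is a function of its own block \<open>F p\<close> of original
  samples. The blocks are disjoint: the samples at \<open>N\<close> lie outside the range of
  \<open>n\<close>, and each is used only by row 0 of its delay.\<close>

lemma (in prob_space) folded_noise_indep:
  assumes N: "0 < N" and W: "iid_complex_gaussian M s {..N} {..<K} W"
  shows "indep_vars (\<lambda>_. borel) (folded_noise s N W) ({..<N} \<times> {..<K})"
proof -
  define F where "F p = (if fst p = 0 then {p, (N, snd p)} else {p})" for p :: "nat \<times> nat"
  define f where "f p v = complex_of_real (1 / sqrt (s * fold_weight (fst p))) * (v p + (if fst p = 0 then v (N, snd p) else 0))"
    for p :: "nat \<times> nat" and v :: "nat \<times> nat \<Rightarrow> complex"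
  have ind: "indep_vars (\<lambda>_. borel) (\<lambda>(i, j). W i j) ({..N} \<times> {..<K})"
    using W by (simp add: iid_complex_gaussian_def)
  have "indep_vars (\<lambda>p. PiM (F p) (\<lambda>_. borel)) (\<lambda>p \<omega>. restrict (\<lambda>q. (case q of (i, j) \<Rightarrow> W i j) \<omega>) (F p)) ({..<N} \<times> {..<K})"
    by (rule indep_vars_restrict[OF ind]) (auto simp: F_def disjoint_family_on_def)
  then have "indep_vars (\<lambda>_. borel) (\<lambda>p \<omega>. f p (restrict (\<lambda>q. (case q of (i, j) \<Rightarrow> W i j) \<omega>) (F p))) ({..<N} \<times> {..<K})"
  proof (rule indep_vars_compose2)
    fix p
    have "(\<lambda>v. v q) \<in> borel_measurable (PiM (F p) (\<lambda>_. borel :: complex measure))" if "q \<in> F p" for q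
      using that by (rule measurable_component_singleton)
    then show "f p \<in> borel_measurable (PiM (F p) (\<lambda>_. borel))"
      unfolding f_def by (cases "fst p = 0") (auto simp: F_def intro!: borel_measurable_times borel_measurable_add)
  qed
  also have "(\<lambda>p \<omega>. f p (restrict (\<lambda>q. (case q of (i, j) \<Rightarrow> W i j) \<omega>) (F p))) = folded_noise s N W"
    by (auto simp: fun_eq_iff f_def F_def folded_noise_def)
  finally show ?thesis .
qed

lemma (in prob_space) folded_noise_indep_input:
  assumes N: "0 < N"
    and indep: "indep_var S U (complex_vec_space {..N} {..<K}) (family_vec {..N} {..<K} W)"
  shows "indep_var S U (complex_vec_space {..<N} {..<K}) (\<lambda>\<omega>. \<lambda>p\<in>{..<N} \<times> {..<K}. folded_noise s N W p \<omega>)"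
proof -
  define f where "f v = (\<lambda>p\<in>{..<N} \<times> {..<K}. complex_of_real (1 / sqrt (s * fold_weight (fst p))) * (v p + (if fst p = 0 then v (N, snd p) else 0)))"
    for v :: "nat \<times> nat \<Rightarrow> complex"
  have comp: "(\<lambda>v. v q) \<in> borel_measurable (complex_vec_space {..N} {..<K})" if "q \<in> {..N} \<times> {..<K}" for q
    using that by (rule measurable_component_singleton)
  have f: "f \<in> complex_vec_space {..N} {..<K} \<rightarrow>\<^sub>M complex_vec_space {..<N} {..<K}"
    unfolding f_def
  proof (rule measurable_restrict)
    fix p assume "p \<in> {..<N} \<times> {..<K}"
    then show "(\<lambda>v. complex_of_real (1 / sqrt (s * fold_weight (fst p))) * (v p + (if fst p = 0 then v (N, snd p) else 0)))
        \<in> borel_measurable (complex_vec_space {..N} {..<K})"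
      using comp[of p] comp[of "(N, snd p)"]
      by (cases "fst p = 0") (auto intro!: borel_measurable_times borel_measurable_add)
  qed
  have "indep_var S ((\<lambda>v. v) \<circ> U) (complex_vec_space {..<N} {..<K}) (f \<circ> family_vec {..N} {..<K} W)"
    by (rule indep_var_compose[OF indep _ f]) simp
  moreover have "f (family_vec {..N} {..<K} W \<omega>) = (\<lambda>p\<in>{..<N} \<times> {..<K}. folded_noise s N W p \<omega>)" for \<omega>
    by (auto simp: fun_eq_iff f_def family_vec_def folded_noise_def restrict_def)
  ultimately show ?thesis
    by (simp add: comp_def)
qed

lemma family_vec_eq: "family_vec I J x = (\<lambda>\<omega>. \<lambda>p\<in>I \<times> J. x (fst p) (snd p) \<omega>)"
  by (auto simp: family_vec_def fun_eq_iff restrict_def)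

theorem theorem6:
  fixes Om :: "'a measure"
    and M N L :: nat
    and T df P N0 \<rho> :: real
    and h :: "nat \<Rightarrow> complex"
    and \<tau> \<nu> :: "nat \<Rightarrow> real"
    and x :: "nat \<Rightarrow> nat \<Rightarrow> 'a \<Rightarrow> complex"
    and w :: "real \<Rightarrow> 'a \<Rightarrow> complex"
  assumes "prob_space Om"
    and "M > 0" and "N > 0" and "L > 0"
    and "T > 0" and "df = 1 / T" and "P > 0" and "N0 > 0"
    and "\<And>i. i \<in> {1..L} \<Longrightarrow> 0 < \<tau> i \<and> \<tau> i < T"
    and symbols: "iid_complex_gaussian Om P {..<N} {..<M} x"
    and noise: "iid_complex_gaussian Om (N0 * real M * df) {..N} {..<M} (noise_sample M T w)"
    and independent: "prob_space.indep_var Om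
          (complex_vec_space {..<N} {..<M}) (family_vec {..<N} {..<M} x)
          (complex_vec_space {..N} {..<M}) (family_vec {..N} {..<M} (noise_sample M T w))"
    and snr: "\<rho> = avg_tx_power Om M N T df x / (N0 * real M * df)"
  shows "invertible_mat (K_mat M N) \<and>
         Im (Determinant.det (capacity_mat M N L T df h \<tau> \<nu> \<rho>)) = 0 \<and>
         Re (Determinant.det (capacity_mat M N L T df h \<tau> \<nu> \<rho>)) > 0 \<and>
         spectral_efficiency Om M N L T df h \<tau> \<nu> x w =
           1 / (real M * real N) *
           log 2 (Re (Determinant.det (capacity_mat M N L T df h \<tau> \<nu> \<rho>)))"
proof -
  interpret prob_space Om by fact
  define n where "n = M * N"
  define e where "e p = (p div M, p mod M)" for p
  define J where "J = e ` {..<n}"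
  define s where "s = N0 * real M * df"
  have s: "0 < s" using assms by (simp add: s_def)
  have n0: "0 < n" using assms by (simp add: n_def)
  have bij: "bij_betw e {..<n} ({..<N} \<times> {..<M})"
    unfolding e_def n_def by (rule div_mod_bij_betw) fact
  then have inj: "inj_on e {..<n}" and J: "J = {..<N} \<times> {..<M}"
    by (auto simp: bij_betw_def J_def)
  have eJ: "e i \<in> J" if "i < n" for i
    using that by (simp add: J_def)
  \<comment> \<open>The transmit power is \<open>P M / T\<close>, the noise power
    \<open>N0 M / T\<close>.\<close>
  have \<rho>: "\<rho> = P / N0"
    unfolding snr avg_tx_power_iid_gaussian[OF assms(1,2,3,5,6,7) symbols]
    using assms(2,5,8) by (simp add: assms(6))
  let ?H = "H_mat M N L T df h \<tau> \<nu>"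
  let ?B = "B_mat M N T s"
  let ?K = "K_mat M N"
  let ?Ki = "the (mat_inverse ?K)"
  let ?mv = "\<lambda>C. mv n (\<lambda>i j. C $$ (i, j))"
  have H: "?H \<in> carrier_mat n n" and B: "?B \<in> carrier_mat n n" and K: "?K \<in> carrier_mat n n"
    using B_mat_carrier K_mat_carrier by (simp_all add: H_mat_def n_def)
  note iK = inverse_K_mat[OF assms(2,3), folded n_def]
  \<comment> \<open>The scale of the noise covariance; with \<open>s = N0 M / T\<close> it equals
    \<open>N0 M N\<close>.\<close>
  define c where "c = complex_of_real (T * s * real N)"
  have c: "c = complex_of_real (N0 * real M * real N)" "c \<noteq> 0"
    using assms by (simp_all add: c_def s_def)
  have BB: "?B * mat_adjoint ?B = c \<cdot>\<^sub>m ?K"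
    unfolding c_def using assms s by (intro B_mat_adjoint) auto
  have "Determinant.det ?B * Determinant.det (mat_adjoint ?B) = c ^ n * Determinant.det ?K"
    using det_mult[OF B mat_adjoint_carrier[OF B]] BB K by (simp add: det_smult)
  then have "Determinant.det ?B \<noteq> 0"
    using c(2) iK(4) by auto
  from det_non_zero_imp_unit[OF B this] obtain R
    where R: "R \<in> carrier_mat n n" and RB: "R * ?B = 1\<^sub>m n" and BR: "?B * R = 1\<^sub>m n"
    unfolding Units_def by (auto simp: ring_mat_def)
  note adjs = mat_adjoint_carrier[OF B] mat_adjoint_carrier[OF R] mat_adjoint_carrier[OF H]
  \<comment> \<open>The channel matrix seen after whitening by \<open>R\<close>, the inverse of
    \<open>B\<close>, including the factor \<open>sqrt (M N)\<close> of the ZAK output.\<close>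
  define A where "A = complex_of_real (sqrt (real M * real N)) \<cdot>\<^sub>m (R * ?H)"
  have mc: "X * Y \<in> carrier_mat n n" if "X \<in> carrier_mat n n" "Y \<in> carrier_mat n n" for X Y :: "complex mat"
    using that by simp
  have assoc: "X * Y * Z = X * (Y * Z)" if "X \<in> carrier_mat n n" "Y \<in> carrier_mat n n" "Z \<in> carrier_mat n n" for X Y Z :: "complex mat"
    by (rule assoc_mult_mat[OF that])
  have sm1: "(k \<cdot>\<^sub>m X) * Y = k \<cdot>\<^sub>m (X * Y)" and sm2: "X * (k \<cdot>\<^sub>m Y) = k \<cdot>\<^sub>m (X * Y)"
    if "X \<in> carrier_mat n n" "Y \<in> carrier_mat n n" for X Y :: "complex mat" and k
    using mult_smult_assoc_mat[OF that] mult_smult_distrib[OF that] by simp_all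
  have RH: "R * ?H \<in> carrier_mat n n" using R H by simp
  \<comment> \<open>Inverting \<open>B B^H = c K\<close> gives this formula; it is verified by
    multiplying out.\<close>
  have Ki: "?Ki = c \<cdot>\<^sub>m (mat_adjoint R * R)"
  proof -
    have "(?B * mat_adjoint ?B) * (mat_adjoint R * R) = ?B * (mat_adjoint ?B * mat_adjoint R) * R"
      using B R adjs by (simp add: assoc mc)
    also have "mat_adjoint ?B * mat_adjoint R = 1\<^sub>m n"
      unfolding mat_adjoint_mult[OF R B, symmetric] RB by (subst mat_adjoint_eq_mat[of _ n]) auto
    also have "?B * 1\<^sub>m n * R = 1\<^sub>m n"
      using B BR by simp
    finally have "?K * (c \<cdot>\<^sub>m (mat_adjoint R * R)) = 1\<^sub>m n"
      unfolding BB using K R adjs by (simp add: sm1 sm2 mc)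
    then have "?Ki * (?K * (c \<cdot>\<^sub>m (mat_adjoint R * R))) = ?Ki"
      using iK(2) by simp
    then show ?thesis
      using iK(2,3) K R adjs left_mult_one_mat[of "c \<cdot>\<^sub>m (mat_adjoint R * R)" n n] by (simp add: assoc[symmetric] mc)
  qed
  have HKH: "mat_adjoint ?H * ?Ki * ?H = c \<cdot>\<^sub>m (mat_adjoint (R * ?H) * (R * ?H))"
    unfolding Ki mat_adjoint_mult[OF R H] using H R adjs
    by (simp add: assoc mc sm1 sm2)
  \<comment> \<open>\<open>A^H A\<close> is \<open>M N\<close> times \<open>(R H)^H (R H)\<close>,
    and \<open>H^H inverse(K) H\<close> is \<open>c\<close> times the same matrix; the two sides
    match because \<open>\<rho> * c = P M N\<close>.\<close>
  have cap: "capacity_mat M N L T df h \<tau> \<nu> \<rho> =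
     mat n n (\<lambda>(i, j). (if i = j then 1 else 0) + complex_of_real P * (\<Sum>k<n. cnj (A $$ (k, i)) * A $$ (k, j)))"
  proof (rule eq_matI)
    fix i j assume "i < dim_row (mat n n (\<lambda>(i, j). (if i = j then 1 else 0) + complex_of_real P * (\<Sum>k<n. cnj (A $$ (k, i)) * A $$ (k, j))))"
      "j < dim_col (mat n n (\<lambda>(i, j). (if i = j then 1 else 0) + complex_of_real P * (\<Sum>k<n. cnj (A $$ (k, i)) * A $$ (k, j))))"
    then have ij: "i < n" "j < n" by auto
    have "(mat_adjoint (R * ?H) * (R * ?H)) $$ (i, j) = (\<Sum>k<n. cnj ((R * ?H) $$ (k, i)) * (R * ?H) $$ (k, j))"
      unfolding mat_mult_index_sum[OF mat_adjoint_carrier[OF RH] RH ij]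
      using ij by (intro sum.cong refl) (simp add: mat_adjoint_eq_mat[OF RH] del: index_mult_mat)
    moreover have "(\<Sum>k<n. cnj (A $$ (k, i)) * A $$ (k, j)) = complex_of_real (real M * real N) * (\<Sum>k<n. cnj ((R * ?H) $$ (k, i)) * (R * ?H) $$ (k, j))"
      unfolding sum_distrib_left
    proof (intro sum.cong refl)
      fix k assume "k \<in> {..<n}"
      define r where "r = complex_of_real (sqrt (real M * real N))"
      have "cnj r = r" by (simp add: r_def)
      moreover from \<open>k \<in> {..<n}\<close> have "A $$ (k, i) = r * (R * ?H) $$ (k, i)" "A $$ (k, j) = r * (R * ?H) $$ (k, j)"
        using ij R H by (auto simp: A_def r_def simp del: index_mult_mat(1))
      moreover have "complex_of_real (real M * real N) = r * r"
        unfolding r_def of_real_mult[symmetric] by simp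
      ultimately show "cnj (A $$ (k, i)) * A $$ (k, j) = complex_of_real (real M * real N) * (cnj ((R * ?H) $$ (k, i)) * (R * ?H) $$ (k, j))"
        by (simp add: mult_ac del: index_mult_mat of_real_mult)
    qed
    moreover have "complex_of_real \<rho> * c = complex_of_real P * complex_of_real (real M * real N)"
      unfolding c(1) \<rho> of_real_mult[symmetric] using assms by simp
    ultimately show "capacity_mat M N L T df h \<tau> \<nu> \<rho> $$ (i, j) = mat n n (\<lambda>(i, j). (if i = j then 1 else 0) + complex_of_real P * (\<Sum>k<n. cnj (A $$ (k, i)) * A $$ (k, j))) $$ (i, j)"
      unfolding capacity_mat_def n_def[symmetric] HKH
      using ij mc[OF mat_adjoint_carrier[OF RH] RH]
      by (simp add: mult.assoc[symmetric] del: index_mult_mat)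
  qed (use H mat_adjoint_dim[OF H] in \<open>simp_all add: capacity_mat_def n_def\<close>)
  define X where "X = (\<lambda>(i, j). x i j)"
  define U where "U = folded_noise s N (noise_sample M T w)"
  \<comment> \<open>The whitened output. A label \<open>p\<close> is a pair, while the matrix needs
    its position, hence \<open>inv_into\<close>.\<close>
  define Y where "Y p \<omega> = mv n (\<lambda>i j. A $$ (i, j)) (\<lambda>j. X (e j) \<omega>) (inv_into {..<n} e p) + U p \<omega>" for p \<omega>
  have Xg: "\<And>p. p \<in> J \<Longrightarrow> complex_gaussian Om P (X p)" and Xi: "indep_vars (\<lambda>_. borel) X J"
    using symbols by (auto simp: iid_complex_gaussian_def X_def J)
  have fX: "family_vec {..<N} {..<M} x = (\<lambda>\<omega>. \<lambda>p\<in>J. X p \<omega>)"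
    by (simp add: family_vec_eq X_def J split_beta')
  have Ug: "\<And>p. p \<in> J \<Longrightarrow> complex_gaussian Om 1 (U p)" and Ui: "indep_vars (\<lambda>_. borel) U J"
    unfolding U_def J using folded_noise_gaussian[OF assms(3) s noise[folded s_def]]
      folded_noise_indep[OF assms(3) noise[folded s_def]] by auto
  have XU: "indep_var (PiM J (\<lambda>_. borel)) (\<lambda>\<omega>. \<lambda>p\<in>J. X p \<omega>) (PiM J (\<lambda>_. borel)) (\<lambda>\<omega>. \<lambda>p\<in>J. U p \<omega>)"
    using folded_noise_indep_input[OF assms(3) independent, of s] unfolding fX U_def[symmetric] J[symmetric] .
  have Y: "Y (e i) = (\<lambda>\<omega>. mv n (\<lambda>i j. A $$ (i, j)) (\<lambda>j. X (e j) \<omega>) i + U (e i) \<omega>)" if "i < n" for i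
    using that inj by (simp add: fun_eq_iff Y_def)
  obtain D where D: "0 < D"
    "Determinant.det (capacity_mat M N L T df h \<tau> \<nu> \<rho>) = complex_of_real D"
    "mutual_information 2 (PiM J (\<lambda>_. borel)) (PiM J (\<lambda>_. borel)) (\<lambda>\<omega>. \<lambda>p\<in>J. X p \<omega>) (\<lambda>\<omega>. \<lambda>p\<in>J. Y p \<omega>) = log 2 D"
    and ac: "absolutely_continuous
        (distr Om (PiM J (\<lambda>_. borel)) (\<lambda>\<omega>. \<lambda>p\<in>J. X p \<omega>) \<Otimes>\<^sub>M distr Om (PiM J (\<lambda>_. borel)) (\<lambda>\<omega>. \<lambda>p\<in>J. Y p \<omega>))
        (distr Om (PiM J (\<lambda>_. borel) \<Otimes>\<^sub>M PiM J (\<lambda>_. borel)) (\<lambda>\<omega>. (\<lambda>p\<in>J. X p \<omega>, \<lambda>p\<in>J. Y p \<omega>)))"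
    using mutual_information_gaussian_channel[OF n0 assms(7) inj Xg[unfolded J_def] Xi[unfolded J_def]
        Ug[unfolded J_def] Ui[unfolded J_def] XU[unfolded J_def] Y]
    unfolding cap J_def by blast
  \<comment> \<open>The action of a matrix on families labelled by pairs. Restriction to
    \<open>J\<close> keeps the values in the product space, so that two such families are equal once
    they agree at all \<open>e i\<close>.\<close>
  define g where "g C y = (\<lambda>p\<in>J. ?mv C (\<lambda>j. y (e j)) (inv_into {..<n} e p))" for C and y :: "nat \<times> nat \<Rightarrow> complex"
  have ge: "g C y (e i) = ?mv C (\<lambda>j. y (e j)) i" if "i < n" for C y i
    using that inj by (simp add: g_def eJ)
  have gm: "g C \<in> PiM J (\<lambda>_. borel) \<rightarrow>\<^sub>M PiM J (\<lambda>_. borel)" for C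
    unfolding g_def by (intro measurable_restrict borel_measurable_mv measurable_component_singleton eJ)
  have PiE_eq: "u = v" if "u \<in> extensional J" "v \<in> extensional J" "\<And>i. i < n \<Longrightarrow> u (e i) = v (e i)" for u v :: "nat \<times> nat \<Rightarrow> complex"
    using that by (auto intro!: extensionalityI[of u J v] simp: J_def)
  have g_inv: "g R (g ?B y) = y" if "y \<in> space (PiM J (\<lambda>_. borel))" for y
  proof (rule PiE_eq)
    show "y \<in> extensional J" using that by (auto simp: space_PiM PiE_def)
    fix i assume i: "i < n"
    have "g R (g ?B y) (e i) = ?mv R (?mv ?B (\<lambda>j. y (e j))) i"
      unfolding ge[OF i] by (rule mv_cong) (rule ge)
    also have "\<dots> = y (e i)"
      unfolding mv_mat_mult[OF R B i, symmetric] RB by (rule mv_one_mat[OF i])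
    finally show "g R (g ?B y) (e i) = y (e i)" .
  qed (simp add: g_def)
  \<comment> \<open>Multiplication by \<open>B\<close> undoes the whitening:
    \<open>B A = sqrt (M N) H\<close>, and \<open>B U\<close> is the ZAK noise.\<close>
  have zak: "family_vec {..<N} {..<M} (zak_output M N L T df h \<tau> \<nu> x w) \<omega> = g ?B (\<lambda>p\<in>J. Y p \<omega>)" for \<omega>
  proof (rule PiE_eq)
    fix i assume i: "i < n"
    let ?x = "\<lambda>j. X (e j) \<omega>" and ?u = "\<lambda>j. U (e j) \<omega>"
    have "g ?B (\<lambda>p\<in>J. Y p \<omega>) (e i) = ?mv ?B (\<lambda>j. ?mv A ?x j + ?u j) i"
      unfolding ge[OF i] by (rule mv_cong) (simp add: eJ Y)
    also have "\<dots> = ?mv ?B (?mv A ?x) i + ?mv ?B ?u i"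
      by (simp add: mv_def sum.distrib distrib_left)
    also have "?mv ?B (?mv A ?x) i = ?mv (?B * A) ?x i"
      by (rule mv_mat_mult[symmetric, OF B _ i]) (use RH in \<open>simp add: A_def\<close>)
    also have "?B * A = complex_of_real (sqrt (real M * real N)) \<cdot>\<^sub>m ?H"
      unfolding A_def using B R H BR by (simp add: sm2 mc assoc[symmetric])
    also have "?mv (complex_of_real (sqrt (real M * real N)) \<cdot>\<^sub>m ?H) ?x i + ?mv ?B ?u i
        = zak_output M N L T df h \<tau> \<nu> x w (i div M) (i mod M) \<omega>"
      unfolding zak_output_eq_mv[OF assms(2,3) s i[unfolded n_def]] by (simp add: e_def X_def U_def n_def)
    also have "\<dots> = family_vec {..<N} {..<M} (zak_output M N L T df h \<tau> \<nu> x w) \<omega> (e i)"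
      using eJ[OF i] unfolding family_vec_eq J[symmetric] by (simp add: e_def)
    finally show "family_vec {..<N} {..<M} (zak_output M N L T df h \<tau> \<nu> x w) \<omega> (e i) = g ?B (\<lambda>p\<in>J. Y p \<omega>) (e i)" ..
  qed (simp_all add: g_def family_vec_eq J)
  have Xm: "(\<lambda>\<omega>. \<lambda>p\<in>J. X p \<omega>) \<in> Om \<rightarrow>\<^sub>M PiM J (\<lambda>_. borel)"
    using complex_gaussian_measurable[OF Xg] by (intro measurable_restrict) auto
  have Ym: "(\<lambda>\<omega>. \<lambda>p\<in>J. Y p \<omega>) \<in> Om \<rightarrow>\<^sub>M PiM J (\<lambda>_. borel)"
    unfolding Y_def using complex_gaussian_measurable[OF Xg] complex_gaussian_measurable[OF Ug] eJ
    by (intro measurable_restrict borel_measurable_add borel_measurable_mv) auto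
  have "mutual_information 2 (PiM J (\<lambda>_. borel)) (PiM J (\<lambda>_. borel)) (family_vec {..<N} {..<M} x)
      (family_vec {..<N} {..<M} (zak_output M N L T df h \<tau> \<nu> x w)) = log 2 D"
  proof -
    have "mutual_information 2 (PiM J (\<lambda>_. borel)) (PiM J (\<lambda>_. borel)) (\<lambda>\<omega>. \<lambda>p\<in>J. X p \<omega>) (\<lambda>\<omega>. g ?B (\<lambda>p\<in>J. Y p \<omega>))
      = mutual_information 2 (PiM J (\<lambda>_. borel)) (PiM J (\<lambda>_. borel)) (\<lambda>\<omega>. \<lambda>p\<in>J. X p \<omega>) (\<lambda>\<omega>. \<lambda>p\<in>J. Y p \<omega>)"
      by (rule mutual_information_bimeasurable[OF Xm Ym gm[of ?B] gm[of R] _ ac]) (rule g_inv)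
    moreover have "family_vec {..<N} {..<M} (zak_output M N L T df h \<tau> \<nu> x w) = (\<lambda>\<omega>. g ?B (\<lambda>p\<in>J. Y p \<omega>))"
      by (rule ext) (rule zak)
    ultimately show ?thesis
      unfolding fX by (simp add: D(3))
  qed
  \<comment> \<open>The time-bandwidth product \<open>(N T) * (M df)\<close> is \<open>M N\<close>
    because \<open>T * df = 1\<close>.\<close>
  then have "spectral_efficiency Om M N L T df h \<tau> \<nu> x w = 1 / (real M * real N) * log 2 D"
    using assms(5,6) by (simp add: spectral_efficiency_def J mult.commute)
  then show ?thesis
    using D(1,2) iK(1) by simp
qed

end
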